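(* Let $v$ be a submultiplicative weight of polynomial growth on $\mathbb{R}^2$, and let $\mathcal{B}$ be a Banach space continuously embedded into the space $S'(\mathbb{R})$ of tempered distributions such that: (i) $\mathcal{B}$ is invariant under the $A$-time-frequency shifts $M_\omega^AT_x^A$, and $\|M_\omega^AT_x^Af\|_{\mathcal{B}}\le v(x,\omega)\|f\|_{\mathcal{B}}$ for all $f\in\mathcal{B}$ and all $(x,\omega)\in\mathbb{R}^2$; (ii) $M^1_{A,v}\cap\mathcal{B}\neq\{0\}$. Then $M^1_{A,v}$ is continuously embedded in $\mathcal{B}$.
   Context: $A=\{a,b,c,d,p,q\}$ are real parameters with $ad-bc=1$ and $b\neq 0$. A weight is a positive measurable function on $\mathbb{R}^2$; $v$ is submultiplicative if $v(x_1+x_2,\omega_1+\omega_2)\le v(x_1,\omega_1)v(x_2,\omega_2)$, and has polynomial growth if $v(x,\omega)\le C(1+|x|+|\omega|)^k$ for some $C>0,k\ge0$. $T_sf(t)=f(t-s)$, $M_sf(t)=e^{2\pi i st}f(t)$, $C_sf(t)=e^{\pi i s t^2}f(t)$, $\phi^{\checkmark}(t)=\phi(-t)$. The $A$-translation is $T_s^Af(t)=e^{-\frac{2\pi i a}{b}s(t-s)}f(t-s)$ and the $A$-modulation is $M_s^Af(t)=e^{\frac{\pi i}{b}(as^2-2ps+2st)}f(t)$; both are compositions of translations, modulations and unimodular scalars and act on $S'(\mathbb{R})$ accordingly. For $\Lambda\in S'(\mathbb{R})$ and $\phi\in S(\mathbb{R})$, $(\Lambda\star_A\phi)(x)=\frac{1}{\sqrt{|b|}}e^{-\frac{2\pi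 i a}{b}x^2}\Lambda\big(C_{2a/b}T_x^A\phi^{\checkmark}\big)$ (for functions, $(f\star_Ag)(x)=\frac{1}{\sqrt{|b|}}\int_{\mathbb{R}} f(s)T_s^Ag(x)\,ds$). Fix a nonzero $g\in S(\mathbb{R})$. $M^1_{A,v}$ is the space of $f\in S'(\mathbb{R})$ with $\|f\|_{M^1_{A,v}}=\int_{\mathbb{R}}\int_{\mathbb{R}}|f\star_AM_\omega^Ag(x)|\,v(x,\omega)\,dx\,d\omega<\infty$; different nonzero windows $g$ give the same space with equivalent norms. *)

theory Defs
  imports "HOL-Analysis.Analysis" "HOL-Library.Function_Algebras"
begin

section \<open>Complex function spaces and topologies given by seminorms\<close>

definition fscale :: "complex \<Rightarrow> ('a \<Rightarrow> complex) \<Rightarrow> 'a \<Rightarrow> complex"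
  where "fscale c f = (\<lambda>x. c * f x)"

global_interpretation cfun: vector_space "fscale :: complex \<Rightarrow> ('a \<Rightarrow> complex) \<Rightarrow> 'a \<Rightarrow> complex"
  by unfold_locales (auto simp: fscale_def fun_eq_iff algebra_simps)

definition seminorm_topology :: "'v::ab_group_add set \<Rightarrow> ('v \<Rightarrow> real) set \<Rightarrow> 'v topology"
  where "seminorm_topology V P = topology (\<lambda>U. U \<subseteq> V \<and>
    (\<forall>f\<in>U. \<exists>F e. finite F \<and> F \<subseteq> P \<and> 0 < e \<and> {h \<in> V. \<forall>r\<in>F. r (h - f) < e} \<subseteq> U))"

lemma openin_seminorm_topology:
  "openin (seminorm_topology V P) U \<longleftrightarrow> U \<subseteq> V \<and>
    (\<forall>f\<in>U. \<exists>F e. finite F \<and> F \<subseteq> P \<and> 0 < e \<and> {h \<in> V. \<forall>r\<in>F. r (h - f) < e} \<subseteq> U)"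
proof -
  let ?nb = "\<lambda>U f. \<exists>F e. finite F \<and> F \<subseteq> P \<and> 0 < e \<and> {h \<in> V. \<forall>r\<in>F. r (h - f) < e} \<subseteq> U"
  have inter: "?nb (S \<inter> T) f" if ST: "?nb S f" "?nb T f" for S T f
  proof -
    obtain F e G k where F: "finite F" "F \<subseteq> P" "0 < e" "{h \<in> V. \<forall>r\<in>F. r (h - f) < e} \<subseteq> S"
      and G: "finite G" "G \<subseteq> P" "0 < k" "{h \<in> V. \<forall>r\<in>G. r (h - f) < k} \<subseteq> T"
      using ST by blast
    have "{h \<in> V. \<forall>r\<in>F \<union> G. r (h - f) < min e k} \<subseteq> S \<inter> T"
      using F(4) G(4) by auto
    then show ?thesis
      using F(1-3) G(1-3) by (intro exI[of _ "F \<union> G"] exI[of _ "min e k"]) auto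
  qed
  have union: "?nb (\<Union>K) f" if "S \<in> K" "?nb S f" for S K f
    using that by (meson Union_upper order_trans)
  have "istopology (\<lambda>U. U \<subseteq> V \<and> (\<forall>f\<in>U. ?nb U f))"
    unfolding istopology_def
  proof (intro conjI allI impI)
    fix S T assume "S \<subseteq> V \<and> (\<forall>f\<in>S. ?nb S f)" "T \<subseteq> V \<and> (\<forall>f\<in>T. ?nb T f)"
    then show "S \<inter> T \<subseteq> V" "\<forall>f\<in>S \<inter> T. ?nb (S \<inter> T) f"
      using inter by (blast, simp)
  next
    fix K assume K: "\<forall>S\<in>K. S \<subseteq> V \<and> (\<forall>f\<in>S. ?nb S f)"
    then show "\<Union>K \<subseteq> V" by blast
    show "\<forall>f\<in>\<Union>K. ?nb (\<Union>K) f"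
    proof
      fix f assume "f \<in> \<Union>K"
      then obtain S where "S \<in> K" "f \<in> S" by blast
      with K union show "?nb (\<Union>K) f" by simp
    qed
  qed
  then show ?thesis
    by (simp add: seminorm_topology_def)
qed

lemma topspace_seminorm_topology: "topspace (seminorm_topology V P) = V"
proof (rule subset_antisym)
  show "topspace (seminorm_topology V P) \<subseteq> V"
    by (rule openin_seminorm_topology[THEN iffD1, THEN conjunct1]) (rule openin_topspace)
  have "openin (seminorm_topology V P) V"
    unfolding openin_seminorm_topology
  proof (intro conjI ballI subset_refl)
    fix f
    have "finite ({} :: ('a \<Rightarrow> real) set) \<and> {} \<subseteq> P \<and> (0::real) < 1 \<and>
        {h \<in> V. \<forall>r\<in>{} :: ('a \<Rightarrow> real) set. r (h - f) < 1} \<subseteq> V"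
      by simp
    then show "\<exists>F e. finite F \<and> F \<subseteq> P \<and> 0 < e \<and> {h \<in> V. \<forall>r\<in>F. r (h - f) < e} \<subseteq> V"
      by (intro exI[of _ "{}"] exI[of _ "1 :: real"])
  qed
  then show "V \<subseteq> topspace (seminorm_topology V P)"
    by (rule openin_subset)
qed

abbreviation norm_topology :: "'v::ab_group_add set \<Rightarrow> ('v \<Rightarrow> real) \<Rightarrow> 'v topology"
  where "norm_topology V N \<equiv> seminorm_topology V {N}"

definition continuously_embedded :: "'v topology \<Rightarrow> 'v topology \<Rightarrow> bool"
  where "continuously_embedded X Y \<longleftrightarrow>
    topspace X \<subseteq> topspace Y \<and> continuous_map X Y (\<lambda>x. x)"

definition complex_banach_space :: "('a \<Rightarrow> complex) set \<Rightarrow> (('a \<Rightarrow> complex) \<Rightarrow> real) \<Rightarrow> bool"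
  where "complex_banach_space V N \<longleftrightarrow>
    cfun.subspace V \<and>
    (\<forall>f\<in>V. 0 \<le> N f \<and> (N f = 0 \<longleftrightarrow> f = 0)) \<and>
    (\<forall>f\<in>V. \<forall>h\<in>V. N (f + h) \<le> N f + N h) \<and>
    (\<forall>c. \<forall>f\<in>V. N (fscale c f) = cmod c * N f) \<and>
    (\<forall>\<sigma>. range \<sigma> \<subseteq> V \<and> (\<forall>e>0. \<exists>K. \<forall>m\<ge>K. \<forall>n\<ge>K. N (\<sigma> m - \<sigma> n) < e) \<longrightarrow>
      (\<exists>f\<in>V. (\<lambda>n. N (\<sigma> n - f)) \<longlonglongrightarrow> 0))"


section \<open>Schwartz functions and tempered distributions on the real line\<close>

definition nth_deriv :: "nat \<Rightarrow> (real \<Rightarrow> complex) \<Rightarrow> real \<Rightarrow> complex"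
  where "nth_deriv n = (\<lambda>f t. vector_derivative f (at t)) ^^ n"

definition schwartz :: "(real \<Rightarrow> complex) set"
  where "schwartz = {f. (\<forall>n t. nth_deriv n f differentiable at t) \<and>
    (\<forall>k n. bounded (range (\<lambda>t. t ^ k *\<^sub>R nth_deriv n f t)))}"

definition schwartz_seminorm :: "nat \<Rightarrow> nat \<Rightarrow> (real \<Rightarrow> complex) \<Rightarrow> real"
  where "schwartz_seminorm k n f = (SUP t. norm (t ^ k *\<^sub>R nth_deriv n f t))"

definition schwartz_topology :: "(real \<Rightarrow> complex) topology"
  where "schwartz_topology = seminorm_topology schwartz (range (\<lambda>(k, n). schwartz_seminorm k n))"

type_synonym distribution = "(real \<Rightarrow> complex) \<Rightarrow> complex"

text \<open>A distribution is a total function here. Fixing the value 0 off the Schwartz space makes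
  equality of functions agree with equality of functionals, and keeps the set of tempered
  distributions closed under the pointwise operations.\<close>

definition tempered :: "distribution set"
  where "tempered = {\<Lambda>.
    (\<forall>\<phi>. \<phi> \<notin> schwartz \<longrightarrow> \<Lambda> \<phi> = 0) \<and>
    (\<forall>\<phi>\<in>schwartz. \<forall>\<psi>\<in>schwartz. \<Lambda> (\<phi> + \<psi>) = \<Lambda> \<phi> + \<Lambda> \<psi>) \<and>
    (\<forall>c. \<forall>\<phi>\<in>schwartz. \<Lambda> (fscale c \<phi>) = c * \<Lambda> \<phi>) \<and>
    continuous_map schwartz_topology euclidean \<Lambda>}"

text \<open>The weak-* topology.\<close>

definition tempered_topology :: "distribution topology"
  where "tempered_topology = seminorm_topology tempered ((\<lambda>\<phi> \<Lambda>. cmod (\<Lambda> \<phi>)) ` schwartz)"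


section \<open>Time-frequency operators\<close>

definition translation :: "real \<Rightarrow> (real \<Rightarrow> complex) \<Rightarrow> real \<Rightarrow> complex"
  where "translation s f = (\<lambda>t. f (t - s))"

definition modulation :: "real \<Rightarrow> (real \<Rightarrow> complex) \<Rightarrow> real \<Rightarrow> complex"
  where "modulation s f = (\<lambda>t. cis (2 * pi * s * t) * f t)"

definition chirp :: "real \<Rightarrow> (real \<Rightarrow> complex) \<Rightarrow> real \<Rightarrow> complex"
  where "chirp s f = (\<lambda>t. cis (pi * s * t\<^sup>2) * f t)"

definition reflection :: "(real \<Rightarrow> complex) \<Rightarrow> real \<Rightarrow> complex"
  where "reflection f = (\<lambda>t. f (- t))"

definition A_translation :: "real \<Rightarrow> real \<Rightarrow> real \<Rightarrow> (real \<Rightarrow> complex) \<Rightarrow> real \<Rightarrow> complex"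
  where "A_translation a b s f = (\<lambda>t. cis (- (2 * pi * a / b) * s * (t - s)) * f (t - s))"

definition A_modulation :: "real \<Rightarrow> real \<Rightarrow> real \<Rightarrow> real \<Rightarrow> (real \<Rightarrow> complex) \<Rightarrow> real \<Rightarrow> complex"
  where "A_modulation a b p s f =
    (\<lambda>t. cis (pi / b * (a * s\<^sup>2 - 2 * p * s + 2 * s * t)) * f t)"

lemma A_translation_eq:
  assumes "b \<noteq> 0"
  shows "A_translation a b s f =
    fscale (cis (2 * pi * a * s\<^sup>2 / b)) (modulation (- (a * s / b)) (translation s f))"
proof
  fix t
  have "- (2 * pi * a / b) * s * (t - s) = 2 * pi * a * s\<^sup>2 / b + 2 * pi * (- (a * s / b)) * t"
    using assms by (simp add: field_simps power2_eq_square)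
  then show "A_translation a b s f t =
      fscale (cis (2 * pi * a * s\<^sup>2 / b)) (modulation (- (a * s / b)) (translation s f)) t"
    unfolding A_translation_def modulation_def translation_def fscale_def
    by (simp only: cis_mult[symmetric] mult.assoc)
qed

lemma A_modulation_eq:
  assumes "b \<noteq> 0"
  shows "A_modulation a b p s f =
    fscale (cis (pi / b * (a * s\<^sup>2 - 2 * p * s))) (modulation (s / b) f)"
proof
  fix t
  have "pi / b * (a * s\<^sup>2 - 2 * p * s + 2 * s * t) =
      pi / b * (a * s\<^sup>2 - 2 * p * s) + 2 * pi * (s / b) * t"
    using assms by (simp add: field_simps)
  then show "A_modulation a b p s f t =
      fscale (cis (pi / b * (a * s\<^sup>2 - 2 * p * s))) (modulation (s / b) f) t"
    unfolding A_modulation_def modulation_def fscale_def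
    by (simp only: cis_mult[symmetric] mult.assoc)
qed

text \<open>The actions on distributions extend those on functions under the bilinear pairing
  \<open>\<phi> \<mapsto> \<integral> f t * \<phi> t dt\<close>, so translation by \<open>s\<close> moves to translation by \<open>- s\<close> of
  the test function while modulation keeps its sign. The A-versions follow the factorizations
  above.\<close>

definition translation_dist :: "real \<Rightarrow> distribution \<Rightarrow> distribution"
  where "translation_dist s \<Lambda> = (\<lambda>\<phi>. \<Lambda> (translation (- s) \<phi>))"

definition modulation_dist :: "real \<Rightarrow> distribution \<Rightarrow> distribution"
  where "modulation_dist s \<Lambda> = (\<lambda>\<phi>. \<Lambda> (modulation s \<phi>))"

definition A_translation_dist :: "real \<Rightarrow> real \<Rightarrow> real \<Rightarrow> distribution \<Rightarrow> distribution"
  where "A_translation_dist a b s \<Lambda> =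
    fscale (cis (2 * pi * a * s\<^sup>2 / b)) (modulation_dist (- (a * s / b)) (translation_dist s \<Lambda>))"

definition A_modulation_dist :: "real \<Rightarrow> real \<Rightarrow> real \<Rightarrow> real \<Rightarrow> distribution \<Rightarrow> distribution"
  where "A_modulation_dist a b p s \<Lambda> =
    fscale (cis (pi / b * (a * s\<^sup>2 - 2 * p * s))) (modulation_dist (s / b) \<Lambda>)"

definition A_convolution ::
    "real \<Rightarrow> real \<Rightarrow> distribution \<Rightarrow> (real \<Rightarrow> complex) \<Rightarrow> real \<Rightarrow> complex"
  where "A_convolution a b \<Lambda> \<phi> x =
    complex_of_real (1 / sqrt \<bar>b\<bar>) * cis (- (2 * pi * a / b) * x\<^sup>2) *
    \<Lambda> (chirp (2 * a / b) (A_translation a b x (reflection \<phi>)))"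


section \<open>Weights and the space M1\<close>

definition weight :: "(real \<times> real \<Rightarrow> real) \<Rightarrow> bool"
  where "weight v \<longleftrightarrow> v \<in> borel_measurable lebesgue \<and> (\<forall>z. 0 < v z)"

definition submultiplicative :: "(real \<times> real \<Rightarrow> real) \<Rightarrow> bool"
  where "submultiplicative v \<longleftrightarrow>
    (\<forall>x\<^sub>1 x\<^sub>2 \<omega>\<^sub>1 \<omega>\<^sub>2. v (x\<^sub>1 + x\<^sub>2, \<omega>\<^sub>1 + \<omega>\<^sub>2) \<le> v (x\<^sub>1, \<omega>\<^sub>1) * v (x\<^sub>2, \<omega>\<^sub>2))"

definition polynomial_growth :: "(real \<times> real \<Rightarrow> real) \<Rightarrow> bool"
  where "polynomial_growth v \<longleftrightarrow>
    (\<exists>C>0. \<exists>k\<ge>0. \<forall>x \<omega>. v (x, \<omega>) \<le> C * (1 + \<bar>x\<bar> + \<bar>\<omega>\<bar>) powr k)"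

definition M1_ennnorm ::
    "real \<Rightarrow> real \<Rightarrow> real \<Rightarrow> (real \<times> real \<Rightarrow> real) \<Rightarrow> (real \<Rightarrow> complex) \<Rightarrow> distribution \<Rightarrow> ennreal"
  where "M1_ennnorm a b p v g f =
    (\<integral>\<^sup>+\<omega>. (\<integral>\<^sup>+x. ennreal (cmod (A_convolution a b f (A_modulation a b p \<omega> g) x) * v (x, \<omega>))
      \<partial>lebesgue) \<partial>lebesgue)"

definition M1 ::
    "real \<Rightarrow> real \<Rightarrow> real \<Rightarrow> (real \<times> real \<Rightarrow> real) \<Rightarrow> (real \<Rightarrow> complex) \<Rightarrow> distribution set"
  where "M1 a b p v g = {f \<in> tempered. M1_ennnorm a b p v g f < \<infinity>}"

definition M1_norm ::
    "real \<Rightarrow> real \<Rightarrow> real \<Rightarrow> (real \<times> real \<Rightarrow> real) \<Rightarrow> (real \<Rightarrow> complex) \<Rightarrow> distribution \<Rightarrow> real"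
  where "M1_norm a b p v g f = enn2real (M1_ennnorm a b p v g f)"

end

theory Submission
  imports Defs "HOL-Probability.Probability" "HOL-Real_Asymp.Real_Asymp"
begin

text \<open>The substitution \<open>\<xi> = (\<omega> - a x) / b\<close> and the window \<open>G t = exp (2 \<pi> i a t\<^sup>2 / b) g (- t)\<close> turn
  \<open>f \<star>\<^sub>A M\<^sup>A\<^sub>\<omega> g\<close> into the ordinary short-time Fourier transform \<open>V f\<close>, up to unimodular factors, and the
  A-time-frequency shifts into the ordinary ones. A submultiplicative weight of polynomial growth is at
  least 1, so \<open>V f\<close> is integrable for \<open>f \<in> M1\<close> and \<open>f\<close> is a bounded continuous function. Hence
  \<open>h G * f = \<integral> V f z * shift z h dz\<close> for \<open>f, h \<in> M1\<close>, where \<open>h\<close> is taken in \<open>M1 \<inter> B\<close> and shifted so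
  that \<open>h G \<noteq> 0\<close>. Shifts act continuously on \<open>h\<close> in \<open>M1\<close>, so a finite Riemann sum \<open>s\<close> of this
  integral leaves an error of at most half the M1-norm of \<open>f\<close>, while \<open>N s\<close> is at most a constant
  times this norm. Iterating on \<open>f - s\<close> gives a series converging in \<open>B\<close>, whose sum is \<open>f\<close>
  because \<open>B\<close> embeds in the tempered distributions.\<close>

section \<open>Schwartz functions\<close>


text \<open>The element h is an arbitrary nonzero member of M1 and B, in general not a Schwartz
  function, so it can act as synthesis window only through the number \<open>h G\<close>, and the
  inversion identity must be proved for two rough factors. Their boundedness and continuity as
  functions permit Fubini and Fourier inversion in the frequency variable. Errors are never measured
  in B but on the transform side, in weighted L1. There the error of a Riemann sum is a twisted
  convolution of \<open>V f\<close> with two kinds of kernels: near the origin of phase space the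
  difference between \<open>V h\<close> and a small twisted translate of it, far away
  \<open>V h\<close> itself, paired with the tail of \<open>V f\<close>. Each part is made at most a
  quarter of |h G| times the norm of f; dividing by |h G| gives the half. The box, and with it the
  number of terms, depends on f, but the constant in front of the norm of f does not, and this
  uniformity is what the iteration needs. The remainders are known to be tempered with halved norm
  long before f is known to lie in B. That they vanish in the limit is therefore read off from the
  inversion identity, tested against one Schwartz function at a time.\<close>

abbreviation vderiv :: "(real \<Rightarrow> complex) \<Rightarrow> real \<Rightarrow> complex"
  where "vderiv f \<equiv> (\<lambda>t. vector_derivative f (at t))"

lemma nth_deriv_0 [simp]: "nth_deriv 0 f = f"
  by (simp add: nth_deriv_def)

lemma nth_deriv_Suc: "nth_deriv (Suc n) f = vderiv (nth_deriv n f)"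
  by (simp add: nth_deriv_def)

lemma nth_deriv_Suc2: "nth_deriv (Suc n) f = nth_deriv n (vderiv f)"
  unfolding nth_deriv_def by (simp only: funpow_Suc_right o_def)

text \<open>The seminorms are used pointwise in t, so estimates need no supremum and no proof that
  it is finite.\<close>

abbreviation wderiv :: "nat \<Rightarrow> nat \<Rightarrow> (real \<Rightarrow> complex) \<Rightarrow> real \<Rightarrow> real"
  where "wderiv k n f t \<equiv> \<bar>t\<bar> ^ k * norm (nth_deriv n f t)"

text \<open>Formulas for n-th derivatives of products or chirps are unwieldy. If a class of decaying
  functions is closed under one derivative, it contains all iterated derivatives of its members, so
  only first derivatives are ever computed.\<close>

lemma schwartz_coinduct:
  assumes "f \<in> X"
    and diff: "\<And>f t. f \<in> X \<Longrightarrow> f differentiable at t"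
    and bnd: "\<And>f k. f \<in> X \<Longrightarrow> \<exists>C. \<forall>t. \<bar>t\<bar> ^ k * norm (f t) \<le> C"
    and der: "\<And>f. f \<in> X \<Longrightarrow> vderiv f \<in> X"
  shows "f \<in> schwartz"
proof -
  have X: "nth_deriv n f \<in> X" for n
    by (induction n) (auto simp: nth_deriv_Suc der assms(1))
  show ?thesis
    unfolding schwartz_def bounded_iff mem_Collect_eq
    using diff[OF X] bnd[OF X] by (fastforce simp: power_abs)
qed

lemma schwartz_differentiable: "f \<in> schwartz \<Longrightarrow> f differentiable at t"
  unfolding schwartz_def by (metis (mono_tags, lifting) mem_Collect_eq nth_deriv_0)

lemma schwartz_has_vector_derivative:
  "f \<in> schwartz \<Longrightarrow> (f has_vector_derivative vderiv f t) (at t)"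
  using schwartz_differentiable vector_derivative_works by blast

lemma schwartz_vderiv: "f \<in> schwartz \<Longrightarrow> vderiv f \<in> schwartz"
  unfolding schwartz_def by (simp flip: nth_deriv_Suc2)

lemma schwartz_nth_deriv: "f \<in> schwartz \<Longrightarrow> nth_deriv n f \<in> schwartz"
  by (induction n) (auto simp: nth_deriv_Suc schwartz_vderiv)

lemma schwartz_continuous: "f \<in> schwartz \<Longrightarrow> continuous_on A f"
  by (meson differentiable_imp_continuous_within schwartz_differentiable
      continuous_at_imp_continuous_on)

lemma schwartz_bounded:
  assumes "f \<in> schwartz"
  obtains C where "C \<ge> 0" "\<And>t. \<bar>t\<bar> ^ k * norm (f t) \<le> C"
proof -
  have "bounded (range (\<lambda>t. t ^ k *\<^sub>R nth_deriv 0 f t))"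
    using assms unfolding schwartz_def by blast
  then obtain C where "\<And>t. \<bar>t\<bar> ^ k * norm (f t) \<le> C"
    unfolding bounded_iff by (auto simp: power_abs)
  then show ?thesis
    using that[of C] by (metis norm_ge_zero mult_nonneg_nonneg abs_ge_zero zero_le_power order_trans)
qed

text \<open>The seminorms with exponents 0 and k suffice because
  \<open>(1 + \<bar>t\<bar>) ^ k\<close> is at most \<open>2 ^ k * (1 + \<bar>t\<bar> ^ k)\<close>.
  Unlike \<bar>t\<bar>, the weight 1 + \<bar>t\<bar> is submultiplicative under addition, which is
  what translations require.\<close>

lemma schwartz_decay:
  assumes "f \<in> schwartz"
  obtains C where "C \<ge> 0" "\<And>t. norm (f t) * (1 + \<bar>t\<bar>) ^ k \<le> C"
proof -
  obtain C0 where C0: "C0 \<ge> 0" "\<And>t. \<bar>t\<bar> ^ 0 * norm (f t) \<le> C0"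
    using schwartz_bounded[OF assms] by blast
  obtain C1 where C1: "C1 \<ge> 0" "\<And>t. \<bar>t\<bar> ^ k * norm (f t) \<le> C1"
    using schwartz_bounded[OF assms] by blast
  have "norm (f t) * (1 + \<bar>t\<bar>) ^ k \<le> 2 ^ k * (C0 + C1)" for t
  proof -
    have "(1 + \<bar>t\<bar>) ^ k \<le> (2 * max 1 \<bar>t\<bar>) ^ k"
      by (rule power_mono) auto
    also have "\<dots> \<le> 2 ^ k * (1 + \<bar>t\<bar> ^ k)"
      by (auto simp: power_mult_distrib max_def)
    finally have "norm (f t) * (1 + \<bar>t\<bar>) ^ k \<le> norm (f t) * (2 ^ k * (1 + \<bar>t\<bar> ^ k))"
      by (rule mult_left_mono) auto
    also have "\<dots> = 2 ^ k * (norm (f t) + \<bar>t\<bar> ^ k * norm (f t))"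
      by (simp add: algebra_simps)
    also have "\<dots> \<le> 2 ^ k * (C0 + C1)"
      using C0(2)[of t] C1(2)[of t] by (intro mult_left_mono) auto
    finally show ?thesis .
  qed
  then show ?thesis using that[of "2 ^ k * (C0 + C1)"] C0(1) C1(1) by auto
qed

section \<open>Closure of the Schwartz space under algebraic operations\<close>

lemma schwartz_zero: "(\<lambda>t. 0) \<in> schwartz"
  by (rule schwartz_coinduct[where X = "{\<lambda>t. 0}"]) auto

lemma schwartz_add:
  assumes "f \<in> schwartz" "h \<in> schwartz"
  shows "(\<lambda>t. f t + h t) \<in> schwartz"
proof (rule schwartz_coinduct[where X = "{\<lambda>t. f t + h t |f h. f \<in> schwartz \<and> h \<in> schwartz}"])
  show "(\<lambda>t. f t + h t) \<in> {\<lambda>t. f t + h t |f h. f \<in> schwartz \<and> h \<in> schwartz}"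
    using assms by blast
next
  fix F assume "F \<in> {\<lambda>t. f t + h t |f h. f \<in> schwartz \<and> h \<in> schwartz}"
  then obtain f h where F: "F = (\<lambda>t. f t + h t)" and fh: "f \<in> schwartz" "h \<in> schwartz"
    by blast
  have der: "(F has_vector_derivative vderiv f t + vderiv h t) (at t)" for t
    unfolding F by (intro has_vector_derivative_add schwartz_has_vector_derivative fh)
  show "F differentiable at t" for t
    using der differentiableI_vector by blast
  show "\<exists>C. \<forall>t. \<bar>t\<bar> ^ k * norm (F t) \<le> C" for k
  proof -
    obtain C1 where C1: "\<And>t. \<bar>t\<bar> ^ k * norm (f t) \<le> C1"
      using schwartz_bounded[OF fh(1)] by blast
    obtain C2 where C2: "\<And>t. \<bar>t\<bar> ^ k * norm (h t) \<le> C2"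
      using schwartz_bounded[OF fh(2)] by blast
    have "\<bar>t\<bar> ^ k * norm (F t) \<le> C1 + C2" for t
    proof -
      have "\<bar>t\<bar> ^ k * norm (F t) \<le> \<bar>t\<bar> ^ k * (norm (f t) + norm (h t))"
        unfolding F by (intro mult_left_mono norm_triangle_ineq) auto
      then show ?thesis using C1[of t] C2[of t] by (simp add: algebra_simps)
    qed
    then show ?thesis by blast
  qed
  have "vderiv F = (\<lambda>t. vderiv f t + vderiv h t)"
    using der vector_derivative_at by blast
  then show "vderiv F \<in> {\<lambda>t. f t + h t |f h. f \<in> schwartz \<and> h \<in> schwartz}"
    by (intro CollectI exI conjI) (auto intro: schwartz_vderiv fh)
qed

lemma vderiv_add:
  "f \<in> schwartz \<Longrightarrow> h \<in> schwartz \<Longrightarrow> vderiv (\<lambda>t. f t + h t) = (\<lambda>t. vderiv f t + vderiv h t)"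
  by (intro ext vector_derivative_at has_vector_derivative_add schwartz_has_vector_derivative)

lemma nth_deriv_add:
  "f \<in> schwartz \<Longrightarrow> h \<in> schwartz \<Longrightarrow>
    nth_deriv n (\<lambda>t. f t + h t) = (\<lambda>t. nth_deriv n f t + nth_deriv n h t)"
  by (induction n arbitrary: f h) (simp_all add: nth_deriv_Suc2 vderiv_add schwartz_vderiv)

text \<open>Differentiating a product gives two products, so single products do not form a class
  closed under the derivative, but their finite sums do. This is the class to which the coinduction
  is applied.\<close>

inductive_set prod_sums :: "(real \<Rightarrow> complex) set" where
  prod: "f \<in> schwartz \<Longrightarrow> h \<in> schwartz \<Longrightarrow> (\<lambda>t. f t * h t) \<in> prod_sums"
| sum: "f \<in> prod_sums \<Longrightarrow> h \<in> prod_sums \<Longrightarrow> (\<lambda>t. f t + h t) \<in> prod_sums"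

lemma prod_sums_differentiable: "f \<in> prod_sums \<Longrightarrow> f differentiable at t"
proof (induction rule: prod_sums.induct)
  case (prod f h)
  show ?case
    by (rule differentiableI_vector[OF has_vector_derivative_mult[OF
            prod(1,2)[THEN schwartz_has_vector_derivative]]])
qed (rule differentiable_add)

lemma schwartz_mult:
  assumes "f \<in> schwartz" "h \<in> schwartz"
  shows "(\<lambda>t. f t * h t) \<in> schwartz"
proof (rule schwartz_coinduct[where X = prod_sums])
  show "(\<lambda>t. f t * h t) \<in> prod_sums"
    using assms by (rule prod_sums.prod)
next
  fix f assume "f \<in> prod_sums"
  then show "\<exists>C. \<forall>t. \<bar>t\<bar> ^ k * norm (f t) \<le> C" for k
  proof (induction rule: prod_sums.induct)
    case (prod f h)
    obtain C1 where C1: "\<And>t. \<bar>t\<bar> ^ k * norm (f t) \<le> C1" "C1 \<ge> 0"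
      using schwartz_bounded[OF prod(1)] by blast
    obtain C2 where C2: "\<And>t. \<bar>t\<bar> ^ 0 * norm (h t) \<le> C2"
      using schwartz_bounded[OF prod(2)] by blast
    have "\<bar>t\<bar> ^ k * norm (f t * h t) \<le> C1 * C2" for t
      using mult_mono[OF C1(1)[of t] C2(1)[of t]] C1(2) by (simp add: norm_mult mult.assoc)
    then show ?case by blast
  next
    case (sum f h)
    then obtain C1 C2 where C: "\<And>t. \<bar>t\<bar> ^ k * norm (f t) \<le> C1" "\<And>t. \<bar>t\<bar> ^ k * norm (h t) \<le> C2"
      by blast
    have "\<bar>t\<bar> ^ k * norm (f t + h t) \<le> C1 + C2" for t
    proof -
      have "\<bar>t\<bar> ^ k * norm (f t + h t) \<le> \<bar>t\<bar> ^ k * (norm (f t) + norm (h t))"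
        by (intro mult_left_mono norm_triangle_ineq) auto
      then show ?thesis using C(1)[of t] C(2)[of t] by (simp add: algebra_simps)
    qed
    then show ?case by blast
  qed
  from \<open>f \<in> prod_sums\<close> show "vderiv f \<in> prod_sums"
  proof (induction rule: prod_sums.induct)
    case (prod f h)
    have "vderiv (\<lambda>t. f t * h t) = (\<lambda>t. f t * vderiv h t + vderiv f t * h t)"
      by (intro ext vector_derivative_at has_vector_derivative_mult
          schwartz_has_vector_derivative prod)
    then show ?case
      by (simp add: prod_sums.intros prod schwartz_vderiv)
  next
    case (sum f h)
    have "vderiv (\<lambda>t. f t + h t) = (\<lambda>t. vderiv f t + vderiv h t)"
      using sum(1,2) by (intro ext vector_derivative_at has_vector_derivative_add)
        (auto simp flip: vector_derivative_works intro: prod_sums_differentiable)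
    then show ?case
      by (simp add: prod_sums.sum sum)
  qed
qed (rule prod_sums_differentiable)

lemma vderiv_mult:
  assumes "f \<in> schwartz" "h \<in> schwartz"
  shows "vderiv (\<lambda>t. f t * h t) = (\<lambda>t. f t * vderiv h t + vderiv f t * h t)"
  using assms
  by (intro ext vector_derivative_at has_vector_derivative_mult
          schwartz_has_vector_derivative)

lemma schwartz_scale:
  assumes "f \<in> schwartz"
  shows "(\<lambda>t. c * f t) \<in> schwartz"
proof (rule schwartz_coinduct[where X = "{\<lambda>t. c * f t |f. f \<in> schwartz}"])
  show "(\<lambda>t. c * f t) \<in> {\<lambda>t. c * f t |f. f \<in> schwartz}" using assms by blast
next
  fix F assume "F \<in> {\<lambda>t. c * f t |f. f \<in> schwartz}"
  then obtain f where F: "F = (\<lambda>t. c * f t)" and f: "f \<in> schwartz" by blast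
  have der: "(F has_vector_derivative c * vderiv f t) (at t)" for t
    unfolding F by (intro has_vector_derivative_mult_right
        schwartz_has_vector_derivative f)
  show "F differentiable at t" for t
    using der differentiableI_vector by blast
  have "vderiv F = (\<lambda>t. c * vderiv f t)"
    using der vector_derivative_at by blast
  then show "vderiv F \<in> {\<lambda>t. c * f t |f. f \<in> schwartz}"
    by (intro CollectI exI conjI) (auto intro: schwartz_vderiv f)
  show "\<exists>C. \<forall>t. \<bar>t\<bar> ^ k * norm (F t) \<le> C" for k
  proof -
    obtain C where "\<And>t. \<bar>t\<bar> ^ k * norm (f t) \<le> C"
      using schwartz_bounded[OF f] by blast
    then have "\<bar>t\<bar> ^ k * norm (F t) \<le> norm c * C" for t
      using mult_left_mono[of "\<bar>t\<bar> ^ k * norm (f t)" C "norm c"]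
      by (simp add: F norm_mult mult.left_commute)
    then show ?thesis by blast
  qed
qed

lemma vderiv_scale: "f \<in> schwartz \<Longrightarrow> vderiv (\<lambda>t. c * f t) = (\<lambda>t. c * vderiv f t)"
  by (intro ext vector_derivative_at has_vector_derivative_mult_right
      schwartz_has_vector_derivative)

lemma nth_deriv_scale:
  "f \<in> schwartz \<Longrightarrow> nth_deriv n (\<lambda>t. c * f t) = (\<lambda>t. c * nth_deriv n f t)"
  by (induction n arbitrary: f) (simp_all add: nth_deriv_Suc2 vderiv_scale schwartz_vderiv)

lemma schwartz_diff:
  assumes "f \<in> schwartz" "h \<in> schwartz"
  shows "(\<lambda>t. f t - h t) \<in> schwartz"
  using schwartz_add[OF assms(1) schwartz_scale[OF assms(2), of "-1"]] by simp

lemma nth_deriv_diff: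
  assumes "f \<in> schwartz" "h \<in> schwartz"
  shows "nth_deriv n (\<lambda>t. f t - h t) = (\<lambda>t. nth_deriv n f t - nth_deriv n h t)"
  using nth_deriv_add[OF assms(1) schwartz_scale[OF assms(2), of "-1"]]
    nth_deriv_scale[OF assms(2), of n "-1"] by simp

lemma schwartz_sum:
  "finite A \<Longrightarrow> (\<And>i. i \<in> A \<Longrightarrow> f i \<in> schwartz) \<Longrightarrow> (\<lambda>t. \<Sum>i\<in>A. f i t) \<in> schwartz"
  by (induction rule: finite_induct) (auto intro: schwartz_zero schwartz_add)

text \<open>The derivative of \<open>t * f t\<close> leaves an extra f behind, so the class for the
  coinduction carries a free Schwartz summand that absorbs it.\<close>

lemma schwartz_times_arg:
  assumes "f \<in> schwartz"
  shows "(\<lambda>t. of_real t * f t) \<in> schwartz"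
proof (rule schwartz_coinduct[where
      X = "{\<lambda>t. of_real t * f t + h t |f h. f \<in> schwartz \<and> h \<in> schwartz}"])
  show "(\<lambda>t. of_real t * f t)
      \<in> {\<lambda>t. of_real t * f t + h t |f h. f \<in> schwartz \<and> h \<in> schwartz}"
    by (intro CollectI exI[of _ f] exI[of _ "\<lambda>t. 0"]) (simp add: assms schwartz_zero)
next
  fix F :: "real \<Rightarrow> complex"
  assume "F \<in> {\<lambda>t. of_real t * f t + h t |f h. f \<in> schwartz \<and> h \<in> schwartz}"
  then obtain f h where F: "F = (\<lambda>t. of_real t * f t + h t)"
    and fh: "f \<in> schwartz" "h \<in> schwartz"
    by blast
  have der: "(F has_vector_derivative of_real t * vderiv f t + (f t + vderiv h t)) (at t)" for t
    unfolding F add.assoc[symmetric]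
    by (rule has_vector_derivative_eq_rhs[OF has_vector_derivative_add[OF
            has_vector_derivative_mult[OF has_vector_derivative_of_real[OF DERIV_ident]
              schwartz_has_vector_derivative[OF fh(1)]]
            schwartz_has_vector_derivative[OF fh(2)]]]) simp
  show "F differentiable at t" for t
    using der differentiableI_vector by blast
  show "\<exists>C. \<forall>t. \<bar>t\<bar> ^ k * norm (F t) \<le> C" for k
  proof -
    obtain C1 where C1: "\<And>t. \<bar>t\<bar> ^ Suc k * norm (f t) \<le> C1"
      using schwartz_bounded[OF fh(1)] by blast
    obtain C2 where C2: "\<And>t. \<bar>t\<bar> ^ k * norm (h t) \<le> C2"
      using schwartz_bounded[OF fh(2)] by blast
    have "\<bar>t\<bar> ^ k * norm (F t) \<le> C1 + C2" for t
    proof -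
      have "\<bar>t\<bar> ^ k * norm (F t) \<le> \<bar>t\<bar> ^ k * (norm (of_real t * f t) + norm (h t))"
        unfolding F by (intro mult_left_mono norm_triangle_ineq) auto
      then show ?thesis using C1[of t] C2[of t] by (simp add: algebra_simps norm_mult)
    qed
    then show ?thesis by blast
  qed
  have "vderiv F = (\<lambda>t. of_real t * vderiv f t + (f t + vderiv h t))"
    using der vector_derivative_at by blast
  moreover have "(\<lambda>t. f t + vderiv h t) \<in> schwartz"
    by (rule schwartz_add[OF fh(1) schwartz_vderiv[OF fh(2)]])
  ultimately show "vderiv F \<in> {\<lambda>t. of_real t * f t + h t |f h. f \<in> schwartz \<and> h \<in> schwartz}"
    using schwartz_vderiv[OF fh(1)] by fast
qed

lemma schwartz_cnj:
  assumes "f \<in> schwartz"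
  shows "(\<lambda>t. cnj (f t)) \<in> schwartz"
proof (rule schwartz_coinduct[where X = "{\<lambda>t. cnj (f t) |f. f \<in> schwartz}"])
  show "(\<lambda>t. cnj (f t)) \<in> {\<lambda>t. cnj (f t) |f. f \<in> schwartz}" using assms by blast
next
  fix F assume "F \<in> {\<lambda>t. cnj (f t) |f. f \<in> schwartz}"
  then obtain f where F: "F = (\<lambda>t. cnj (f t))" and f: "f \<in> schwartz" by blast
  have der: "(F has_vector_derivative cnj (vderiv f t)) (at t)" for t
    unfolding F by (intro has_vector_derivative_cnj schwartz_has_vector_derivative f)
  show "F differentiable at t" for t
    using der differentiableI_vector by blast
  have "vderiv F = (\<lambda>t. cnj (vderiv f t))"
    using der vector_derivative_at by blast
  then show "vderiv F \<in> {\<lambda>t. cnj (f t) |f. f \<in> schwartz}"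
    by (intro CollectI exI conjI) (auto intro: schwartz_vderiv f)
  show "\<exists>C. \<forall>t. \<bar>t\<bar> ^ k * norm (F t) \<le> C" for k
    unfolding F complex_mod_cnj using schwartz_bounded[OF f, of k] by blast
qed

section \<open>The basic character and chirped affine substitutions\<close>

definition echar :: "real \<Rightarrow> complex"
  where "echar x = cis (2 * pi * x)"

lemma norm_echar [simp]: "norm (echar x) = 1"
  by (simp add: echar_def)

lemma echar_0 [simp]: "echar 0 = 1"
  by (simp add: echar_def)

lemma echar_add: "echar (x + y) = echar x * echar y"
  by (simp add: echar_def cis_mult distrib_left)

lemma echar_has_vector_derivative:
  fixes f' :: real
  assumes "(f has_vector_derivative f') (at t within A)"
  shows "((\<lambda>t. echar (f t)) has_vector_derivative 2 * pi * \<i> * of_real f' * echar (f t))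
    (at t within A)"
proof -
  have "((\<lambda>t. 2 * pi * f t) has_real_derivative 2 * pi * f') (at t within A)"
    using assms by (intro DERIV_cmult) (simp add: has_real_derivative_iff_has_vector_derivative)
  then have "((\<lambda>t. \<i> * of_real (2 * pi * f t)) has_vector_derivative \<i> * of_real (2 * pi * f'))
      (at t within A)"
    by (intro has_vector_derivative_mult_right has_vector_derivative_of_real)
  from field_vector_diff_chain_within[OF this, of exp]
  have "((\<lambda>t. exp (\<i> * of_real (2 * pi * f t))) has_vector_derivative
      \<i> * of_real (2 * pi * f') * exp (\<i> * of_real (2 * pi * f t))) (at t within A)"
    by (auto simp: o_def intro!: has_field_derivative_at_within DERIV_exp)
  then show ?thesis
    by (simp add: echar_def cis_conv_exp mult_ac)
qed

lemma continuous_on_echar [continuous_intros]: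
  "continuous_on A f \<Longrightarrow> continuous_on A (\<lambda>x. echar (f x))"
  unfolding echar_def by (intro continuous_intros)

lemma measurable_echar [measurable]: "echar \<in> borel_measurable borel"
  by (intro borel_measurable_continuous_onI continuous_intros)

text \<open>One coinduction covers translations, modulations, chirps and reflections.\<close>

lemma schwartz_chirp_affine:
  assumes "f \<in> schwartz" and \<sigma>: "\<sigma> = 1 \<or> \<sigma> = -1"
  shows "(\<lambda>t. echar (\<alpha> * t\<^sup>2 + \<beta> * t) * f (\<sigma> * t + \<tau>)) \<in> schwartz"
proof (rule schwartz_coinduct[where
      X = "{\<lambda>t. echar (\<alpha> * t\<^sup>2 + \<beta> * t) * f (\<sigma> * t + \<tau>) |f. f \<in> schwartz}"])
  show "(\<lambda>t. echar (\<alpha> * t\<^sup>2 + \<beta> * t) * f (\<sigma> * t + \<tau>))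
      \<in> {\<lambda>t. echar (\<alpha> * t\<^sup>2 + \<beta> * t) * f (\<sigma> * t + \<tau>) |f. f \<in> schwartz}"
    using assms by blast
next
  fix F assume "F \<in> {\<lambda>t. echar (\<alpha> * t\<^sup>2 + \<beta> * t) * f (\<sigma> * t + \<tau>) |f. f \<in> schwartz}"
  then obtain f where F: "F = (\<lambda>t. echar (\<alpha> * t\<^sup>2 + \<beta> * t) * f (\<sigma> * t + \<tau>))"
    and f: "f \<in> schwartz" by blast
  \<comment> \<open>With s = \<sigma> t + \<tau> and \<sigma> squared equal to 1, t is \<sigma> (s -
    \<tau>). The slope 2 \<alpha> t + \<beta> of the phase thus becomes a polynomial in the argument
    s of f, and the derivative has the same shape as the original function, with h in place of
    f.\<close>
  define h where "h = (\<lambda>s. (2 * pi * \<i> * (2 * \<alpha> * \<sigma>)) * (of_real s * f s)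
    + ((2 * pi * \<i> * (\<beta> - 2 * \<alpha> * \<sigma> * \<tau>)) * f s + \<sigma> * vderiv f s))"
  have "h \<in> schwartz"
    unfolding h_def by (intro schwartz_add schwartz_scale schwartz_times_arg schwartz_vderiv f)
  have f': "((\<lambda>t. f (\<sigma> * t + \<tau>)) has_vector_derivative \<sigma> * vderiv f (\<sigma> * t + \<tau>)) (at t)" for t
  proof -
    have "((\<lambda>t. \<sigma> * t + \<tau>) has_vector_derivative \<sigma>) (at t)"
      by (auto intro!: derivative_eq_intros)
    from vector_diff_chain_at[OF this schwartz_has_vector_derivative[OF f]]
    show ?thesis by (simp add: o_def scaleR_conv_of_real)
  qed
  have q': "((\<lambda>t. \<alpha> * t\<^sup>2 + \<beta> * t) has_vector_derivative 2 * \<alpha> * t + \<beta>) (at t)" for t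
    by (simp flip: has_real_derivative_iff_has_vector_derivative)
      (auto intro!: derivative_eq_intros)
  have \<sigma>\<sigma>: "complex_of_real \<sigma> * (of_real \<sigma> * x) = x" for x
    using \<sigma> by auto
  have der: "(F has_vector_derivative echar (\<alpha> * t\<^sup>2 + \<beta> * t) * h (\<sigma> * t + \<tau>)) (at t)" for t
    unfolding F
    by (rule has_vector_derivative_eq_rhs[OF has_vector_derivative_mult[OF
            echar_has_vector_derivative[OF q'] f']])
      (simp add: h_def algebra_simps \<sigma>\<sigma>)
  show "F differentiable at t" for t
    using der differentiableI_vector by blast
  have "vderiv F = (\<lambda>t. echar (\<alpha> * t\<^sup>2 + \<beta> * t) * h (\<sigma> * t + \<tau>))"
    using der vector_derivative_at by blast
  then show "vderiv F \<in> {\<lambda>t. echar (\<alpha> * t\<^sup>2 + \<beta> * t) * f (\<sigma> * t + \<tau>) |f. f \<in> schwartz}"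
    by (intro CollectI exI conjI) (auto intro: \<open>h \<in> schwartz\<close>)
  show "\<exists>C. \<forall>t. \<bar>t\<bar> ^ k * norm (F t) \<le> C" for k
  proof -
    obtain C where C: "C \<ge> 0" "\<And>t. norm (f t) * (1 + \<bar>t\<bar>) ^ k \<le> C"
      using schwartz_decay[OF f] by blast
    have "\<bar>t\<bar> ^ k * norm (F t) \<le> (1 + \<bar>\<tau>\<bar>) ^ k * C" for t
    proof -
      have "\<bar>t\<bar> \<le> (1 + \<bar>\<tau>\<bar>) * (1 + \<bar>\<sigma> * t + \<tau>\<bar>)"
      proof -
        have "\<bar>t\<bar> = \<bar>\<sigma> * t\<bar>" using \<sigma> by auto
        also have "\<dots> \<le> \<bar>\<tau>\<bar> + \<bar>\<sigma> * t + \<tau>\<bar>" by linarith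
        also have "\<dots> \<le> (1 + \<bar>\<tau>\<bar>) * (1 + \<bar>\<sigma> * t + \<tau>\<bar>)" by (simp add: algebra_simps)
        finally show ?thesis .
      qed
      then have "\<bar>t\<bar> ^ k \<le> ((1 + \<bar>\<tau>\<bar>) * (1 + \<bar>\<sigma> * t + \<tau>\<bar>)) ^ k"
        by (intro power_mono) auto
      then have "\<bar>t\<bar> ^ k * norm (F t) \<le> ((1 + \<bar>\<tau>\<bar>) * (1 + \<bar>\<sigma> * t + \<tau>\<bar>)) ^ k * norm (f (\<sigma> * t + \<tau>))"
        by (simp add: F norm_mult mult_right_mono)
      also have "\<dots> = (1 + \<bar>\<tau>\<bar>) ^ k * (norm (f (\<sigma> * t + \<tau>)) * (1 + \<bar>\<sigma> * t + \<tau>\<bar>) ^ k)"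
        by (simp add: power_mult_distrib mult_ac)
      also have "\<dots> \<le> (1 + \<bar>\<tau>\<bar>) ^ k * C"
        by (intro mult_left_mono C) auto
      finally show ?thesis .
    qed
    then show ?thesis by blast
  qed
qed

lemma schwartz_translate: "f \<in> schwartz \<Longrightarrow> (\<lambda>t. f (t - x)) \<in> schwartz"
  using schwartz_chirp_affine[of f 1 0 0 "-x"] by simp

lemma schwartz_modulate: "f \<in> schwartz \<Longrightarrow> (\<lambda>t. echar (\<xi> * t) * f t) \<in> schwartz"
  using schwartz_chirp_affine[of f 1 0 \<xi> 0] by simp

section \<open>Time-frequency atoms\<close>


text \<open>The pairing of distributions with functions is bilinear, hence the negative frequency
  and the absence of a conjugate: evaluating at this atom is the short-time Fourier transform whose
  window is the complex conjugate of G.\<close>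

definition tf_atom :: "(real \<Rightarrow> complex) \<Rightarrow> real \<times> real \<Rightarrow> real \<Rightarrow> complex"
  where "tf_atom G z = (\<lambda>t. echar (- snd z * t) * G (t - fst z))"

abbreviation stft :: "(real \<Rightarrow> complex) \<Rightarrow> distribution \<Rightarrow> real \<times> real \<Rightarrow> complex"
  where "stft G f \<equiv> (\<lambda>z. f (tf_atom G z))"

definition tf_size :: "real \<times> real \<Rightarrow> real"
  where "tf_size z = 1 + \<bar>fst z\<bar> + \<bar>snd z\<bar>"

lemma tf_size_ge_1 [simp]: "1 \<le> tf_size z"
  by (simp add: tf_size_def)

lemma tf_size_pos [simp]: "0 < tf_size z" "0 \<le> tf_size z"
  using tf_size_ge_1[of z] by linarith+

lemma abs_fst_le: "\<bar>fst z - fst z'\<bar> \<le> dist z (z' :: real \<times> real)"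
  and abs_snd_le: "\<bar>snd z - snd z'\<bar> \<le> dist z (z' :: real \<times> real)"
  by (metis dist_real_def dist_fst_le, metis dist_real_def dist_snd_le)

text \<open>Each coordinate moves by at most 1, so the size grows by at most 2, and it is at least
  1.\<close>

lemma tf_size_near:
  assumes "dist z z' \<le> 1"
  shows "tf_size z' \<le> 3 * tf_size z"
  using abs_fst_le[of z z'] abs_snd_le[of z z'] assms by (simp add: tf_size_def)

lemma schwartz_tf_atom: "G \<in> schwartz \<Longrightarrow> tf_atom G z \<in> schwartz"
  unfolding tf_atom_def by (intro schwartz_modulate schwartz_translate)

lemma norm_tf_atom: "norm (tf_atom G z t) = norm (G (t - fst z))"
  by (simp add: tf_atom_def norm_mult)

lemma vderiv_tf_atom:
  assumes "G \<in> schwartz"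
  shows "vderiv (tf_atom G z) =
    (\<lambda>t. - (2 * pi * \<i> * of_real (snd z)) * tf_atom G z t + tf_atom (vderiv G) z t)"
proof (intro ext vector_derivative_at)
  fix t
  have 1: "((\<lambda>t. - snd z * t) has_vector_derivative - snd z) (at t)"
    unfolding has_real_derivative_iff_has_vector_derivative[symmetric]
    by (auto intro!: derivative_eq_intros)
  have "((\<lambda>t. t - fst z) has_vector_derivative 1) (at t)"
    by (auto intro!: derivative_eq_intros)
  from vector_diff_chain_at[OF this schwartz_has_vector_derivative[OF assms]]
  have 2: "((\<lambda>t. G (t - fst z)) has_vector_derivative vderiv G (t - fst z)) (at t)"
    by (simp add: o_def)
  show "(tf_atom G z has_vector_derivative
      - (2 * pi * \<i> * of_real (snd z)) * tf_atom G z t + tf_atom (vderiv G) z t) (at t)"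
    unfolding tf_atom_def
    by (rule has_vector_derivative_eq_rhs[OF has_vector_derivative_mult[OF
            echar_has_vector_derivative[OF 1] 2]]) (simp add: algebra_simps)
qed

text \<open>Differentiation reproduces the atom with a factor linear in the frequency and adds the
  atom of the differentiated window. Estimates on all derivatives follow by induction on n with the
  window left arbitrary.\<close>

lemma nth_deriv_tf_atom:
  assumes "G \<in> schwartz"
  shows "nth_deriv (Suc n) (tf_atom G z) =
    (\<lambda>t. - (2 * pi * \<i> * of_real (snd z)) * nth_deriv n (tf_atom G z) t + nth_deriv n (tf_atom (vderiv G) z) t)"
proof -
  note S = schwartz_tf_atom[OF assms] schwartz_tf_atom[OF schwartz_vderiv[OF assms]]
  show ?thesis
    unfolding nth_deriv_Suc2 vderiv_tf_atom[OF assms]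
      nth_deriv_add[OF schwartz_scale[OF S(1)] S(2)] nth_deriv_scale[OF S(1)] ..
qed

lemma abs_le_shift_product: "\<bar>t\<bar> \<le> (1 + \<bar>x\<bar>) * (1 + \<bar>t - x\<bar> :: real)"
proof -
  have "\<bar>t\<bar> \<le> \<bar>x\<bar> + \<bar>t - x\<bar>" by linarith
  also have "\<dots> \<le> (1 + \<bar>x\<bar>) * (1 + \<bar>t - x\<bar>)" by (simp add: algebra_simps)
  finally show ?thesis .
qed

lemma schwartz_translate_bound:
  assumes "G \<in> schwartz"
  obtains C where "C \<ge> 0" "\<And>x t. \<bar>t\<bar> ^ k * norm (G (t - x)) \<le> C * (1 + \<bar>x\<bar>) ^ k"
proof -
  obtain C where C: "C \<ge> 0" "\<And>t. norm (G t) * (1 + \<bar>t\<bar>) ^ k \<le> C"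
    using schwartz_decay[OF assms] by blast
  have "\<bar>t\<bar> ^ k * norm (G (t - x)) \<le> C * (1 + \<bar>x\<bar>) ^ k" for x t
  proof -
    have "\<bar>t\<bar> ^ k * norm (G (t - x)) \<le> ((1 + \<bar>x\<bar>) * (1 + \<bar>t - x\<bar>)) ^ k * norm (G (t - x))"
      by (intro mult_right_mono power_mono abs_le_shift_product) auto
    also have "\<dots> = (norm (G (t - x)) * (1 + \<bar>t - x\<bar>) ^ k) * (1 + \<bar>x\<bar>) ^ k"
      by (simp add: power_mult_distrib mult_ac)
    also have "\<dots> \<le> C * (1 + \<bar>x\<bar>) ^ k"
      by (intro mult_right_mono C) auto
    finally show ?thesis .
  qed
  then show ?thesis using that C(1) by blast
qed

text \<open>Every derivative costs at most one factor \<open>snd z\<close>, and every power of t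
  costs one factor 1 + \<bar>x\<bar> once t is compared with t - x. This accounts for the exponent k
  + n.\<close>

lemma tf_atom_bound:
  assumes "G \<in> schwartz"
  shows "\<exists>C\<ge>0. \<forall>z t. wderiv k n (tf_atom G z) t \<le> C * tf_size z ^ (k + n)"
  using assms
proof (induction n arbitrary: G)
  case 0
  obtain C where C: "C \<ge> 0" "\<And>x t. \<bar>t\<bar> ^ k * norm (G (t - x)) \<le> C * (1 + \<bar>x\<bar>) ^ k"
    using schwartz_translate_bound[OF 0] by blast
  have "\<bar>t\<bar> ^ k * norm (G (t - fst z)) \<le> C * tf_size z ^ k" for z t
  proof -
    have "C * (1 + \<bar>fst z\<bar>) ^ k \<le> C * tf_size z ^ k"
      by (intro mult_left_mono power_mono C) (auto simp: tf_size_def)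
    then show ?thesis using C(2)[of t "fst z"] by linarith
  qed
  then show ?case using C(1) by (auto simp: norm_tf_atom)
next
  case (Suc n)
  obtain C1 where C1: "C1 \<ge> 0"
    "\<And>z t. wderiv k n (tf_atom G z) t \<le> C1 * tf_size z ^ (k + n)"
    using Suc.IH[OF Suc.prems] by blast
  obtain C2 where C2: "C2 \<ge> 0"
    "\<And>z t. wderiv k n (tf_atom (vderiv G) z) t \<le> C2 * tf_size z ^ (k + n)"
    using Suc.IH[OF schwartz_vderiv[OF Suc.prems]] by blast
  have "wderiv k (Suc n) (tf_atom G z) t \<le> (2 * pi * C1 + C2) * tf_size z ^ (k + Suc n)"
    for z t
  proof -
    let ?A = "nth_deriv n (tf_atom G z) t" and ?B = "nth_deriv n (tf_atom (vderiv G) z) t"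
    have "norm (nth_deriv (Suc n) (tf_atom G z) t) \<le> 2 * pi * \<bar>snd z\<bar> * norm ?A + norm ?B"
      unfolding nth_deriv_tf_atom[OF Suc.prems]
      by (rule order_trans[OF norm_triangle_ineq]) (simp add: norm_mult)
    also have "\<dots> \<le> 2 * pi * tf_size z * norm ?A + tf_size z * norm ?B"
      using mult_right_mono[OF tf_size_ge_1[of z], of "norm ?B"]
      by (intro add_mono mult_right_mono mult_left_mono) (auto simp: tf_size_def)
    finally have "wderiv k (Suc n) (tf_atom G z) t
        \<le> \<bar>t\<bar> ^ k * (2 * pi * tf_size z * norm ?A + tf_size z * norm ?B)"
      by (rule mult_left_mono) auto
    also have "\<dots> = tf_size z * (2 * pi * (\<bar>t\<bar> ^ k * norm ?A) + \<bar>t\<bar> ^ k * norm ?B)"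
      by (simp add: algebra_simps)
    also have "\<dots> \<le> tf_size z * (2 * pi * (C1 * tf_size z ^ (k + n)) + C2 * tf_size z ^ (k + n))"
      by (intro mult_left_mono add_mono C1 C2) auto
    also have "\<dots> = (2 * pi * C1 + C2) * tf_size z ^ (k + Suc n)"
      by (simp add: algebra_simps)
    finally show ?thesis .
  qed
  moreover have "2 * pi * C1 + C2 \<ge> 0" using C1(1) C2(1) by auto
  ultimately show ?case by blast
qed

section \<open>Lipschitz dependence of atoms on the phase-space point\<close>

lemma norm_echar_diff_le: "norm (echar a - echar b) \<le> 2 * pi * \<bar>a - b\<bar>"
proof -
  have "echar a - echar b = echar b * (exp (\<i> * of_real (2 * pi * (a - b))) - 1)"
    using echar_add[of b "a - b"] by (simp add: echar_def cis_conv_exp algebra_simps)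
  then have "norm (echar a - echar b) = 2 * \<bar>sin (2 * pi * (a - b) / 2)\<bar>"
    by (simp add: norm_mult dist_exp_i_1 del: of_real_mult of_real_diff)
  also have "\<dots> \<le> 2 * \<bar>2 * pi * (a - b) / 2\<bar>"
    by (intro mult_left_mono abs_sin_x_le_abs_x) auto
  finally show ?thesis by (simp add: abs_mult)
qed

text \<open>The mean value inequality is applied in the translation variable, with the power of t
  frozen. At an intermediate point y one has 1 + \<bar>y\<bar> \<le> 2 (1 + \<bar>x\<bar>), which is
  the origin of \<open>2 ^ k\<close>.\<close>

lemma schwartz_translate_lipschitz:
  assumes "G \<in> schwartz"
  obtains C where "C \<ge> 0" "\<And>x x' t. \<bar>x - x'\<bar> \<le> 1 \<Longrightarrow>
    \<bar>t\<bar> ^ k * norm (G (t - x) - G (t - x')) \<le> C * \<bar>x - x'\<bar> * (1 + \<bar>x\<bar>) ^ k"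
proof -
  obtain C where C: "C \<ge> 0" "\<And>x t. \<bar>t\<bar> ^ k * norm (vderiv G (t - x)) \<le> C * (1 + \<bar>x\<bar>) ^ k"
    using schwartz_translate_bound[OF schwartz_vderiv[OF assms]] by blast
  have "\<bar>t\<bar> ^ k * norm (G (t - x) - G (t - x')) \<le> (C * 2 ^ k) * \<bar>x - x'\<bar> * (1 + \<bar>x\<bar>) ^ k"
    if x: "\<bar>x - x'\<bar> \<le> 1" for x x' t
  proof -
    define H where "H = (\<lambda>y. of_real (\<bar>t\<bar> ^ k) * G (t - y))"
    have H': "(H has_vector_derivative - (of_real (\<bar>t\<bar> ^ k) * vderiv G (t - y))) (at y)" for y
    proof -
      have "((\<lambda>y. t - y) has_vector_derivative - 1) (at y)"
        by (auto intro!: derivative_eq_intros)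
      from vector_diff_chain_at[OF this schwartz_has_vector_derivative[OF assms]]
      have "((\<lambda>y. G (t - y)) has_vector_derivative - vderiv G (t - y)) (at y)"
        by (simp add: o_def)
      from has_vector_derivative_mult_right[OF this] show ?thesis
        unfolding H_def by simp
    qed
    have "norm (H x - H x') \<le> (C * 2 ^ k * (1 + \<bar>x\<bar>) ^ k) * norm (x - x')"
    proof (rule differentiable_bound)
      show "convex {min x x'..max x x'}" by simp
      show "x \<in> {min x x'..max x x'}" "x' \<in> {min x x'..max x x'}" by auto
      fix y assume y: "y \<in> {min x x'..max x x'}"
      show "(H has_derivative (\<lambda>h. h *\<^sub>R - (of_real (\<bar>t\<bar> ^ k) * vderiv G (t - y))))
          (at y within {min x x'..max x x'})"
        using H'[of y] unfolding has_vector_derivative_def by (rule has_derivative_at_withinI)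
      have "norm (of_real (\<bar>t\<bar> ^ k) * vderiv G (t - y)) \<le> C * (1 + \<bar>y\<bar>) ^ k"
        using C(2)[of t y] by (simp add: norm_mult norm_power)
      also have "\<dots> \<le> C * (2 * (1 + \<bar>x\<bar>)) ^ k"
        using x y C(1) by (intro mult_left_mono power_mono) (auto simp: min_def max_def split: if_splits)
      finally have *: "norm (of_real (\<bar>t\<bar> ^ k) * vderiv G (t - y)) \<le> C * 2 ^ k * (1 + \<bar>x\<bar>) ^ k"
        unfolding power_mult_distrib by (simp only: mult.assoc)
      show "onorm (\<lambda>h. h *\<^sub>R - (of_real (\<bar>t\<bar> ^ k) * vderiv G (t - y))) \<le> C * 2 ^ k * (1 + \<bar>x\<bar>) ^ k"
        using * by (subst onorm_scaleR_left) (auto simp: onorm_id)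
    qed
    moreover have "norm (H x - H x') = \<bar>t\<bar> ^ k * norm (G (t - x) - G (t - x'))"
      unfolding H_def by (simp add: norm_mult norm_power flip: right_diff_distrib)
    ultimately show ?thesis by (simp add: mult_ac)
  qed
  then show ?thesis using that[of "C * 2 ^ k"] C(1) by simp
qed

text \<open>Two characters with different frequencies differ by at most 2 pi times the distance
  times \<bar>t\<bar>. This additional \<bar>t\<bar> costs one power of \<open>tf_size\<close> more
  than the plain bound on atoms.\<close>

lemma tf_atom_lipschitz:
  assumes "G \<in> schwartz"
  shows "\<exists>C\<ge>0. \<forall>z z' t. dist z z' \<le> 1 \<longrightarrow>
    \<bar>t\<bar> ^ k * norm (nth_deriv n (tf_atom G z) t - nth_deriv n (tf_atom G z') t)
      \<le> C * dist z z' * tf_size z ^ (k + n + 1)"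
  using assms
proof (induction n arbitrary: G)
  case 0
  obtain C1 where C1: "C1 \<ge> 0" "\<And>x t. \<bar>t\<bar> ^ Suc k * norm (G (t - x)) \<le> C1 * (1 + \<bar>x\<bar>) ^ Suc k"
    using schwartz_translate_bound[OF 0] by blast
  obtain C2 where C2: "C2 \<ge> 0" "\<And>x x' t. \<bar>x - x'\<bar> \<le> 1 \<Longrightarrow>
    \<bar>t\<bar> ^ k * norm (G (t - x) - G (t - x')) \<le> C2 * \<bar>x - x'\<bar> * (1 + \<bar>x\<bar>) ^ k"
    using schwartz_translate_lipschitz[OF 0] by blast
  have "\<bar>t\<bar> ^ k * norm (tf_atom G z t - tf_atom G z' t)
      \<le> (2 * pi * C1 + C2) * dist z z' * tf_size z ^ (k + 1)" if z: "dist z z' \<le> 1" for z z' t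
  proof -
    let ?e = "echar (- snd z * t)" and ?e' = "echar (- snd z' * t)"
    have "tf_atom G z t - tf_atom G z' t = (?e - ?e') * G (t - fst z) + ?e' * (G (t - fst z) - G (t - fst z'))"
      by (simp add: tf_atom_def algebra_simps)
    then have "norm (tf_atom G z t - tf_atom G z' t)
        \<le> norm (?e - ?e') * norm (G (t - fst z)) + norm (G (t - fst z) - G (t - fst z'))"
      by (metis norm_triangle_ineq norm_mult norm_echar mult_1)
    also have "norm (?e - ?e') \<le> 2 * pi * (dist z z' * \<bar>t\<bar>)"
    proof -
      have "norm (?e - ?e') \<le> 2 * pi * \<bar>- snd z * t - - snd z' * t\<bar>"
        by (rule norm_echar_diff_le)
      also have "\<bar>- snd z * t - - snd z' * t\<bar> = \<bar>snd z - snd z'\<bar> * \<bar>t\<bar>"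
        by (simp flip: abs_mult) (simp add: algebra_simps)
      also have "\<dots> \<le> dist z z' * \<bar>t\<bar>"
        by (intro mult_right_mono abs_snd_le) auto
      finally show ?thesis by simp
    qed
    finally have "norm (tf_atom G z t - tf_atom G z' t)
        \<le> 2 * pi * (dist z z' * \<bar>t\<bar>) * norm (G (t - fst z)) + norm (G (t - fst z) - G (t - fst z'))"
      by (simp add: mult_right_mono)
    then have "\<bar>t\<bar> ^ k * norm (tf_atom G z t - tf_atom G z' t) \<le>
        \<bar>t\<bar> ^ k * (2 * pi * (dist z z' * \<bar>t\<bar>) * norm (G (t - fst z)) + norm (G (t - fst z) - G (t - fst z')))"
      by (rule mult_left_mono) auto
    also have "\<dots> = 2 * pi * dist z z' * (\<bar>t\<bar> ^ Suc k * norm (G (t - fst z)))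
        + \<bar>t\<bar> ^ k * norm (G (t - fst z) - G (t - fst z'))"
      by (simp add: algebra_simps)
    also have "\<dots> \<le> 2 * pi * dist z z' * (C1 * (1 + \<bar>fst z\<bar>) ^ Suc k)
        + C2 * \<bar>fst z - fst z'\<bar> * (1 + \<bar>fst z\<bar>) ^ k"
      using abs_fst_le[of z z'] z by (intro add_mono mult_left_mono C1 C2) auto
    also have "\<dots> \<le> 2 * pi * dist z z' * (C1 * tf_size z ^ Suc k) + C2 * dist z z' * tf_size z ^ Suc k"
    proof -
      have "(1 + \<bar>fst z\<bar>) ^ Suc k \<le> tf_size z ^ Suc k"
        by (intro power_mono) (auto simp: tf_size_def)
      moreover have "(1 + \<bar>fst z\<bar>) ^ k \<le> (1 + \<bar>fst z\<bar>) ^ Suc k"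
        by (rule power_increasing) auto
      ultimately have "(1 + \<bar>fst z\<bar>) ^ k \<le> tf_size z ^ Suc k" "(1 + \<bar>fst z\<bar>) ^ Suc k \<le> tf_size z ^ Suc k"
        by linarith+
      then show ?thesis
        using C1(1) C2(1) abs_fst_le[of z z']
        by (intro add_mono mult_left_mono mult_mono) simp_all
    qed
    also have "\<dots> = (2 * pi * C1 + C2) * dist z z' * tf_size z ^ (k + 1)"
      by (simp add: algebra_simps)
    finally show ?thesis .
  qed
  moreover have "2 * pi * C1 + C2 \<ge> 0" using C1(1) C2(1) by auto
  ultimately show ?case by (auto intro!: exI[of _ "2 * pi * C1 + C2"])
next
  case (Suc n)
  obtain C1 where C1: "C1 \<ge> 0" "\<And>z z' t. dist z z' \<le> 1 \<Longrightarrow>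
      \<bar>t\<bar> ^ k * norm (nth_deriv n (tf_atom G z) t - nth_deriv n (tf_atom G z') t)
        \<le> C1 * dist z z' * tf_size z ^ (k + n + 1)"
    using Suc.IH[OF Suc.prems] by blast
  obtain C2 where C2: "C2 \<ge> 0" "\<And>z z' t. dist z z' \<le> 1 \<Longrightarrow>
      \<bar>t\<bar> ^ k * norm (nth_deriv n (tf_atom (vderiv G) z) t - nth_deriv n (tf_atom (vderiv G) z') t)
        \<le> C2 * dist z z' * tf_size z ^ (k + n + 1)"
    using Suc.IH[OF schwartz_vderiv[OF Suc.prems]] by blast
  obtain C3 where C3: "C3 \<ge> 0"
    "\<And>z t. wderiv k n (tf_atom G z) t \<le> C3 * tf_size z ^ (k + n)"
    using tf_atom_bound[OF Suc.prems] by blast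
  \<comment> \<open>The middle summand stems from the change of the frequency factor. It multiplies
    the atom at z', whose size is at most three times that of z, hence the power of 3.\<close>
  let ?C = "2 * pi * C1 + 2 * pi * (C3 * 3 ^ (k + n)) + C2"
  have "\<bar>t\<bar> ^ k * norm (nth_deriv (Suc n) (tf_atom G z) t - nth_deriv (Suc n) (tf_atom G z') t)
      \<le> ?C * dist z z' * tf_size z ^ (k + Suc n + 1)" if z: "dist z z' \<le> 1" for z z' t
  proof -
    let ?d = "dist z z'" and ?w = "tf_size z"
    let ?A = "nth_deriv n (tf_atom G z) t" and ?B = "nth_deriv n (tf_atom (vderiv G) z) t"
    let ?A' = "nth_deriv n (tf_atom G z') t" and ?B' = "nth_deriv n (tf_atom (vderiv G) z') t"
    have "nth_deriv (Suc n) (tf_atom G z) t - nth_deriv (Suc n) (tf_atom G z') t =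
      - (2 * pi * \<i> * of_real (snd z)) * (?A - ?A') + (- (2 * pi * \<i> * of_real (snd z - snd z')) * ?A' + (?B - ?B'))"
      unfolding nth_deriv_tf_atom[OF Suc.prems] by (simp add: algebra_simps)
    also have "norm \<dots> \<le> norm (- (2 * pi * \<i> * of_real (snd z)) * (?A - ?A')) +
        (norm (- (2 * pi * \<i> * of_real (snd z - snd z')) * ?A') + norm (?B - ?B'))"
      by (intro order_trans[OF norm_triangle_ineq] add_left_mono norm_triangle_ineq)
    also have "\<dots> = 2 * pi * \<bar>snd z\<bar> * norm (?A - ?A') + (2 * pi * \<bar>snd z - snd z'\<bar> * norm ?A' + norm (?B - ?B'))"
      by (simp add: norm_mult del: of_real_diff)
    also have "\<dots> \<le> 2 * pi * ?w * norm (?A - ?A') + (2 * pi * ?d * norm ?A' + norm (?B - ?B'))"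
      using abs_snd_le[of z z']
      by (intro add_mono mult_right_mono mult_left_mono) (auto simp: tf_size_def)
    finally have "\<bar>t\<bar> ^ k * norm (nth_deriv (Suc n) (tf_atom G z) t - nth_deriv (Suc n) (tf_atom G z') t)
      \<le> \<bar>t\<bar> ^ k * (2 * pi * ?w * norm (?A - ?A') + (2 * pi * ?d * norm ?A' + norm (?B - ?B')))"
      by (rule mult_left_mono) auto
    also have "\<dots> = 2 * pi * ?w * (\<bar>t\<bar> ^ k * norm (?A - ?A'))
       + (2 * pi * ?d * (\<bar>t\<bar> ^ k * norm ?A') + \<bar>t\<bar> ^ k * norm (?B - ?B'))"
      by (simp add: algebra_simps)
    also have "\<dots> \<le> 2 * pi * ?w * (C1 * ?d * ?w ^ (k + n + 1))
       + (2 * pi * ?d * (C3 * (3 * ?w) ^ (k + n)) + C2 * ?d * ?w ^ (k + n + 1))"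
    proof -
      have "C3 * tf_size z' ^ (k + n) \<le> C3 * (3 * ?w) ^ (k + n)"
        using C3(1) tf_size_near[OF z] by (intro mult_left_mono power_mono) auto
      then have "\<bar>t\<bar> ^ k * norm ?A' \<le> C3 * (3 * ?w) ^ (k + n)"
        using C3(2)[of t z'] by linarith
      then show ?thesis
        using z by (intro add_mono mult_left_mono C1 C2) auto
    qed
    also have "\<dots> \<le> 2 * pi * ?w * (C1 * ?d * ?w ^ (k + n + 1))
       + (2 * pi * ?d * (C3 * (3 ^ (k + n) * ?w ^ (k + Suc n + 1))) + C2 * ?d * ?w ^ (k + Suc n + 1))"
    proof -
      have "?w ^ (k + n) \<le> ?w ^ (k + Suc n + 1)" "?w ^ (k + n + 1) \<le> ?w ^ (k + Suc n + 1)"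
        by (intro power_increasing; simp)+
      then show ?thesis
        unfolding power_mult_distrib
        using C1(1) C2(1) C3(1) by (intro add_mono mult_left_mono) auto
    qed
    also have "\<dots> = ?C * ?d * ?w ^ (k + Suc n + 1)"
      by (simp add: algebra_simps)
    finally show ?thesis .
  qed
  moreover have "?C \<ge> 0" using C1(1) C2(1) C3(1) by auto
  ultimately show ?case by (auto intro!: exI[of _ ?C])
qed

section \<open>Linearity and seminorm bounds of tempered distributions\<close>

lemma tempered_add: "f \<in> tempered \<Longrightarrow> \<phi> \<in> schwartz \<Longrightarrow> \<psi> \<in> schwartz \<Longrightarrow>
    f (\<lambda>t. \<phi> t + \<psi> t) = f \<phi> + f \<psi>"
  by (simp add: tempered_def plus_fun_def)

lemma tempered_scale: "f \<in> tempered \<Longrightarrow> \<phi> \<in> schwartz \<Longrightarrow> f (\<lambda>t. c * \<phi> t) = c * f \<phi>"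
  by (simp add: tempered_def fscale_def)

lemma tempered_outside: "f \<in> tempered \<Longrightarrow> \<phi> \<notin> schwartz \<Longrightarrow> f \<phi> = 0"
  by (simp add: tempered_def)

lemma tempered_zero: "f \<in> tempered \<Longrightarrow> f (\<lambda>t. 0) = 0"
  using tempered_scale[OF _ schwartz_zero, of f 0] by simp

lemma tempered_diff: "f \<in> tempered \<Longrightarrow> \<phi> \<in> schwartz \<Longrightarrow> \<psi> \<in> schwartz \<Longrightarrow>
    f (\<lambda>t. \<phi> t - \<psi> t) = f \<phi> - f \<psi>"
  using tempered_add[of f \<phi> "\<lambda>t. -1 * \<psi> t"] tempered_scale[of f \<psi> "-1"] schwartz_scale[of \<psi> "-1"]
  by simp

lemma tempered_sum:
  "f \<in> tempered \<Longrightarrow> finite A \<Longrightarrow> (\<And>i. i \<in> A \<Longrightarrow> \<phi> i \<in> schwartz) \<Longrightarrow>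
    f (\<lambda>t. \<Sum>i\<in>A. \<phi> i t) = (\<Sum>i\<in>A. f (\<phi> i))"
proof (induction A rule: infinite_finite_induct)
  case (insert i A)
  have "f (\<lambda>t. \<phi> i t + (\<Sum>i\<in>A. \<phi> i t)) = f (\<phi> i) + f (\<lambda>t. \<Sum>i\<in>A. \<phi> i t)"
    by (intro tempered_add schwartz_sum) (use insert in auto)
  then show ?case
    using insert by simp
qed (simp_all add: tempered_zero)

lemma schwartz_seminorm_le:
  "(\<And>t. wderiv k n \<phi> t \<le> K) \<Longrightarrow> schwartz_seminorm k n \<phi> \<le> K"
  unfolding schwartz_seminorm_def by (rule cSUP_least) (auto simp: power_abs)

text \<open>A neighbourhood of 0 on which f is smaller than 1 restricts only finitely many
  seminorms, and homogeneity turns it into an inequality. The bound K stays a parameter so that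
  callers supply pointwise estimates only.\<close>

lemma tempered_bound:
  assumes f: "f \<in> tempered"
  obtains C m where "C \<ge> 0" "\<And>\<phi> K. \<phi> \<in> schwartz \<Longrightarrow>
    (\<And>k n t. k \<le> m \<Longrightarrow> n \<le> m \<Longrightarrow> wderiv k n \<phi> t \<le> K) \<Longrightarrow> norm (f \<phi>) \<le> C * K"
proof -
  let ?U = "{\<phi> \<in> topspace schwartz_topology. f \<phi> \<in> ball 0 1}"
  have "continuous_map schwartz_topology euclidean f"
    using f by (simp add: tempered_def)
  then have "openin schwartz_topology ?U"
    by (rule openin_continuous_map_preimage) simp
  moreover have "(\<lambda>t. 0) \<in> ?U"
    using schwartz_zero tempered_zero[OF f]
    by (simp add: schwartz_topology_def topspace_seminorm_topology)
  ultimately obtain F e where F: "finite F" "F \<subseteq> range (\<lambda>(k, n). schwartz_seminorm k n)"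
    and e: "0 < e" and sub: "{\<phi> \<in> schwartz. \<forall>r\<in>F. r (\<phi> - (\<lambda>t. 0)) < e} \<subseteq> ?U"
    unfolding schwartz_topology_def openin_seminorm_topology by meson
  have small: "norm (f \<phi>) < 1" if "\<phi> \<in> schwartz" "\<forall>r\<in>F. r \<phi> < e" for \<phi>
  proof -
    have "\<phi> - (\<lambda>t. 0) = \<phi>" by (simp add: fun_eq_iff)
    then show ?thesis using that sub by auto
  qed
  obtain I where I: "finite I" "F = (\<lambda>(k, n). schwartz_seminorm k n) ` I"
    using finite_subset_image[OF F] by auto
  \<comment> \<open>The 0 is inserted so that the maximum exists even if no seminorm occurs.\<close>
  define m where "m = Max (insert 0 (fst ` I \<union> snd ` I))"
  have m: "k \<le> m \<and> n \<le> m" if "(k, n) \<in> I" for k n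
    unfolding m_def using that I(1)
    by (intro conjI Max_ge) (auto simp: rev_image_eqI)
  have "norm (f \<phi>) \<le> 1 / e * K" if \<phi>: "\<phi> \<in> schwartz"
    and K: "\<And>k n t. k \<le> m \<Longrightarrow> n \<le> m \<Longrightarrow> wderiv k n \<phi> t \<le> K" for \<phi> K
  proof -
    have K0: "K \<ge> 0"
      using order_trans[OF norm_ge_zero[of "\<phi> 0"]] K[of 0 0 0] by auto
    \<comment> \<open>K may be 0, so \<phi> is rescaled by \<open>e / \<tau>\<close> with \<tau> >
      K. This also makes the seminorms strictly smaller than e; afterwards \<tau> decreases to
      K.\<close>
    have "norm (f \<phi>) \<le> \<tau> / e" if \<tau>: "\<tau> > K" for \<tau>
    proof -
      have \<tau>0: "\<tau> > 0" using K0 \<tau> by simp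
      define c where "c = complex_of_real (e / \<tau>)"
      have c: "norm c = e / \<tau>"
        unfolding c_def norm_of_real using e \<tau>0 by simp
      have "r (\<lambda>t. c * \<phi> t) < e" if rF: "r \<in> F" for r
      proof -
        obtain k n where r: "r = schwartz_seminorm k n" and "(k, n) \<in> I"
          using rF unfolding I(2) by auto
        have "schwartz_seminorm k n (\<lambda>t. c * \<phi> t) \<le> e / \<tau> * K"
        proof (rule schwartz_seminorm_le)
          fix t
          have "wderiv k n (\<lambda>t. c * \<phi> t) t = e / \<tau> * (wderiv k n \<phi> t)"
            by (simp add: nth_deriv_scale[OF \<phi>] norm_mult c)
          also have "\<dots> \<le> e / \<tau> * K"
            using e \<tau>0 m[OF \<open>(k, n) \<in> I\<close>] by (intro mult_left_mono K) auto
          finally show "wderiv k n (\<lambda>t. c * \<phi> t) t \<le> e / \<tau> * K" .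
        qed
        also have "\<dots> < e" using e \<tau> \<tau>0 by (simp add: field_simps)
        finally show ?thesis unfolding r .
      qed
      then have "norm (f (\<lambda>t. c * \<phi> t)) < 1"
        by (intro small schwartz_scale \<phi>) auto
      then have "e / \<tau> * norm (f \<phi>) < 1"
        by (simp add: tempered_scale[OF f \<phi>] norm_mult c)
      then show ?thesis using e \<tau>0 by (simp add: field_simps)
    qed
    then have "norm (f \<phi>) * e \<le> \<tau>" if "\<tau> > K" for \<tau>
      using that e by (simp add: field_simps)
    then have "norm (f \<phi>) * e \<le> K" by (rule dense_ge)
    then show ?thesis using e by (simp add: field_simps)
  qed
  then show ?thesis using that[of "1 / e" m] e by auto
qed

section \<open>Tempered distributions and parameter integrals\<close>


text \<open>Dominated convergence is a statement about sequences, so derivatives of parameter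
  integrals are computed along arbitrary null sequences of nonzero increments.\<close>

lemma difference_quotient_sequentially:
  fixes f :: "real \<Rightarrow> complex"
  shows "(f has_vector_derivative f') (at t) \<longleftrightarrow>
    (\<forall>h. (\<forall>i. h i \<noteq> 0) \<longrightarrow> h \<longlonglongrightarrow> 0 \<longrightarrow> (\<lambda>i. (f (t + h i) - f t) / of_real (h i)) \<longlonglongrightarrow> f')"
proof -
  have "(f has_vector_derivative f') (at t) \<longleftrightarrow> (\<lambda>h. (f (t + h) - f t) / of_real h) \<midarrow>0\<rightarrow> f'"
  proof -
    have "norm (f (t + h) - f t - h *\<^sub>R f') / norm h = norm ((f (t + h) - f t) / of_real h - f')"
      if "h \<noteq> 0" for h
    proof -
      have "(f (t + h) - f t) / of_real h - f' = (f (t + h) - f t - h *\<^sub>R f') / of_real h"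
        using that by (simp add: field_simps scaleR_conv_of_real)
      then show ?thesis by (simp add: norm_divide)
    qed
    then have "(\<lambda>h. norm (f (t + h) - f t - h *\<^sub>R f') / norm h) \<midarrow>0\<rightarrow> 0 \<longleftrightarrow>
        (\<lambda>h. norm ((f (t + h) - f t) / of_real h - f')) \<midarrow>0\<rightarrow> 0"
      by (intro tendsto_cong) (auto simp: eventually_at_filter)
    then show ?thesis
      unfolding has_vector_derivative_def has_derivative_at
      by (simp add: bounded_linear_scaleR_left tendsto_norm_zero_iff Lim_null[symmetric] LIM_zero_iff)
  qed
  also have "\<dots> \<longleftrightarrow> (\<forall>h. (\<forall>i. h i \<noteq> 0) \<longrightarrow> h \<longlonglongrightarrow> 0 \<longrightarrow> (\<lambda>i. (f (t + h i) - f t) / of_real (h i)) \<longlonglongrightarrow> f')"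
    by (simp add: tendsto_at_iff_sequentially o_def)
  finally show ?thesis .
qed

lemma difference_quotient_LIMSEQ:
  fixes f :: "real \<Rightarrow> complex"
  assumes "(f has_vector_derivative f') (at t)" "\<And>i. h i \<noteq> 0" "h \<longlonglongrightarrow> 0"
  shows "(\<lambda>i. (f (t + h i) - f t) / of_real (h i)) \<longlonglongrightarrow> f'"
  using difference_quotient_sequentially[THEN iffD1, OF assms(1), THEN spec, of h] assms(2,3) by simp

lemma vector_derivative_lipschitz:
  fixes f :: "real \<Rightarrow> complex"
  assumes "\<And>t. (f has_vector_derivative f' t) (at t)" and "\<And>t. norm (f' t) \<le> B"
  shows "norm (f x - f y) \<le> B * \<bar>x - y\<bar>"
proof -
  have "norm (f x - f y) \<le> B * norm (x - y)"
  proof (rule differentiable_bound[of UNIV])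
    show "(f has_derivative (\<lambda>h. h *\<^sub>R f' s)) (at s within UNIV)" for s
      using assms(1)[of s] by (simp add: has_vector_derivative_def)
    show "onorm (\<lambda>h. h *\<^sub>R f' s) \<le> B" for s
      using assms(2)[of s] by (subst onorm_scaleR_left) (auto simp: onorm_id)
  qed auto
  then show ?thesis by simp
qed

section \<open>Differentiation under the integral sign\<close>

text \<open>The majorants are uniform in t and exist for every weighted derivative, so the notion is
  stable under differentiation in t. This stability makes the integrals of such families a class to
  which the coinduction applies.\<close>

definition schwartz_family :: "'z measure \<Rightarrow> ('z \<Rightarrow> real \<Rightarrow> complex) \<Rightarrow> bool"
  where "schwartz_family M \<Phi> \<longleftrightarrow> (\<forall>z. \<Phi> z \<in> schwartz) \<and> (\<forall>t. (\<lambda>z. \<Phi> z t) \<in> borel_measurable M) \<and>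
    (\<forall>k n. \<exists>b. integrable M b \<and> (\<forall>z t. wderiv k n (\<Phi> z) t \<le> b z))"

lemma schwartz_familyD:
  assumes "schwartz_family M \<Phi>"
  shows "\<Phi> z \<in> schwartz" "(\<lambda>z. \<Phi> z t) \<in> borel_measurable M"
    "\<exists>b. integrable M b \<and> (\<forall>z t. wderiv k n (\<Phi> z) t \<le> b z)"
  using assms by (auto simp: schwartz_family_def)

text \<open>Measurability in the parameter survives because the derivative is a limit of difference
  quotients along a fixed null sequence; the majorants are those of the next order.\<close>

lemma schwartz_family_vderiv:
  assumes "schwartz_family M \<Phi>"
  shows "schwartz_family M (\<lambda>z. vderiv (\<Phi> z))"
  unfolding schwartz_family_def
proof (intro conjI allI)
  note [measurable] = schwartz_familyD(2)[OF assms]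
  show "vderiv (\<Phi> z) \<in> schwartz" for z
    by (intro schwartz_vderiv schwartz_familyD[OF assms])
  show "(\<lambda>z. vderiv (\<Phi> z) t) \<in> borel_measurable M" for t
  proof (rule borel_measurable_LIMSEQ_metric)
    show "(\<lambda>z. (\<Phi> z (t + inverse (real (Suc i))) - \<Phi> z t) / of_real (inverse (real (Suc i))))
        \<in> borel_measurable M" for i
      by measurable
    show "(\<lambda>i. (\<Phi> z (t + inverse (real (Suc i))) - \<Phi> z t) / of_real (inverse (real (Suc i))))
        \<longlonglongrightarrow> vderiv (\<Phi> z) t" for z
      by (rule difference_quotient_LIMSEQ[OF schwartz_has_vector_derivative[OF
              schwartz_familyD(1)[OF assms]] _ LIMSEQ_inverse_real_of_nat]) simp
  qed
  show "\<exists>b. integrable M b \<and> (\<forall>z t. wderiv k n (vderiv (\<Phi> z)) t \<le> b z)" for k n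
    unfolding nth_deriv_Suc2[symmetric] by (rule schwartz_familyD(3)[OF assms])
qed

lemma schwartz_family_integrable:
  assumes "schwartz_family M \<Phi>"
  shows "integrable M (\<lambda>z. \<Phi> z t)"
proof -
  obtain b where b: "integrable M b" "\<And>z t. wderiv 0 0 (\<Phi> z) t \<le> b z"
    using schwartz_familyD(3)[OF assms] by blast
  show ?thesis
    by (rule Bochner_Integration.integrable_bound[OF b(1) schwartz_familyD(2)[OF assms]])
      (use b(2) in \<open>force intro!: AE_I2 order_trans[OF _ abs_ge_self]\<close>)
qed

lemma schwartz_family_integral_bound:
  assumes "schwartz_family M \<Phi>"
  shows "\<exists>C. \<forall>t. \<bar>t\<bar> ^ k * norm (\<integral>z. \<Phi> z t \<partial>M) \<le> C"
proof -
  obtain b where b: "integrable M b" "\<And>z t. wderiv k 0 (\<Phi> z) t \<le> b z"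
    using schwartz_familyD(3)[OF assms] by blast
  have "\<bar>t\<bar> ^ k * norm (\<integral>z. \<Phi> z t \<partial>M) \<le> (\<integral>z. b z \<partial>M)" for t
  proof -
    have "\<bar>t\<bar> ^ k * norm (\<integral>z. \<Phi> z t \<partial>M) \<le> \<bar>t\<bar> ^ k * (\<integral>z. norm (\<Phi> z t) \<partial>M)"
      by (intro mult_left_mono integral_norm_bound) auto
    also have "\<dots> = (\<integral>z. \<bar>t\<bar> ^ k * norm (\<Phi> z t) \<partial>M)" by simp
    also have "\<dots> \<le> (\<integral>z. b z \<partial>M)"
      using b schwartz_family_integrable[OF assms] by (intro integral_mono) auto
    finally show ?thesis .
  qed
  then show ?thesis by blast
qed

text \<open>By the mean value inequality the difference quotients are dominated by the majorant of
  the first derivative, whatever the increment.\<close>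

lemma schwartz_family_has_vector_derivative:
  assumes "schwartz_family M \<Phi>"
  shows "((\<lambda>t. \<integral>z. \<Phi> z t \<partial>M) has_vector_derivative (\<integral>z. vderiv (\<Phi> z) t \<partial>M)) (at t)"
  unfolding difference_quotient_sequentially
proof (intro allI impI)
  fix h :: "nat \<Rightarrow> real" assume h: "\<forall>i. h i \<noteq> 0" "h \<longlonglongrightarrow> 0"
  note [measurable] = schwartz_familyD(2)[OF assms] schwartz_familyD(2)[OF schwartz_family_vderiv[OF assms]]
  note int = schwartz_family_integrable[OF assms]
  obtain b where b: "integrable M b" "\<And>z t. wderiv 0 (Suc 0) (\<Phi> z) t \<le> b z"
    using schwartz_familyD(3)[OF assms] by blast
  have "(\<lambda>i. \<integral>z. (\<Phi> z (t + h i) - \<Phi> z t) / of_real (h i) \<partial>M) \<longlonglongrightarrow> (\<integral>z. vderiv (\<Phi> z) t \<partial>M)"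
  proof (rule integral_dominated_convergence[where w = b])
    show "AE z in M. (\<lambda>i. (\<Phi> z (t + h i) - \<Phi> z t) / of_real (h i)) \<longlonglongrightarrow> vderiv (\<Phi> z) t"
      by (intro AE_I2 difference_quotient_LIMSEQ schwartz_has_vector_derivative
          schwartz_familyD(1)[OF assms]) (use h in auto)
    show "AE z in M. norm ((\<Phi> z (t + h i) - \<Phi> z t) / of_real (h i)) \<le> b z" for i
    proof (rule AE_I2)
      fix z
      have "norm (\<Phi> z (t + h i) - \<Phi> z t) \<le> b z * \<bar>t + h i - t\<bar>"
        using b(2)[where z = z]
        by (intro vector_derivative_lipschitz[where f' = "vderiv (\<Phi> z)"]
            schwartz_has_vector_derivative schwartz_familyD[OF assms]) (simp add: nth_deriv_Suc)
      then show "norm ((\<Phi> z (t + h i) - \<Phi> z t) / of_real (h i)) \<le> b z"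
        using h(1) by (simp add: norm_divide field_simps)
    qed
  qed (use b in measurable)
  then show "(\<lambda>i. ((\<integral>z. \<Phi> z (t + h i) \<partial>M) - (\<integral>z. \<Phi> z t \<partial>M)) / of_real (h i)) \<longlonglongrightarrow> (\<integral>z. vderiv (\<Phi> z) t \<partial>M)"
    by (simp add: int)
qed

lemma schwartz_family_integral:
  assumes "schwartz_family M \<Phi>"
  shows "(\<lambda>t. \<integral>z. \<Phi> z t \<partial>M) \<in> schwartz"
proof (rule schwartz_coinduct[where X = "{\<lambda>t. \<integral>z. \<Phi> z t \<partial>M |\<Phi>. schwartz_family M \<Phi>}"])
  show "(\<lambda>t. \<integral>z. \<Phi> z t \<partial>M) \<in> {\<lambda>t. \<integral>z. \<Phi> z t \<partial>M |\<Phi>. schwartz_family M \<Phi>}"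
    using assms by fast
next
  fix f assume "f \<in> {\<lambda>t. \<integral>z. \<Phi> z t \<partial>M |\<Phi>. schwartz_family M \<Phi>}"
  then obtain \<Phi> where f: "f = (\<lambda>t. \<integral>z. \<Phi> z t \<partial>M)" and \<Phi>: "schwartz_family M \<Phi>" by fast
  note der = schwartz_family_has_vector_derivative[OF \<Phi>]
  show "f differentiable at t" for t
    unfolding f by (rule differentiableI_vector[OF der])
  show "\<exists>C. \<forall>t. \<bar>t\<bar> ^ k * norm (f t) \<le> C" for k
    unfolding f by (rule schwartz_family_integral_bound[OF \<Phi>])
  have "vderiv f = (\<lambda>t. \<integral>z. vderiv (\<Phi> z) t \<partial>M)"
    unfolding f by (intro ext vector_derivative_at der)
  then show "vderiv f \<in> {\<lambda>t. \<integral>z. \<Phi> z t \<partial>M |\<Phi>. schwartz_family M \<Phi>}"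
    using schwartz_family_vderiv[OF \<Phi>] by fast
qed

lemma schwartz_family_nth_deriv:
  "schwartz_family M \<Phi> \<Longrightarrow> nth_deriv n (\<lambda>t. \<integral>z. \<Phi> z t \<partial>M) = (\<lambda>t. \<integral>z. nth_deriv n (\<Phi> z) t \<partial>M)"
proof (induction n arbitrary: \<Phi>)
  case (Suc n)
  have "vderiv (\<lambda>t. \<integral>z. \<Phi> z t \<partial>M) = (\<lambda>t. \<integral>z. vderiv (\<Phi> z) t \<partial>M)"
    by (intro ext vector_derivative_at schwartz_family_has_vector_derivative Suc)
  then show ?case
    using Suc.IH[OF schwartz_family_vderiv[OF Suc.prems]] by (simp add: nth_deriv_Suc2)
qed simp

lemma schwartz_family_nth_deriv_family:
  "schwartz_family M \<Phi> \<Longrightarrow> schwartz_family M (\<lambda>z. nth_deriv n (\<Phi> z))"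
  by (induction n) (simp_all add: nth_deriv_Suc schwartz_family_vderiv)

section \<open>Riemann sums on a phase-space grid\<close>

text \<open>On each cell \<open>r z = k\<close> the sampled value is the constant
  \<open>A k\<close>, so the integral splits into finitely many cell integrals of c. A may be an
  arbitrary function because only finitely many of its values enter.\<close>

lemma finite_range_integral:
  fixes c :: "'z \<Rightarrow> 'b :: {real_normed_field, banach, second_countable_topology}"
  assumes "finite (r ` Q)" and [measurable]: "Q \<in> sets M"
    and [measurable]: "\<And>k. {z \<in> space M. r z = k} \<in> sets M"
    and c: "integrable M c"
  shows "has_bochner_integral M (\<lambda>z. indicator Q z * c z * A (r z))
    (\<Sum>k\<in>r ` Q. (\<integral>z. indicator (Q \<inter> {z \<in> space M. r z = k}) z * c z \<partial>M) * A k)"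
proof -
  have "has_bochner_integral M
      (\<lambda>z. \<Sum>k\<in>r ` Q. (indicator (Q \<inter> {z \<in> space M. r z = k}) z * c z) * A k)
      (\<Sum>k\<in>r ` Q. (\<integral>z. indicator (Q \<inter> {z \<in> space M. r z = k}) z * c z \<partial>M) * A k)"
  proof (intro has_bochner_integral_sum has_bochner_integral_mult_left has_bochner_integral_integrable)
    show "integrable M (\<lambda>z. indicator (Q \<inter> {z \<in> space M. r z = k}) z * c z)" for k
    proof -
      have "integrable M (\<lambda>z. indicator (Q \<inter> {z \<in> space M. r z = k}) z *\<^sub>R c z)"
        by (intro integrable_mult_indicator c) measurable
      moreover have "(\<lambda>z. indicator (Q \<inter> {z \<in> space M. r z = k}) z *\<^sub>R c z) =
          (\<lambda>z. indicator (Q \<inter> {z \<in> space M. r z = k}) z * c z)"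
        by (auto simp: indicator_def fun_eq_iff)
      ultimately show ?thesis by simp
    qed
  qed
  also have "?this \<longleftrightarrow> ?thesis"
  proof (rule has_bochner_integral_cong)
    fix z assume "z \<in> space M"
    then have "(\<Sum>k\<in>r ` Q. (indicator (Q \<inter> {z \<in> space M. r z = k}) z * c z) * A k)
      = (\<Sum>k\<in>r ` Q. if k = r z then indicator Q z * c z * A (r z) else 0)"
      by (intro sum.cong) (auto simp: indicator_def)
    also have "\<dots> = indicator Q z * c z * A (r z)"
      using assms(1) by (auto simp: indicator_def)
    finally show "(\<Sum>k\<in>r ` Q. (indicator (Q \<inter> {z \<in> space M. r z = k}) z * c z) * A k) = \<dots>" .
  qed auto
  finally show ?thesis .
qed

definition tf_box :: "real \<Rightarrow> (real \<times> real) set"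
  where "tf_box R = {z. \<bar>fst z\<bar> \<le> R \<and> \<bar>snd z\<bar> \<le> R}"

definition tf_grid :: "real \<Rightarrow> real \<times> real \<Rightarrow> real \<times> real"
  where "tf_grid d z = (d * \<lfloor>fst z / d\<rfloor>, d * \<lfloor>snd z / d\<rfloor>)"

lemma measurable_tf_grid [measurable]: "tf_grid d \<in> borel \<rightarrow>\<^sub>M borel"
  unfolding tf_grid_def borel_prod[symmetric] by measurable

lemma measurable_tf_box [measurable]: "tf_box R \<in> sets borel"
proof -
  have "tf_box R = {- R..R} \<times> {- R..R}"
    by (auto simp: tf_box_def)
  then show ?thesis by (simp add: borel_closed closed_Times)
qed

lemma dist_tf_grid:
  assumes "d > 0"
  shows "dist (tf_grid d z) z \<le> 2 * d"
proof -
  have "dist (d * \<lfloor>s / d\<rfloor>) s \<le> d" for s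
  proof -
    have "d * \<lfloor>s / d\<rfloor> \<le> d * (s / d)" "d * (s / d) \<le> d * (\<lfloor>s / d\<rfloor> + 1)"
      using assms by (intro mult_left_mono; linarith)+
    then show ?thesis using assms by (simp add: dist_real_def algebra_simps)
  qed
  from this[of "fst z"] this[of "snd z"] show ?thesis
    using sqrt_sum_squares_le_sum[of "dist (d * \<lfloor>fst z / d\<rfloor>) (fst z)" "dist (d * \<lfloor>snd z / d\<rfloor>) (snd z)"]
    by (simp add: tf_grid_def dist_prod_def)
qed

lemma finite_tf_grid_box:
  assumes "d > 0"
  shows "finite (tf_grid d ` tf_box R)"
proof -
  define F where "F = {\<lfloor>- R / d\<rfloor>..\<lfloor>R / d\<rfloor>}"
  have F: "\<lfloor>s / d\<rfloor> \<in> F" if "\<bar>s\<bar> \<le> R" for s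
    using that divide_right_mono[of "- R" s d] divide_right_mono[of s R d] assms
    unfolding F_def by (auto intro!: floor_mono)
  have "tf_grid d ` tf_box R \<subseteq> (\<lambda>(i, j). (d * of_int i, d * of_int j)) ` (F \<times> F)"
    using F by (auto simp: tf_grid_def tf_box_def)
  then show ?thesis
    by (rule finite_subset) (simp add: F_def)
qed

section \<open>Uniform bounds for the transform of a tempered distribution\<close>

text \<open>Estimates on atoms come with a separate constant for each k and n, whereas a tempered
  distribution involves all indices up to some m. The sum of the finitely many constants serves for
  all of them.\<close>

lemma uniform_finite_bound:
  fixes m :: nat
  assumes "\<And>k n. \<exists>C\<ge>0. \<forall>x. F k n x \<le> C * W k n x" and "\<And>k n x. 0 \<le> W k n x"
    and "\<And>k n x. k \<le> m \<Longrightarrow> n \<le> m \<Longrightarrow> W k n x \<le> V x"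
  obtains C where "(C::real) \<ge> 0" "\<And>k n x. k \<le> m \<Longrightarrow> n \<le> m \<Longrightarrow> F k n x \<le> C * (V x :: real)"
proof -
  obtain c where c: "\<And>k n. c k n \<ge> 0" "\<And>k n x. F k n x \<le> c k n * W k n x"
    using assms(1) by metis
  define C where "C = (\<Sum>k\<le>m. \<Sum>n\<le>m. c k n)"
  have C: "c k n \<le> C" if "k \<le> m" "n \<le> m" for k n
  proof -
    have "c k n \<le> (\<Sum>n\<le>m. c k n)"
      using that by (intro member_le_sum c) auto
    also have "\<dots> \<le> C"
      unfolding C_def using that by (intro member_le_sum[of k "{..m}" "\<lambda>k. \<Sum>n\<le>m. c k n"] sum_nonneg c) auto
    finally show ?thesis .
  qed
  have "F k n x \<le> C * V x" if "k \<le> m" "n \<le> m" for k n x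
    using c(2)[of k n x] mult_mono[OF C[OF that] assms(3)[OF that]] c(1)[of k n] C[OF that]
      assms(2)[of k n x] by (meson order_trans)
  then show ?thesis
    using that[of C] c(1) by (simp add: C_def sum_nonneg)
qed

lemma schwartz_uniform_atom_bounds:
  assumes G: "G \<in> schwartz"
  obtains A where "A \<ge> 0"
    "\<And>k n z t. k \<le> m \<Longrightarrow> n \<le> m \<Longrightarrow>
      wderiv k n (tf_atom G z) t \<le> A * tf_size z ^ (2 * m)"
    "\<And>k n z z' t. k \<le> m \<Longrightarrow> n \<le> m \<Longrightarrow> dist z z' \<le> 1 \<Longrightarrow>
      \<bar>t\<bar> ^ k * norm (nth_deriv n (tf_atom G z) t - nth_deriv n (tf_atom G z') t)
        \<le> A * dist z z' * tf_size z ^ (2 * m + 1)"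
proof -
  obtain A1 where A1: "A1 \<ge> 0" "\<And>k n z t. k \<le> m \<Longrightarrow> n \<le> m \<Longrightarrow>
      wderiv k n (tf_atom G z) t \<le> A1 * tf_size z ^ (2 * m)"
  proof (rule uniform_finite_bound[where m = m
        and F = "\<lambda>k n (z, t). wderiv k n (tf_atom G z) t"
        and W = "\<lambda>k n (z, t). tf_size z ^ (k + n)" and V = "\<lambda>(z, t). tf_size z ^ (2 * m)"])
    show "\<exists>C\<ge>0. \<forall>x. (case x of (z, t) \<Rightarrow> wderiv k n (tf_atom G z) t)
        \<le> C * (case x of (z, t) \<Rightarrow> tf_size z ^ (k + n))" for k n
      using tf_atom_bound[OF G, of k n] by auto
  qed (auto intro!: power_increasing)
  obtain A2 where A2: "A2 \<ge> 0" "\<And>k n z z' t. k \<le> m \<Longrightarrow> n \<le> m \<Longrightarrow> dist z z' \<le> 1 \<Longrightarrow>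
      \<bar>t\<bar> ^ k * norm (nth_deriv n (tf_atom G z) t - nth_deriv n (tf_atom G z') t)
        \<le> A2 * dist z z' * tf_size z ^ (2 * m + 1)"
  \<comment> \<open>The restriction to \<open>dist z z' \<le> 1\<close> is encoded by the value 0
    elsewhere, which makes the estimate unconditional.\<close>
  proof (rule uniform_finite_bound[where m = m
        and F = "\<lambda>k n (z, z', t). if dist z z' \<le> 1 then
          \<bar>t\<bar> ^ k * norm (nth_deriv n (tf_atom G z) t - nth_deriv n (tf_atom G z') t) else 0"
        and W = "\<lambda>k n (z, z', t). dist z z' * tf_size z ^ (k + n + 1)"
        and V = "\<lambda>(z, z', t). dist z z' * tf_size z ^ (2 * m + 1)"])
    show "\<exists>C\<ge>0. \<forall>x. (case x of (z, z', t) \<Rightarrow> if dist z z' \<le> 1 then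
          \<bar>t\<bar> ^ k * norm (nth_deriv n (tf_atom G z) t - nth_deriv n (tf_atom G z') t) else 0)
        \<le> C * (case x of (z, z', t) \<Rightarrow> dist z z' * tf_size z ^ (k + n + 1))" for k n
      using tf_atom_lipschitz[OF G, of k n] by (auto simp: mult.assoc)
  next
    fix C assume C: "C \<ge> 0" "\<And>k n x. k \<le> m \<Longrightarrow> n \<le> m \<Longrightarrow> (case x of (z, z', t) \<Rightarrow> if dist z z' \<le> 1 then
          \<bar>t\<bar> ^ k * norm (nth_deriv n (tf_atom G z) t - nth_deriv n (tf_atom G z') t) else 0)
        \<le> C * (case x of (z, z', t) \<Rightarrow> dist z z' * tf_size z ^ (2 * m + 1))"
    show thesis
    proof (rule that[OF C(1)])
      fix k n t and z z' :: "real \<times> real" assume "k \<le> m" "n \<le> m" and d: "dist z z' \<le> 1"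
      from C(2)[OF this(1,2), of "(z, z', t)"] d
      show "\<bar>t\<bar> ^ k * norm (nth_deriv n (tf_atom G z) t - nth_deriv n (tf_atom G z') t)
        \<le> C * dist z z' * tf_size z ^ (2 * m + 1)"
        by (simp add: mult.assoc)
    qed
  qed (auto intro!: power_increasing mult_left_mono simp del: power_Suc)
  show ?thesis
  proof (rule that[of "max A1 A2"])
    show "0 \<le> max A1 A2" using A1(1) by simp
    fix k n z t assume kn: "k \<le> m" "n \<le> m"
    have "A1 * tf_size z ^ (2 * m) \<le> max A1 A2 * tf_size z ^ (2 * m)"
      by (intro mult_right_mono) auto
    then show "wderiv k n (tf_atom G z) t \<le> max A1 A2 * tf_size z ^ (2 * m)"
      using A1(2)[OF kn, of t z] by linarith
    fix z' assume "dist z z' \<le> 1"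
    moreover have "A2 * dist z z' * tf_size z ^ (2 * m + 1) \<le> max A1 A2 * dist z z' * tf_size z ^ (2 * m + 1)"
      by (intro mult_right_mono) auto
    ultimately show "\<bar>t\<bar> ^ k * norm (nth_deriv n (tf_atom G z) t - nth_deriv n (tf_atom G z') t)
        \<le> max A1 A2 * dist z z' * tf_size z ^ (2 * m + 1)"
      using A2(2)[OF kn, of z z' t] by linarith
  qed
qed

text \<open>A tempered distribution sees finitely many seminorms, and on atoms and on differences of
  nearby atoms these grow polynomially in the phase-space point.\<close>

lemma tempered_atom_bounds:
  assumes G: "G \<in> schwartz" and f: "f \<in> tempered"
  obtains A m where "A \<ge> 0" "\<And>z. norm (f (tf_atom G z)) \<le> A * tf_size z ^ m"
    "\<And>z z'. dist z z' \<le> 1 \<Longrightarrow>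
      norm (f (tf_atom G z) - f (tf_atom G z')) \<le> A * dist z z' * tf_size z ^ (m + 1)"
proof -
  obtain C m where C: "C \<ge> 0" "\<And>\<phi> K. \<phi> \<in> schwartz \<Longrightarrow>
    (\<And>k n t. k \<le> m \<Longrightarrow> n \<le> m \<Longrightarrow> wderiv k n \<phi> t \<le> K) \<Longrightarrow> norm (f \<phi>) \<le> C * K"
    using tempered_bound[OF f] by blast
  obtain A where A: "A \<ge> 0"
    "\<And>k n z t. k \<le> m \<Longrightarrow> n \<le> m \<Longrightarrow>
      wderiv k n (tf_atom G z) t \<le> A * tf_size z ^ (2 * m)"
    "\<And>k n z z' t. k \<le> m \<Longrightarrow> n \<le> m \<Longrightarrow> dist z z' \<le> 1 \<Longrightarrow>
      \<bar>t\<bar> ^ k * norm (nth_deriv n (tf_atom G z) t - nth_deriv n (tf_atom G z') t)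
        \<le> A * dist z z' * tf_size z ^ (2 * m + 1)"
    using schwartz_uniform_atom_bounds[OF G] by blast
  note S = schwartz_tf_atom[OF G]
  show ?thesis
  proof (rule that[of "C * A" "2 * m"])
    show "0 \<le> C * A" using C A by simp
    show "norm (f (tf_atom G z)) \<le> C * A * tf_size z ^ (2 * m)" for z
      unfolding mult.assoc by (intro C(2) S A(2))
    fix z z' :: "real \<times> real" assume d: "dist z z' \<le> 1"
    have "norm (f (\<lambda>t. tf_atom G z t - tf_atom G z' t)) \<le> C * (A * dist z z' * tf_size z ^ (2 * m + 1))"
      unfolding mult.assoc[symmetric]
      by (rule order_trans[OF C(2)[OF schwartz_diff[OF S S]]], unfold nth_deriv_diff[OF S S])
        (rule A(3)[OF _ _ d], assumption+, simp add: mult.assoc)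
    then show "norm (f (tf_atom G z) - f (tf_atom G z')) \<le> C * A * dist z z' * tf_size z ^ (2 * m + 1)"
      by (simp add: tempered_diff[OF f S S] mult.assoc)
  qed
qed

lemma continuous_on_tempered_atom:
  assumes G: "G \<in> schwartz" and f: "f \<in> tempered"
  shows "continuous_on UNIV (stft G f)"
proof -
  obtain A m where A: "A \<ge> 0" "\<And>z. norm (f (tf_atom G z)) \<le> A * tf_size z ^ m"
    "\<And>z z'. dist z z' \<le> 1 \<Longrightarrow>
      norm (f (tf_atom G z) - f (tf_atom G z')) \<le> A * dist z z' * tf_size z ^ (m + 1)"
    using tempered_atom_bounds[OF G f] by blast
  show ?thesis
  proof (intro continuous_at_imp_continuous_on ballI)
    fix z
    have "((\<lambda>z'. f (tf_atom G z) - f (tf_atom G z')) \<longlongrightarrow> 0) (at z)"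
    proof (rule Lim_null_comparison)
      show "\<forall>\<^sub>F z' in at z. norm (f (tf_atom G z) - f (tf_atom G z')) \<le> A * dist z z' * tf_size z ^ (m + 1)"
        unfolding eventually_at by (rule exI[of _ 1]) (use A(3)[of z] in \<open>simp add: dist_commute del: split_paired_All\<close>)
      have "((\<lambda>z'. A * dist z z' * tf_size z ^ (m + 1)) \<longlongrightarrow> A * dist z z * tf_size z ^ (m + 1)) (at z)"
        by (intro tendsto_intros)
      then show "((\<lambda>z'. A * dist z z' * tf_size z ^ (m + 1)) \<longlongrightarrow> 0) (at z)" by simp
    qed
    from tendsto_diff[OF tendsto_const[of "f (tf_atom G z)"] this]
    show "isCont (stft G f) z"
      by (simp add: isCont_def)
  qed
qed

lemma nth_deriv_sum:
  "finite I \<Longrightarrow> (\<And>i. i \<in> I \<Longrightarrow> f i \<in> schwartz) \<Longrightarrow>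
    nth_deriv n (\<lambda>t. \<Sum>i\<in>I. f i t) = (\<lambda>t. \<Sum>i\<in>I. nth_deriv n (f i) t)"
proof (induction I rule: finite_induct)
  case empty
  have "nth_deriv n (\<lambda>t. 0 * 0) = (\<lambda>t. 0 * nth_deriv n (\<lambda>t. 0) t)"
    by (rule nth_deriv_scale[OF schwartz_zero])
  then show ?case by simp
next
  case (insert i I)
  have "nth_deriv n (\<lambda>t. f i t + (\<Sum>i\<in>I. f i t)) = (\<lambda>t. nth_deriv n (f i) t + nth_deriv n (\<lambda>t. \<Sum>i\<in>I. f i t) t)"
    by (intro nth_deriv_add schwartz_sum) (use insert in auto)
  then show ?case using insert by simp
qed

section \<open>Superpositions of atoms and the exchange with a distribution\<close>

lemma schwartz_family_atoms:
  assumes G: "G \<in> schwartz" and c[measurable]: "c \<in> borel_measurable borel"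
    and int: "\<And>m. integrable lborel (\<lambda>z. norm (c z) * tf_size z ^ m)"
  shows "schwartz_family lborel (\<lambda>z t. c z * tf_atom G z t)"
  unfolding schwartz_family_def
proof (intro conjI allI)
  note S = schwartz_tf_atom[OF G]
  show "(\<lambda>t. c z * tf_atom G z t) \<in> schwartz" for z
    by (intro schwartz_scale S)
  have "continuous_on UNIV (\<lambda>z. tf_atom G z t)" for t
    unfolding tf_atom_def
    by (intro continuous_intros continuous_on_compose2[OF schwartz_continuous[OF G, of UNIV]]) auto
  then have "(\<lambda>z. tf_atom G z t) \<in> borel_measurable borel" for t
    by (rule borel_measurable_continuous_onI)
  note [measurable] = this
  show "(\<lambda>z. c z * tf_atom G z t) \<in> borel_measurable lborel" for t
    by measurable
  show "\<exists>b. integrable lborel b \<and> (\<forall>z t. wderiv k n (\<lambda>t. c z * tf_atom G z t) t \<le> b z)"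
    for k n
  proof -
    obtain C where C: "C \<ge> 0" "\<And>z t. wderiv k n (tf_atom G z) t \<le> C * tf_size z ^ (k + n)"
      using tf_atom_bound[OF G] by blast
    have "wderiv k n (\<lambda>t. c z * tf_atom G z t) t \<le> C * (norm (c z) * tf_size z ^ (k + n))"
      for z t
      using mult_left_mono[OF C(2)[of t z], of "norm (c z)"]
      by (simp add: nth_deriv_scale[OF S] norm_mult mult_ac)
    then show ?thesis
      using int[of "k + n"] by (intro exI[of _ "\<lambda>z. C * (norm (c z) * tf_size z ^ (k + n))"]) auto
  qed
qed

text \<open>A tempered distribution commutes with the integral because both sides are approximated by
  Riemann sums over a grid of width \<open>1 / j\<close> in a box of size \<open>j\<close>; the weight \<open>tf_size\<close> is at least
  \<open>j\<close> outside the box.\<close>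

lemma tempered_integral_atoms:
  assumes G: "G \<in> schwartz" and f: "f \<in> tempered" and c[measurable]: "c \<in> borel_measurable borel"
    and int: "\<And>m. integrable lborel (\<lambda>z. norm (c z) * tf_size z ^ m)"
  shows "(\<lambda>t. LBINT z. c z * tf_atom G z t) \<in> schwartz"
    and "f (\<lambda>t. LBINT z. c z * tf_atom G z t) = (LBINT z. c z * f (tf_atom G z))"
proof -
  note fam = schwartz_family_atoms[OF G c int]
  note S = schwartz_tf_atom[OF G]
  let ?K = "\<lambda>t. LBINT z. c z * tf_atom G z t"
  show K: "?K \<in> schwartz"
    by (rule schwartz_family_integral[OF fam])
  obtain C m where C: "C \<ge> 0" "\<And>\<phi> K. \<phi> \<in> schwartz \<Longrightarrow>
    (\<And>k n t. k \<le> m \<Longrightarrow> n \<le> m \<Longrightarrow> wderiv k n \<phi> t \<le> K) \<Longrightarrow> norm (f \<phi>) \<le> C * K"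
    using tempered_bound[OF f] by blast
  obtain A where A: "A \<ge> 0"
    "\<And>k n z t. k \<le> m \<Longrightarrow> n \<le> m \<Longrightarrow>
      wderiv k n (tf_atom G z) t \<le> A * tf_size z ^ (2 * m)"
    "\<And>k n z z' t. k \<le> m \<Longrightarrow> n \<le> m \<Longrightarrow> dist z z' \<le> 1 \<Longrightarrow>
      \<bar>t\<bar> ^ k * norm (nth_deriv n (tf_atom G z) t - nth_deriv n (tf_atom G z') t)
        \<le> A * dist z z' * tf_size z ^ (2 * m + 1)"
    using schwartz_uniform_atom_bounds[OF G] by blast
  define S0 where "S0 = (LBINT z. norm (c z) * tf_size z ^ (2 * m + 1))"
  have cint: "integrable lborel c"
    using int[of 0] by (simp add: integrable_norm_iff)
  have fint: "integrable lborel (\<lambda>z. c z * f (tf_atom G z))"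
  proof -
    obtain A m where A: "A \<ge> 0" "\<And>z. norm (f (tf_atom G z)) \<le> A * tf_size z ^ m"
      using that by (rule tempered_atom_bounds[OF G f])
    have [measurable]: "(stft G f) \<in> borel_measurable borel"
      by (intro borel_measurable_continuous_onI continuous_on_tempered_atom G f)
    show ?thesis
    proof (rule Bochner_Integration.integrable_bound)
      show "integrable lborel (\<lambda>z. A * (norm (c z) * tf_size z ^ m))"
        using int[of m] by simp
      show "AE z in lborel. norm (c z * f (tf_atom G z)) \<le> norm (A * (norm (c z) * tf_size z ^ m))"
        using mult_left_mono[OF A(2), of "norm (c _)"] A(1)
        by (intro AE_I2) (simp add: norm_mult abs_mult mult_ac)
    qed measurable
  qed
  \<comment> \<open>For j \<ge> 2 the grid moves points by at most 2 / j \<le> 1, the range of the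
    Lipschitz bound. The factor 4 collects two errors with factor 2: f applied to the Riemann sum
    against f applied to the integral, and the Riemann sum of the values of f against their
    integral.\<close>
  have "norm (f ?K - (LBINT z. c z * f (tf_atom G z))) \<le> 4 * C * A * S0 / real j" if j: "j \<ge> 2" for j
  proof -
    define r where "r = tf_grid (1 / real j)"
    define Q where "Q = tf_box (real j)"
    have r: "dist z (r z) \<le> 2 / real j" for z
      using dist_tf_grid[of "1 / real j" z] j by (simp add: r_def dist_commute)
    have r1: "dist z (r z) \<le> 1" for z
    proof -
      have "2 / real j \<le> 1" using j by simp
      then show ?thesis using r[of z] by linarith
    qed
    have fin: "finite (r ` Q)"
      unfolding r_def Q_def using j by (intro finite_tf_grid_box) auto
    have sets: "Q \<in> sets lborel" "\<And>k. {z \<in> space lborel. r z = k} \<in> sets lborel"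
      unfolding Q_def r_def by measurable
    have outside: "tf_size z \<ge> real j" if "z \<notin> Q" for z
      using that by (auto simp: Q_def tf_box_def tf_size_def)
    define a where "a k = (LBINT z. indicator (Q \<inter> {z \<in> space lborel. r z = k}) z * c z)" for k
    have riemann: "has_bochner_integral lborel (\<lambda>z. indicator Q z * c z * X (r z)) (\<Sum>k\<in>r ` Q. a k * X k)" for X
      unfolding a_def by (rule finite_range_integral[OF fin sets cint])
    \<comment> \<open>One expression covers both cases. Inside the box it is the Lipschitz bound
      with displacement 2 / j; outside, one spare power of \<open>tf_size\<close>, divided by j, is
      at least 1.\<close>
    define err where "err z = 2 * A * (tf_size z ^ (2 * m + 1) / real j)" for z
    have err: "\<bar>t\<bar> ^ k * norm (nth_deriv n (tf_atom G z) t - indicator Q z * nth_deriv n (tf_atom G (r z)) t) \<le> err z"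
      if kn: "k \<le> m" "n \<le> m" for k n z t
    proof (cases "z \<in> Q")
      case True
      have "A * dist z (r z) * tf_size z ^ (2 * m + 1) \<le> A * (2 / real j) * tf_size z ^ (2 * m + 1)"
        using A(1) r[of z] by (intro mult_right_mono mult_left_mono) auto
      then show ?thesis
        using A(3)[OF kn r1, of t z] True by (simp add: err_def field_simps)
    next
      case False
      have "A * tf_size z ^ (2 * m) * real j \<le> A * tf_size z ^ (2 * m) * tf_size z"
        using A(1) outside[OF False] by (intro mult_left_mono) auto
      then have "A * tf_size z ^ (2 * m) \<le> A * tf_size z ^ (2 * m + 1) / real j"
        using j by (simp add: field_simps)
      also have "\<dots> \<le> err z"
        using A(1) j by (simp add: err_def divide_simps)
      finally show ?thesis
        using A(2)[OF kn, of t z] False by simp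
    qed
    have errint: "integrable lborel (\<lambda>z. norm (c z) * err z)" "(LBINT z. norm (c z) * err z) = 2 * A * S0 / real j"
    proof -
      have *: "(\<lambda>z. norm (c z) * err z) = (\<lambda>z. 2 * A / real j * (norm (c z) * tf_size z ^ (2 * m + 1)))"
        by (simp add: err_def fun_eq_iff field_simps)
      show "integrable lborel (\<lambda>z. norm (c z) * err z)"
        unfolding * by (intro integrable_mult_right int)
      show "(LBINT z. norm (c z) * err z) = 2 * A * S0 / real j"
        unfolding * S0_def by simp
    qed
    let ?I = "\<lambda>t. \<Sum>k\<in>r ` Q. a k * tf_atom G k t"
    have I: "?I \<in> schwartz"
      by (intro schwartz_sum fin schwartz_scale S)
    have fI: "f ?I = (\<Sum>k\<in>r ` Q. a k * f (tf_atom G k))"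
      using tempered_sum[OF f fin, of "\<lambda>k t. a k * tf_atom G k t"] by (simp add: schwartz_scale S tempered_scale[OF f])
    have "norm (f (\<lambda>t. ?K t - ?I t)) \<le> C * (2 * A * S0 / real j)"
    proof (intro C(2) schwartz_diff K I)
      fix k n t assume kn: "k \<le> m" "n \<le> m"
      have "nth_deriv n ?I t = (\<Sum>k\<in>r ` Q. a k * nth_deriv n (tf_atom G k) t)"
        by (subst nth_deriv_sum[OF fin]) (simp_all add: schwartz_scale S nth_deriv_scale)
      also have "\<dots> = (LBINT z. indicator Q z * c z * nth_deriv n (tf_atom G (r z)) t)"
        using riemann[of "\<lambda>k. nth_deriv n (tf_atom G k) t"] by (simp add: has_bochner_integral_integral_eq)
      finally have "nth_deriv n (\<lambda>t. ?K t - ?I t) t = (LBINT z. c z * nth_deriv n (tf_atom G z) t)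
          - (LBINT z. indicator Q z * c z * nth_deriv n (tf_atom G (r z)) t)"
        using schwartz_family_nth_deriv[OF fam, of n]
        by (simp add: nth_deriv_diff[OF K I] nth_deriv_scale[OF S])
      also have "\<dots> = (LBINT z. c z * nth_deriv n (tf_atom G z) t - indicator Q z * c z * nth_deriv n (tf_atom G (r z)) t)"
        using schwartz_family_integrable[OF schwartz_family_nth_deriv_family[OF fam, of n], of t]
          riemann[of "\<lambda>k. nth_deriv n (tf_atom G k) t", THEN integrable.intros]
        by (intro Bochner_Integration.integral_diff[symmetric]) (simp_all add: nth_deriv_scale[OF S])
      finally have eq: "nth_deriv n (\<lambda>t. ?K t - ?I t) t =
        (LBINT z. c z * (nth_deriv n (tf_atom G z) t - indicator Q z * nth_deriv n (tf_atom G (r z)) t))"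
        by (simp add: algebra_simps)
      have "wderiv k n (\<lambda>t. ?K t - ?I t) t
        = norm (LBINT z. of_real (\<bar>t\<bar> ^ k) * (c z * (nth_deriv n (tf_atom G z) t - indicator Q z * nth_deriv n (tf_atom G (r z)) t)))"
        unfolding eq by (subst integral_mult_right_zero) (simp add: norm_mult norm_power)
      also have "\<dots> \<le> (LBINT z. norm (c z) * err z)"
      proof (rule Bochner_Integration.integral_norm_bound_integral[OF integrable_mult_right errint(1)])
        show "integrable lborel (\<lambda>z. c z * (nth_deriv n (tf_atom G z) t - indicator Q z * nth_deriv n (tf_atom G (r z)) t))"
          using Bochner_Integration.integrable_diff[OF
              schwartz_family_integrable[OF schwartz_family_nth_deriv_family[OF fam, of n], of t]
              riemann[of "\<lambda>k. nth_deriv n (tf_atom G k) t", THEN integrable.intros]]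
          by (simp add: nth_deriv_scale[OF S] algebra_simps)
        show "norm (of_real (\<bar>t\<bar> ^ k) * (c z * (nth_deriv n (tf_atom G z) t - indicator Q z * nth_deriv n (tf_atom G (r z)) t)))
            \<le> norm (c z) * err z" for z
          using mult_left_mono[OF err[OF kn, of t z], of "norm (c z)"]
          by (simp add: norm_mult norm_power mult_ac)
      qed
      also have "\<dots> = 2 * A * S0 / real j" by (rule errint)
      finally show "wderiv k n (\<lambda>t. ?K t - ?I t) t \<le> 2 * A * S0 / real j" .
    qed
    then have 1: "norm (f ?K - f ?I) \<le> C * (2 * A * S0 / real j)"
      by (simp add: tempered_diff[OF f K I])
    have 2: "norm (f ?I - (LBINT z. c z * f (tf_atom G z))) \<le> C * (2 * A * S0 / real j)"
    proof -
      have "f ?I = (LBINT z. indicator Q z * c z * f (tf_atom G (r z)))"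
        using riemann[of "\<lambda>k. f (tf_atom G k)"] by (simp add: fI has_bochner_integral_integral_eq)
      then have "norm (f ?I - (LBINT z. c z * f (tf_atom G z))) =
          norm (LBINT z. c z * f (tf_atom G z) - indicator Q z * c z * f (tf_atom G (r z)))"
        using riemann[of "\<lambda>k. f (tf_atom G k)", THEN integrable.intros] fint
        by (simp add: norm_minus_commute)
      also have "\<dots> \<le> (LBINT z. C * (norm (c z) * err z))"
      proof (rule Bochner_Integration.integral_norm_bound_integral)
        show "integrable lborel (\<lambda>z. c z * f (tf_atom G z) - indicator Q z * c z * f (tf_atom G (r z)))"
          using riemann[of "\<lambda>k. f (tf_atom G k)", THEN integrable.intros] fint by simp
        show "integrable lborel (\<lambda>z. C * (norm (c z) * err z))"
          using errint by simp
        fix z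
        \<comment> \<open>The seminorm estimate used for the first error is reused for the single
          function \<open>?\<psi>\<close>, so f is bounded before integrating in z.\<close>
        let ?\<psi> = "\<lambda>t. tf_atom G z t - indicator Q z * tf_atom G (r z) t"
        have "norm (f ?\<psi>) \<le> C * err z"
          by (intro C(2) schwartz_diff schwartz_scale S)
            (simp add: nth_deriv_diff schwartz_scale S nth_deriv_scale err)
        also have "f ?\<psi> = f (tf_atom G z) - indicator Q z * f (tf_atom G (r z))"
          by (simp add: tempered_diff[OF f] schwartz_scale S tempered_scale[OF f])
        finally have "norm (c z) * norm (f (tf_atom G z) - indicator Q z * f (tf_atom G (r z))) \<le> norm (c z) * (C * err z)"
          by (rule mult_left_mono) simp
        then show "norm (c z * f (tf_atom G z) - indicator Q z * c z * f (tf_atom G (r z))) \<le> C * (norm (c z) * err z)"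
          by (simp add: norm_mult[symmetric] algebra_simps)
      qed
      also have "\<dots> = C * (2 * A * S0 / real j)"
        using errint by simp
      finally show ?thesis .
    qed
    have "f ?K - (LBINT z. c z * f (tf_atom G z)) = (f ?K - f ?I) + (f ?I - (LBINT z. c z * f (tf_atom G z)))"
      by simp
    then have "norm (f ?K - (LBINT z. c z * f (tf_atom G z))) \<le> C * (2 * A * S0 / real j) + C * (2 * A * S0 / real j)"
      using norm_triangle_le[OF add_mono[OF 1 2]] by simp
    then show ?thesis by (simp add: mult_ac)
  qed
  then have "norm (f ?K - (LBINT z. c z * f (tf_atom G z))) \<le> 0"
    by (intro tendsto_lowerbound[OF lim_const_over_n[of "4 * C * A * S0"]])
      (auto simp: eventually_sequentially intro!: exI[of _ 2])
  then show "f ?K = (LBINT z. c z * f (tf_atom G z))"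
    by simp
qed

section \<open>Fourier inversion\<close>


lemma integrable_inverse_1_plus_square_lborel: "integrable lborel (\<lambda>x::real. 1 / (1 + x\<^sup>2))"
  using integrable_inverse_1_plus_square
  by (simp add: set_integrable_def einterval_eq_UNIV inverse_eq_divide)

lemma schwartz_integrable:
  assumes "f \<in> schwartz"
  shows "integrable lborel f"
proof -
  obtain C where C: "C \<ge> 0" "\<And>t. norm (f t) * (1 + \<bar>t\<bar>) ^ 2 \<le> C"
    using schwartz_decay[OF assms] by blast
  show ?thesis
  proof (rule Bochner_Integration.integrable_bound)
    show "integrable lborel (\<lambda>x::real. C * (1 / (1 + x\<^sup>2)))"
      by (intro integrable_mult_right integrable_inverse_1_plus_square_lborel)
    show "f \<in> borel_measurable lborel"
      using borel_measurable_continuous_onI[OF schwartz_continuous[OF assms]] by simp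
    show "AE t in lborel. norm (f t) \<le> norm (C * (1 / (1 + t\<^sup>2)))"
    proof (rule AE_I2)
      fix t :: real
      have "norm (f t) * (1 + t\<^sup>2) \<le> norm (f t) * (1 + \<bar>t\<bar>) ^ 2"
        by (intro mult_left_mono) (auto simp: power2_sum)
      then have "norm (f t) * (1 + t\<^sup>2) \<le> C" using C(2)[of t] by linarith
      moreover have "1 + t\<^sup>2 > 0" by (simp add: add_pos_nonneg)
      ultimately show "norm (f t) \<le> norm (C * (1 / (1 + t\<^sup>2)))"
        using C(1) by (simp add: field_simps)
    qed
  qed
qed

lemma schwartz_measurable: "f \<in> schwartz \<Longrightarrow> f \<in> borel_measurable borel"
  by (intro borel_measurable_continuous_onI schwartz_continuous)

lemma schwartz_tendsto_0:
  assumes "f \<in> schwartz"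
  shows "(f \<longlongrightarrow> 0) at_infinity"
proof -
  obtain C where C: "C \<ge> 0" "\<And>t. \<bar>t\<bar> ^ 1 * norm (f t) \<le> C"
    using schwartz_bounded[OF assms] by blast
  have "((\<lambda>t. C / norm t) \<longlongrightarrow> 0) at_infinity"
    by (intro tendsto_divide_0[OF tendsto_const] filterlim_at_top_imp_at_infinity filterlim_norm_at_top)
  moreover have "\<forall>\<^sub>F t in at_infinity. norm (f t) \<le> C / norm t"
    unfolding eventually_at_infinity
    by (rule exI[of _ 1]) (use C in \<open>auto simp: field_simps\<close>)
  ultimately show ?thesis by (rule Lim_null_comparison[rotated])
qed

lemma integral_vderiv_schwartz:
  assumes f: "f \<in> schwartz"
  shows "(LBINT t. vderiv f t) = 0"
proof -
  have lim: "(f \<longlongrightarrow> 0) at_top" "(f \<longlongrightarrow> 0) at_bot"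
    using schwartz_tendsto_0[OF f] by (meson tendsto_mono at_top_le_at_infinity at_bot_le_at_infinity)+
  have "(LBINT t=-\<infinity>..\<infinity>. vderiv f t) = 0 - 0"
  proof (rule interval_integral_FTC_integrable)
    show "set_integrable lborel (einterval (-\<infinity>) \<infinity>) (vderiv f)"
      using schwartz_integrable[OF schwartz_vderiv[OF f]] by (simp add: set_integrable_def einterval_eq_UNIV)
    show "isCont (vderiv f) x" for x
      using schwartz_continuous[OF schwartz_vderiv[OF f], of UNIV] by (simp add: continuous_on_eq_continuous_at)
    show "((f \<circ> real_of_ereal) \<longlongrightarrow> 0) (at_right (-\<infinity>))" "((f \<circ> real_of_ereal) \<longlongrightarrow> 0) (at_left \<infinity>)"
      unfolding ereal_tendsto_simps by (rule lim)+
  qed (auto intro: schwartz_has_vector_derivative f)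
  then show ?thesis
    by (simp add: interval_lebesgue_integral_def set_lebesgue_integral_def einterval_eq_UNIV)
qed

text \<open>Integration by parts: the derivative of \<open>echar (\<xi> * t) * f t\<close> has
  integral 0, since Schwartz functions vanish at infinity.\<close>

lemma integral_echar_vderiv:
  assumes f: "f \<in> schwartz"
  shows "(LBINT t. echar (\<xi> * t) * vderiv f t) = - (2 * pi * \<i> * \<xi>) * (LBINT t. echar (\<xi> * t) * f t)"
proof -
  have "((\<lambda>t. \<xi> * t) has_vector_derivative \<xi>) (at t)" for t
    unfolding has_real_derivative_iff_has_vector_derivative[symmetric]
    by (auto intro!: derivative_eq_intros)
  then have "((\<lambda>t. echar (\<xi> * t) * f t) has_vector_derivative
      echar (\<xi> * t) * vderiv f t + 2 * pi * \<i> * of_real \<xi> * echar (\<xi> * t) * f t) (at t)" for t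
    by (intro has_vector_derivative_mult echar_has_vector_derivative schwartz_has_vector_derivative f)
  then have "vderiv (\<lambda>t. echar (\<xi> * t) * f t) =
      (\<lambda>t. echar (\<xi> * t) * vderiv f t + 2 * pi * \<i> * of_real \<xi> * echar (\<xi> * t) * f t)"
    by (intro ext vector_derivative_at)
  then have "(LBINT t. echar (\<xi> * t) * vderiv f t + (2 * pi * \<i> * of_real \<xi>) * (echar (\<xi> * t) * f t)) = 0"
    using integral_vderiv_schwartz[OF schwartz_modulate[OF f, of \<xi>]] by (simp add: mult.assoc)
  moreover have "integrable lborel (\<lambda>t. echar (\<xi> * t) * h t)" if "h \<in> schwartz" for h
    by (intro schwartz_integrable schwartz_modulate that)
  ultimately show ?thesis
    using f schwartz_vderiv[OF f] by (simp add: add_eq_0_iff2)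
qed

lemma integral_echar_nth_deriv:
  "f \<in> schwartz \<Longrightarrow> (LBINT t. echar (\<xi> * t) * nth_deriv n f t) =
    (- (2 * pi * \<i> * \<xi>)) ^ n * (LBINT t. echar (\<xi> * t) * f t)"
  by (induction n) (simp_all add: nth_deriv_Suc integral_echar_vderiv schwartz_nth_deriv)

text \<open>A product majorant verifies both conditions of Tonelli at once. The complex double
  integrals exchanged in the transform identities below have integrands dominated in this
  way.\<close>

lemma integrable_pair_product_bound:
  fixes f :: "'a::euclidean_space \<times> 'b::euclidean_space \<Rightarrow> complex"
  assumes [measurable]: "f \<in> borel_measurable (lborel \<Otimes>\<^sub>M lborel)"
    and u: "integrable lborel u" and w: "integrable lborel w"
    and bd: "\<And>x y. norm (f (x, y)) \<le> u x * w y"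
  shows "integrable (lborel \<Otimes>\<^sub>M lborel) f"
proof (rule lborel_pair.Fubini_integrable)
  note [measurable] = borel_measurable_integrable[OF u] borel_measurable_integrable[OF w]
  have int: "integrable lborel (\<lambda>y. f (x, y))" for x
    by (rule Bochner_Integration.integrable_bound[OF integrable_mult_right[OF w, of "u x"]])
      (auto intro!: AE_I2 order_trans[OF bd abs_ge_self])
  then show "AE x in lborel. integrable lborel (\<lambda>y. f (x, y))" by simp
  show "integrable lborel (\<lambda>x. LBINT y. norm (f (x, y)))"
  proof (rule Bochner_Integration.integrable_bound[OF integrable_mult_left[OF u, of "LBINT y. w y"]])
    show "AE x in lborel. norm (LBINT y. norm (f (x, y))) \<le> norm (u x * (LBINT y. w y))"
    proof (rule AE_I2)
      fix x
      have "(LBINT y. norm (f (x, y))) \<le> (LBINT y. u x * w y)"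
        using int w by (intro integral_mono bd) auto
      then show "norm (LBINT y. norm (f (x, y))) \<le> norm (u x * (LBINT y. w y))"
        by (simp add: order_trans[OF _ abs_ge_self])
    qed
  qed measurable
qed measurable

lemma Fubini_product_bound:
  fixes f :: "'a::euclidean_space \<Rightarrow> 'b::euclidean_space \<Rightarrow> complex"
  assumes "case_prod f \<in> borel_measurable (lborel \<Otimes>\<^sub>M lborel)"
    and "integrable lborel u" "integrable lborel w" "\<And>x y. norm (f x y) \<le> u x * w y"
  shows "(LBINT x. LBINT y. f x y) = (LBINT y. LBINT x. f x y)"
  by (rule lborel_pair.Fubini_integral[symmetric], rule integrable_pair_product_bound) (use assms in auto)

lemma echar_diff: "echar (x - y) = echar x * echar (- y)"
  using echar_add[of x "- y"] by simp

text \<open>The Fourier transform of the Gaussian is taken from the characteristic function of the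
  standard normal law.\<close>

lemma integral_std_normal_density_iexp:
  "(LBINT x. of_real (std_normal_density x) * iexp (u * x)) = of_real (exp (- (u\<^sup>2) / 2))"
proof -
  have "char std_normal_distribution u = (LBINT x. std_normal_density x *\<^sub>R iexp (u * x))"
    unfolding char_def by (subst integral_density) auto
  then show ?thesis
    by (simp add: char_std_normal_distribution scaleR_conv_of_real)
qed

lemma integral_gaussian_echar:
  assumes "\<epsilon> > 0"
  shows "(LBINT \<xi>. of_real (std_normal_density (2 * pi * \<epsilon> * \<xi>)) * echar (\<xi> * u)) =
    of_real (1 / (2 * pi * \<epsilon>) * exp (- ((u / \<epsilon>)\<^sup>2) / 2))"
proof -
  have "of_real (exp (- ((u / \<epsilon>)\<^sup>2) / 2)) = (LBINT x. of_real (std_normal_density x) * iexp ((u / \<epsilon>) * x))"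
    by (rule integral_std_normal_density_iexp[symmetric])
  also have "\<dots> = \<bar>2 * pi * \<epsilon>\<bar> *\<^sub>R (LBINT \<xi>. of_real (std_normal_density (0 + 2 * pi * \<epsilon> * \<xi>)) * iexp ((u / \<epsilon>) * (0 + 2 * pi * \<epsilon> * \<xi>)))"
    using assms by (intro lborel_integral_real_affine) auto
  also have "\<dots> = of_real (2 * pi * \<epsilon>) * (LBINT \<xi>. of_real (std_normal_density (2 * pi * \<epsilon> * \<xi>)) * echar (\<xi> * u))"
    using assms by (simp add: scaleR_conv_of_real echar_def cis_conv_exp mult_ac)
  finally show ?thesis using assms by (simp add: field_simps)
qed

lemma integrable_std_normal_scaled:
  assumes "c \<noteq> 0"
  shows "integrable lborel (\<lambda>\<xi>. std_normal_density (c * \<xi>))"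
  using lborel_integrable_real_affine[OF integrable_normal_density[of 1 0], of c 0] assms by simp

text \<open>Gaussian regularization: the regularized inversion integral is the average of \<open>a\<close> against a
  Gaussian of width \<open>\<epsilon>\<close>. The sign \<open>\<sigma>\<close> covers both conventions for the transform.\<close>

lemma fourier_inversion:
  fixes a :: "real \<Rightarrow> complex"
  assumes cont: "continuous_on UNIV a" and bdd: "\<And>t. norm (a t) \<le> B" and a: "integrable lborel a"
    and \<sigma>: "\<sigma> = 1 \<or> \<sigma> = -1"
    and ahat: "integrable lborel (\<lambda>\<xi>. LBINT s. echar (\<sigma> * \<xi> * s) * a s)"
  shows "(LBINT \<xi>. echar (- \<sigma> * \<xi> * t) * (LBINT s. echar (\<sigma> * \<xi> * s) * a s)) = a t"
proof -
  let ?g = std_normal_density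
  define A where "A \<xi> = (LBINT s. echar (\<sigma> * \<xi> * s) * a s)" for \<xi>
  have [measurable]: "a \<in> borel_measurable borel" using borel_measurable_integrable[OF a] by simp
  have [measurable]: "A \<in> borel_measurable borel" using borel_measurable_integrable[OF ahat] by (simp add: A_def[abs_def])
  have J: "(LBINT \<xi>. of_real (?g (2 * pi * \<epsilon> * \<xi>)) * (echar (- \<sigma> * \<xi> * t) * A \<xi>))
      = of_real (1 / sqrt (2 * pi)) * (LBINT y. of_real (?g y) * a (t + \<epsilon> * y))" if \<epsilon>: "\<epsilon> > 0" for \<epsilon>
  proof -
    have "(LBINT \<xi>. of_real (?g (2 * pi * \<epsilon> * \<xi>)) * (echar (- \<sigma> * \<xi> * t) * A \<xi>))
      = (LBINT \<xi>. (LBINT s. of_real (?g (2 * pi * \<epsilon> * \<xi>)) * echar (\<xi> * (\<sigma> * (s - t))) * a s))"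
      unfolding A_def
      by (intro Bochner_Integration.integral_cong refl)
        (simp add: algebra_simps echar_diff flip: integral_mult_right_zero)
    also have "\<dots> = (LBINT s. (LBINT \<xi>. of_real (?g (2 * pi * \<epsilon> * \<xi>)) * echar (\<xi> * (\<sigma> * (s - t))) * a s))"
    proof (rule Fubini_product_bound)
      show "integrable lborel (\<lambda>\<xi>. ?g (2 * pi * \<epsilon> * \<xi>))"
        using \<epsilon> by (intro integrable_std_normal_scaled) auto
      show "integrable lborel (\<lambda>s. norm (a s))" using a by simp
      show "norm (of_real (?g (2 * pi * \<epsilon> * \<xi>)) * echar (\<xi> * (\<sigma> * (s - t))) * a s) \<le> ?g (2 * pi * \<epsilon> * \<xi>) * norm (a s)"
        for \<xi> s by (simp add: norm_mult)
    qed measurable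
    also have "\<dots> = (LBINT s. of_real (1 / (2 * pi * \<epsilon>) * exp (- ((\<sigma> * (s - t) / \<epsilon>)\<^sup>2) / 2)) * a s)"
      using integral_gaussian_echar[OF \<epsilon>] by simp
    also have "\<dots> = \<bar>\<epsilon>\<bar> *\<^sub>R (LBINT y. of_real (1 / (2 * pi * \<epsilon>) * exp (- ((\<sigma> * ((t + \<epsilon> * y) - t) / \<epsilon>)\<^sup>2) / 2)) * a (t + \<epsilon> * y))"
      using \<epsilon> by (intro lborel_integral_real_affine) auto
    also have "\<dots> = (LBINT y. of_real (1 / sqrt (2 * pi)) * (of_real (?g y) * a (t + \<epsilon> * y)))"
    proof -
      have "\<epsilon> *\<^sub>R (of_real (1 / (2 * pi * \<epsilon>) * exp (- ((\<sigma> * ((t + \<epsilon> * y) - t) / \<epsilon>)\<^sup>2) / 2)) * a (t + \<epsilon> * y))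
        = of_real (1 / sqrt (2 * pi)) * (of_real (?g y) * a (t + \<epsilon> * y))" for y
      proof -
        have "\<epsilon> * (1 / (2 * pi * \<epsilon>) * exp (- ((\<sigma> * ((t + \<epsilon> * y) - t) / \<epsilon>)\<^sup>2) / 2)) = 1 / sqrt (2 * pi) * ?g y"
          using \<epsilon> \<sigma> by (auto simp: normal_density_def real_sqrt_mult[symmetric] field_simps)
        then show ?thesis
          by (simp only: scaleR_conv_of_real mult.assoc[symmetric] of_real_mult[symmetric])
      qed
      then show ?thesis
        unfolding abs_of_pos[OF \<epsilon>] integral_scaleR_right[symmetric] by (simp only:)
    qed
    finally show ?thesis by simp
  qed
  define e where "e n = inverse (real (Suc n))" for n
  have e: "e n > 0" "e \<longlonglongrightarrow> 0" for n
    using LIMSEQ_inverse_real_of_nat by (simp_all add: e_def[abs_def])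
  \<comment> \<open>In the limit the regularizing factor becomes the constant \<open>?g 0\<close>,
    that is 1 / sqrt (2 pi). The same constant multiplies the average of a on the other side, so it
    cancels at the end.\<close>
  have L1: "(\<lambda>n. LBINT \<xi>. of_real (?g (2 * pi * e n * \<xi>)) * (echar (- \<sigma> * \<xi> * t) * A \<xi>))
      \<longlonglongrightarrow> (LBINT \<xi>. of_real (?g (2 * pi * 0 * \<xi>)) * (echar (- \<sigma> * \<xi> * t) * A \<xi>))"
  proof (rule integral_dominated_convergence[where w = "\<lambda>\<xi>. norm (A \<xi>)"])
    show "integrable lborel (\<lambda>\<xi>. norm (A \<xi>))" using ahat by (simp add: A_def[abs_def])
    have "isCont ?g x" for x unfolding normal_density_def by (intro continuous_intros) auto
    then show "AE \<xi> in lborel. (\<lambda>n. of_real (?g (2 * pi * e n * \<xi>)) * (echar (- \<sigma> * \<xi> * t) * A \<xi>))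
        \<longlonglongrightarrow> of_real (?g (2 * pi * 0 * \<xi>)) * (echar (- \<sigma> * \<xi> * t) * A \<xi>)"
      by (intro AE_I2 tendsto_intros isCont_tendsto_compose[of _ ?g] e)
    have "?g x \<le> 1" for x
    proof -
      have "1 \<le> sqrt (2 * pi)" using pi_gt3 by simp
      then show ?thesis by (auto simp: normal_density_def divide_simps intro: order_trans[of _ 1])
    qed
    then show "AE \<xi> in lborel. norm (of_real (?g (2 * pi * e n * \<xi>)) * (echar (- \<sigma> * \<xi> * t) * A \<xi>)) \<le> norm (A \<xi>)" for n
      by (intro AE_I2) (simp add: norm_mult mult_left_le_one_le)
  qed measurable
  have "(\<lambda>n. LBINT y. of_real (?g y) * a (t + e n * y)) \<longlonglongrightarrow> (LBINT y. of_real (?g y) * a (t + 0 * y))"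
  proof (rule integral_dominated_convergence[where w = "\<lambda>y. ?g y * B"])
    show "integrable lborel (\<lambda>y. ?g y * B)" by (intro integrable_mult_left integrable_normal_density) simp
    have "isCont a x" for x using cont by (simp add: continuous_on_eq_continuous_at)
    then show "AE y in lborel. (\<lambda>n. of_real (?g y) * a (t + e n * y)) \<longlonglongrightarrow> of_real (?g y) * a (t + 0 * y)"
      by (intro AE_I2 tendsto_intros isCont_tendsto_compose[of _ a] e)
    show "AE y in lborel. norm (of_real (?g y) * a (t + e n * y)) \<le> ?g y * B" for n
      by (intro AE_I2) (simp add: norm_mult mult_left_mono bdd)
  qed measurable
  then have L2: "(\<lambda>n. of_real (1 / sqrt (2 * pi)) * (LBINT y. of_real (?g y) * a (t + e n * y)))
      \<longlonglongrightarrow> of_real (1 / sqrt (2 * pi)) * (LBINT y. of_real (?g y) * a (t + 0 * y))"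
    by (intro tendsto_intros)
  have "(LBINT \<xi>. of_real (?g (2 * pi * 0 * \<xi>)) * (echar (- \<sigma> * \<xi> * t) * A \<xi>))
      = of_real (1 / sqrt (2 * pi)) * (LBINT y. of_real (?g y) * a (t + 0 * y))"
    using L1 L2 unfolding J[OF e(1)] by (rule LIMSEQ_unique)
  moreover have "(LBINT y. complex_of_real (?g y)) = 1"
    using integral_std_normal_density_iexp[of 0] by simp
  ultimately show ?thesis
    by (simp add: A_def normal_density_def)
qed

section \<open>The reproducing formula\<close>


text \<open>Four additional powers of \<open>tf_size\<close> are spent: two dominate 1 + x squared
  and two dominate 1 + y squared, and the reciprocals of these are integrable on the line.\<close>

lemma integrable_tf_size_decay:
  fixes c :: "real \<times> real \<Rightarrow> complex"
  assumes [measurable]: "c \<in> borel_measurable borel"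
    and decay: "\<And>m. \<exists>C. \<forall>z. norm (c z) * tf_size z ^ m \<le> C"
  shows "integrable lborel (\<lambda>z. norm (c z) * tf_size z ^ m)"
proof -
  obtain C where C: "\<And>z. norm (c z) * tf_size z ^ (m + 4) \<le> C"
    using decay by blast
  have [measurable]: "tf_size \<in> borel_measurable borel"
    unfolding tf_size_def[abs_def] borel_prod[symmetric] by measurable
  have "integrable (lborel \<Otimes>\<^sub>M lborel) (\<lambda>z. c z * of_real (tf_size z ^ m))"
  proof (rule integrable_pair_product_bound)
    show "(\<lambda>z. c z * of_real (tf_size z ^ m)) \<in> borel_measurable (lborel \<Otimes>\<^sub>M lborel)"
      unfolding lborel_prod by measurable
    show "integrable lborel (\<lambda>x::real. C * (1 / (1 + x\<^sup>2)))" "integrable lborel (\<lambda>x::real. 1 / (1 + x\<^sup>2))"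
      by (intro integrable_mult_right integrable_inverse_1_plus_square_lborel)+
    fix x y :: real
    let ?w = "tf_size (x, y)"
    have pos: "1 + x\<^sup>2 > 0" "1 + y\<^sup>2 > 0" by (simp_all add: add_pos_nonneg)
    have "1 + x\<^sup>2 \<le> (1 + \<bar>x\<bar>)\<^sup>2" "1 + y\<^sup>2 \<le> (1 + \<bar>y\<bar>)\<^sup>2"
      by (simp_all add: power2_sum)
    moreover have "(1 + \<bar>x\<bar>)\<^sup>2 \<le> ?w\<^sup>2" "(1 + \<bar>y\<bar>)\<^sup>2 \<le> ?w\<^sup>2"
      by (intro power_mono; simp add: tf_size_def)+
    ultimately have "1 + x\<^sup>2 \<le> ?w\<^sup>2" "1 + y\<^sup>2 \<le> ?w\<^sup>2"
      by (blast intro: order_trans)+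
    then have "(1 + x\<^sup>2) * (1 + y\<^sup>2) \<le> ?w\<^sup>2 * ?w\<^sup>2"
      using pos by (intro mult_mono) auto
    then have "norm (c (x, y)) * ?w ^ m * ((1 + x\<^sup>2) * (1 + y\<^sup>2)) \<le> norm (c (x, y)) * ?w ^ m * (?w\<^sup>2 * ?w\<^sup>2)"
      by (intro mult_left_mono) auto
    also have "\<dots> = norm (c (x, y)) * ?w ^ (m + 4)"
      by (simp add: power_add power2_eq_square power4_eq_xxxx mult_ac)
    also have "\<dots> \<le> C" by (rule C)
    finally show "norm (c (x, y) * of_real (?w ^ m)) \<le> C * (1 / (1 + x\<^sup>2)) * (1 / (1 + y\<^sup>2))"
      using pos by (simp add: norm_mult norm_power pos_le_divide_eq mult_ac)
  qed
  then have "integrable lborel (\<lambda>z. norm (c z * of_real (tf_size z ^ m)))"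
    unfolding lborel_prod by (rule integrable_norm)
  then show ?thesis by (simp add: norm_mult norm_power)
qed

text \<open>The inequality 1 + \<bar>x\<bar> \<le> (1 + \<bar>t\<bar>) (1 + \<bar>t - x\<bar>)
  distributes a weight in the translation parameter over the two factors, each of which decays at
  every rate. Derivatives are handled by the product rule, so both functions stay arbitrary in the
  induction.\<close>

lemma translate_product_bound:
  "\<gamma> \<in> schwartz \<Longrightarrow> \<phi> \<in> schwartz \<Longrightarrow> \<exists>C\<ge>0. \<forall>x t.
    wderiv k n (\<lambda>t. \<gamma> (t - x) * \<phi> t) t * (1 + \<bar>x\<bar>) ^ m \<le> C"
proof (induction n arbitrary: \<gamma> \<phi>)
  case 0
  obtain C1 where C1: "C1 \<ge> 0" "\<And>t. norm (\<gamma> t) * (1 + \<bar>t\<bar>) ^ m \<le> C1"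
    using schwartz_decay[OF 0(1)] by blast
  obtain C2 where C2: "C2 \<ge> 0" "\<And>t. norm (\<phi> t) * (1 + \<bar>t\<bar>) ^ (k + m) \<le> C2"
    using schwartz_decay[OF 0(2)] by blast
  have "\<bar>t\<bar> ^ k * norm (\<gamma> (t - x) * \<phi> t) * (1 + \<bar>x\<bar>) ^ m \<le> C1 * C2" for x t
  proof -
    have "1 + \<bar>x\<bar> \<le> 1 + \<bar>t\<bar> + \<bar>t - x\<bar>" by linarith
    also have "\<dots> \<le> (1 + \<bar>t\<bar>) * (1 + \<bar>t - x\<bar>)" by (simp add: algebra_simps)
    finally have "(1 + \<bar>x\<bar>) ^ m \<le> ((1 + \<bar>t\<bar>) * (1 + \<bar>t - x\<bar>)) ^ m"
      by (intro power_mono) auto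
    moreover have "\<bar>t\<bar> ^ k \<le> (1 + \<bar>t\<bar>) ^ k" by (intro power_mono) auto
    ultimately have "\<bar>t\<bar> ^ k * (1 + \<bar>x\<bar>) ^ m \<le> (1 + \<bar>t\<bar>) ^ k * ((1 + \<bar>t\<bar>) * (1 + \<bar>t - x\<bar>)) ^ m"
      by (intro mult_mono) auto
    then have "norm (\<gamma> (t - x) * \<phi> t) * (\<bar>t\<bar> ^ k * (1 + \<bar>x\<bar>) ^ m)
        \<le> norm (\<gamma> (t - x) * \<phi> t) * ((1 + \<bar>t\<bar>) ^ k * ((1 + \<bar>t\<bar>) * (1 + \<bar>t - x\<bar>)) ^ m)"
      by (rule mult_left_mono) simp
    also have "\<dots> = (norm (\<gamma> (t - x)) * (1 + \<bar>t - x\<bar>) ^ m) * (norm (\<phi> t) * (1 + \<bar>t\<bar>) ^ (k + m))"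
      by (simp add: norm_mult power_mult_distrib power_add mult_ac)
    also have "\<dots> \<le> C1 * C2"
      by (intro mult_mono C1 C2) auto
    finally show ?thesis by (simp add: mult_ac)
  qed
  then show ?case using C1(1) C2(1) by (auto intro!: exI[of _ "C1 * C2"])
next
  case (Suc n)
  note \<gamma>' = schwartz_vderiv[OF Suc.prems(1)] and \<phi>' = schwartz_vderiv[OF Suc.prems(2)]
  obtain C1 where C1: "C1 \<ge> 0"
    "\<And>x t. wderiv k n (\<lambda>t. \<gamma> (t - x) * vderiv \<phi> t) t * (1 + \<bar>x\<bar>) ^ m \<le> C1"
    using Suc.IH[OF Suc.prems(1) \<phi>'] by blast
  obtain C2 where C2: "C2 \<ge> 0"
    "\<And>x t. wderiv k n (\<lambda>t. vderiv \<gamma> (t - x) * \<phi> t) t * (1 + \<bar>x\<bar>) ^ m \<le> C2"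
    using Suc.IH[OF \<gamma>' Suc.prems(2)] by blast
  have "wderiv k (Suc n) (\<lambda>t. \<gamma> (t - x) * \<phi> t) t * (1 + \<bar>x\<bar>) ^ m \<le> C1 + C2" for x t
  proof -
    have "vector_derivative (\<lambda>t. \<gamma> (t - x)) (at t) = vderiv \<gamma> (t - x)" for t
      using fun_cong[OF vderiv_tf_atom[OF Suc.prems(1), of "(x, 0)"]] by (simp add: tf_atom_def)
    then have "nth_deriv (Suc n) (\<lambda>t. \<gamma> (t - x) * \<phi> t)
      = nth_deriv n (\<lambda>t. \<gamma> (t - x) * vderiv \<phi> t + vderiv \<gamma> (t - x) * \<phi> t)"
      unfolding nth_deriv_Suc2
      by (subst vderiv_mult[OF schwartz_translate[OF Suc.prems(1)] Suc.prems(2)]) simp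
    also have "\<dots> = (\<lambda>t. nth_deriv n (\<lambda>t. \<gamma> (t - x) * vderiv \<phi> t) t + nth_deriv n (\<lambda>t. vderiv \<gamma> (t - x) * \<phi> t) t)"
      by (intro nth_deriv_add schwartz_mult schwartz_translate Suc.prems \<gamma>' \<phi>')
    finally have "wderiv k (Suc n) (\<lambda>t. \<gamma> (t - x) * \<phi> t) t * (1 + \<bar>x\<bar>) ^ m \<le>
      \<bar>t\<bar> ^ k * (norm (nth_deriv n (\<lambda>t. \<gamma> (t - x) * vderiv \<phi> t) t)
        + norm (nth_deriv n (\<lambda>t. vderiv \<gamma> (t - x) * \<phi> t) t)) * (1 + \<bar>x\<bar>) ^ m"
      by (intro mult_right_mono mult_left_mono) (auto intro: norm_triangle_ineq)
    also have "\<dots> \<le> C1 + C2"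
      using C1(2)[of t x] C2(2)[of t x] by (simp add: algebra_simps)
    finally show ?thesis .
  qed
  then show ?case using C1(1) C2(1) by (auto intro!: exI[of _ "C1 + C2"])
qed

text \<open>These are the coefficients with which \<phi> is synthesized from atoms, analysed with a
  possibly different window \<gamma>. The frequency sign is opposite to that of
  \<open>tf_atom\<close>, so that the two characters cancel under inversion.\<close>

definition cross_transform :: "(real \<Rightarrow> complex) \<Rightarrow> (real \<Rightarrow> complex) \<Rightarrow> real \<times> real \<Rightarrow> complex"
  where "cross_transform \<gamma> \<phi> z = (LBINT t. echar (snd z * t) * (\<gamma> (t - fst z) * \<phi> t))"

lemma measurable_cross_transform [measurable]:
  assumes "\<gamma> \<in> schwartz" "\<phi> \<in> schwartz"
  shows "cross_transform \<gamma> \<phi> \<in> borel_measurable borel"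
proof -
  note [measurable] = schwartz_measurable[OF assms(1)] schwartz_measurable[OF assms(2)]
  show ?thesis
    unfolding cross_transform_def[abs_def] borel_prod[symmetric] by measurable
qed

text \<open>Repeated integration by parts trades the frequency power for a derivative of the
  product, and the position weight is absorbed by the decay of that product in x. The exponents 0
  and 2 in t together give the integrable majorant 1 / (1 + t squared).\<close>

lemma cross_transform_decay:
  assumes S: "\<gamma> \<in> schwartz" "\<phi> \<in> schwartz"
  shows "\<exists>C\<ge>0. \<forall>z. norm (cross_transform \<gamma> \<phi> z) * (1 + \<bar>fst z\<bar>) ^ m * \<bar>snd z\<bar> ^ n \<le> C"
proof -
  obtain C0 where C0: "C0 \<ge> 0"
    "\<And>x t. wderiv 0 n (\<lambda>t. \<gamma> (t - x) * \<phi> t) t * (1 + \<bar>x\<bar>) ^ m \<le> C0"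
    using translate_product_bound[OF S] by blast
  obtain C2 where C2: "C2 \<ge> 0"
    "\<And>x t. wderiv 2 n (\<lambda>t. \<gamma> (t - x) * \<phi> t) t * (1 + \<bar>x\<bar>) ^ m \<le> C2"
    using translate_product_bound[OF S] by blast
  have "norm (cross_transform \<gamma> \<phi> (x, \<xi>)) * (1 + \<bar>x\<bar>) ^ m * \<bar>\<xi>\<bar> ^ n \<le> (C0 + C2) * (LBINT t. 1 / (1 + t\<^sup>2))" for x \<xi>
  proof -
    let ?p = "\<lambda>t. \<gamma> (t - x) * \<phi> t"
    have p: "?p \<in> schwartz" by (intro schwartz_mult schwartz_translate S)
    have nx: "norm (1 + complex_of_real \<bar>x\<bar>) = 1 + \<bar>x\<bar>"
      using norm_of_real[of "1 + \<bar>x\<bar>"] by simp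
    have "\<bar>\<xi>\<bar> ^ n \<le> \<bar>2 * pi * \<xi>\<bar> ^ n"
    proof (rule power_mono)
      have "1 * \<bar>\<xi>\<bar> \<le> 2 * pi * \<bar>\<xi>\<bar>" using pi_ge_two by (intro mult_right_mono) auto
      then show "\<bar>\<xi>\<bar> \<le> \<bar>2 * pi * \<xi>\<bar>" by (simp add: abs_mult)
    qed simp
    then have "norm (cross_transform \<gamma> \<phi> (x, \<xi>)) * (1 + \<bar>x\<bar>) ^ m * \<bar>\<xi>\<bar> ^ n
        \<le> norm (cross_transform \<gamma> \<phi> (x, \<xi>)) * (1 + \<bar>x\<bar>) ^ m * \<bar>2 * pi * \<xi>\<bar> ^ n"
      by (intro mult_left_mono) auto
    also have "\<dots> = norm (LBINT t. of_real ((1 + \<bar>x\<bar>) ^ m) * (echar (\<xi> * t) * nth_deriv n ?p t))"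
      unfolding cross_transform_def integral_mult_right_zero integral_echar_nth_deriv[OF p]
      by (simp add: norm_mult norm_power abs_mult mult_ac nx)
    also have "\<dots> \<le> (LBINT t. (C0 + C2) * (1 / (1 + t\<^sup>2)))"
    proof (rule Bochner_Integration.integral_norm_bound_integral)
      show "integrable lborel (\<lambda>t. of_real ((1 + \<bar>x\<bar>) ^ m) * (echar (\<xi> * t) * nth_deriv n ?p t))"
        by (intro schwartz_integrable schwartz_scale schwartz_modulate schwartz_nth_deriv p)
      show "integrable lborel (\<lambda>t. (C0 + C2) * (1 / (1 + t\<^sup>2)))"
        by (intro integrable_mult_right integrable_inverse_1_plus_square_lborel)
      fix t :: real
      have "1 + t\<^sup>2 > 0" by (simp add: add_pos_nonneg)
      then show "norm (of_real ((1 + \<bar>x\<bar>) ^ m) * (echar (\<xi> * t) * nth_deriv n ?p t)) \<le> (C0 + C2) * (1 / (1 + t\<^sup>2))"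
        using C0(2)[of t x] C2(2)[of t x]
        by (simp add: norm_mult norm_power pos_le_divide_eq algebra_simps nx)
    qed
    also have "\<dots> = (C0 + C2) * (LBINT t. 1 / (1 + t\<^sup>2))"
      by (rule integral_mult_right_zero)
    finally show ?thesis .
  qed
  moreover have "(C0 + C2) * (LBINT t. 1 / (1 + t\<^sup>2)) \<ge> 0"
    using C0(1) C2(1) by (intro mult_nonneg_nonneg integral_nonneg_AE) (auto simp: add_nonneg_nonneg)
  ultimately show ?thesis by (intro exI[of _ "(C0 + C2) * (LBINT t. 1 / (1 + t\<^sup>2))"]) auto
qed

lemma cross_transform_tf_size:
  assumes S: "\<gamma> \<in> schwartz" "\<phi> \<in> schwartz"
  shows "\<exists>C. \<forall>z. norm (cross_transform \<gamma> \<phi> z) * tf_size z ^ m \<le> C"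
proof -
  obtain C0 where C0: "\<And>z. norm (cross_transform \<gamma> \<phi> z) * (1 + \<bar>fst z\<bar>) ^ m * \<bar>snd z\<bar> ^ 0 \<le> C0"
    using cross_transform_decay[OF S] by blast
  obtain C1 where C1: "\<And>z. norm (cross_transform \<gamma> \<phi> z) * (1 + \<bar>fst z\<bar>) ^ m * \<bar>snd z\<bar> ^ m \<le> C1"
    using cross_transform_decay[OF S] by blast
  have "norm (cross_transform \<gamma> \<phi> z) * tf_size z ^ m \<le> 2 ^ m * (C0 + C1)" for z
  proof -
    have "tf_size z ^ m \<le> ((1 + \<bar>fst z\<bar>) * (2 * max 1 \<bar>snd z\<bar>)) ^ m"
    proof (rule power_mono)
      have "tf_size z \<le> (1 + \<bar>fst z\<bar>) * (1 + \<bar>snd z\<bar>)"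
        by (simp add: tf_size_def algebra_simps)
      also have "\<dots> \<le> (1 + \<bar>fst z\<bar>) * (2 * max 1 \<bar>snd z\<bar>)"
        by (intro mult_left_mono) auto
      finally show "tf_size z \<le> (1 + \<bar>fst z\<bar>) * (2 * max 1 \<bar>snd z\<bar>)" .
    qed simp
    also have "\<dots> \<le> (1 + \<bar>fst z\<bar>) ^ m * (2 ^ m * (1 + \<bar>snd z\<bar> ^ m))"
      unfolding power_mult_distrib by (intro mult_left_mono) (auto simp: max_def)
    finally have "norm (cross_transform \<gamma> \<phi> z) * tf_size z ^ m \<le>
        norm (cross_transform \<gamma> \<phi> z) * ((1 + \<bar>fst z\<bar>) ^ m * (2 ^ m * (1 + \<bar>snd z\<bar> ^ m)))"
      by (rule mult_left_mono) simp
    also have "\<dots> = 2 ^ m * (norm (cross_transform \<gamma> \<phi> z) * (1 + \<bar>fst z\<bar>) ^ m * \<bar>snd z\<bar> ^ 0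
        + norm (cross_transform \<gamma> \<phi> z) * (1 + \<bar>fst z\<bar>) ^ m * \<bar>snd z\<bar> ^ m)"
      by (simp add: algebra_simps)
    also have "\<dots> \<le> 2 ^ m * (C0 + C1)"
      by (intro mult_left_mono add_mono C0 C1) auto
    finally show ?thesis .
  qed
  then show ?thesis by blast
qed

lemma integrable_cross_transform_size:
  assumes S: "\<gamma> \<in> schwartz" "\<phi> \<in> schwartz"
  shows "integrable lborel (\<lambda>z. norm (cross_transform \<gamma> \<phi> z) * tf_size z ^ m)"
  by (intro integrable_tf_size_decay measurable_cross_transform cross_transform_tf_size S)

text \<open>For fixed x this is Fourier inversion of \<open>\<gamma> (t - x) * \<phi> t\<close>;
  frequency decay with exponents 0 and 2 makes the transform integrable.\<close>

lemma cross_transform_inversion: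
  assumes S: "\<gamma> \<in> schwartz" "\<phi> \<in> schwartz"
  shows "(LBINT \<xi>. echar (- \<xi> * s) * cross_transform \<gamma> \<phi> (x, \<xi>)) = \<gamma> (s - x) * \<phi> s"
proof -
  let ?p = "\<lambda>t. \<gamma> (t - x) * \<phi> t"
  have p: "?p \<in> schwartz" by (intro schwartz_mult schwartz_translate S)
  obtain B where B: "\<And>t. \<bar>t\<bar> ^ 0 * norm (?p t) \<le> B"
    using schwartz_bounded[OF p] by blast
  have "integrable lborel (\<lambda>\<xi>. LBINT t. echar (1 * \<xi> * t) * ?p t)"
  proof -
    obtain C0 where C0: "\<And>z. norm (cross_transform \<gamma> \<phi> z) * (1 + \<bar>fst z\<bar>) ^ 0 * \<bar>snd z\<bar> ^ 0 \<le> C0"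
      using cross_transform_decay[OF S] by blast
    obtain C2 where C2: "\<And>z. norm (cross_transform \<gamma> \<phi> z) * (1 + \<bar>fst z\<bar>) ^ 0 * \<bar>snd z\<bar> ^ 2 \<le> C2"
      using cross_transform_decay[OF S] by blast
    have [measurable]: "cross_transform \<gamma> \<phi> \<in> borel_measurable borel"
      by (rule measurable_cross_transform[OF S])
    have "integrable lborel (\<lambda>\<xi>. cross_transform \<gamma> \<phi> (x, \<xi>))"
    proof (rule Bochner_Integration.integrable_bound)
      show "integrable lborel (\<lambda>\<xi>::real. (C0 + C2) * (1 / (1 + \<xi>\<^sup>2)))"
        by (intro integrable_mult_right integrable_inverse_1_plus_square_lborel)
      have "(\<lambda>\<xi>::real. (x, \<xi>)) \<in> borel \<rightarrow>\<^sub>M borel"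
        by (intro borel_measurable_continuous_onI continuous_intros)
      then show "(\<lambda>\<xi>. cross_transform \<gamma> \<phi> (x, \<xi>)) \<in> borel_measurable lborel"
        using measurable_compose[OF _ measurable_cross_transform[OF S]] by simp
      show "AE \<xi> in lborel. norm (cross_transform \<gamma> \<phi> (x, \<xi>)) \<le> norm ((C0 + C2) * (1 / (1 + \<xi>\<^sup>2)))"
      proof (rule AE_I2)
        fix \<xi> :: real
        have "1 + \<xi>\<^sup>2 > 0" by (simp add: add_pos_nonneg)
        then have "norm (cross_transform \<gamma> \<phi> (x, \<xi>)) \<le> (C0 + C2) * (1 / (1 + \<xi>\<^sup>2))"
          using C0[of "(x, \<xi>)"] C2[of "(x, \<xi>)"] by (simp add: pos_le_divide_eq algebra_simps)
        then show "norm (cross_transform \<gamma> \<phi> (x, \<xi>)) \<le> norm ((C0 + C2) * (1 / (1 + \<xi>\<^sup>2)))"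
          by (rule order_trans) (simp only: real_norm_def abs_ge_self)
      qed
    qed
    then show ?thesis by (simp add: cross_transform_def)
  qed
  from fourier_inversion[OF schwartz_continuous[OF p] _ schwartz_integrable[OF p] _ this, of B s] B
  show ?thesis by (simp add: cross_transform_def)
qed

text \<open>Pointwise, the frequency integral recovers \<open>\<gamma> (s - x) * \<phi> s\<close>,
  and the remaining position integral of \<gamma> times G does not depend on s. Moving f under the
  integral then reproduces \<open>f \<phi>\<close>, so a suitable \<gamma> shows that f is
  determined by its transform.\<close>

lemma tempered_reproducing:
  assumes G: "G \<in> schwartz" and S: "\<gamma> \<in> schwartz" "\<phi> \<in> schwartz" and f: "f \<in> tempered"
  shows "(LBINT z. cross_transform \<gamma> \<phi> z * f (tf_atom G z)) = (LBINT t. \<gamma> t * G t) * f \<phi>"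
proof -
  note c = measurable_cross_transform[OF S]
  note int = integrable_cross_transform_size[OF S]
  have "(LBINT z. cross_transform \<gamma> \<phi> z * tf_atom G z s) = (LBINT t. \<gamma> t * G t) * \<phi> s" for s
  proof -
    have I: "integrable (lborel \<Otimes>\<^sub>M lborel) (\<lambda>z. cross_transform \<gamma> \<phi> z * tf_atom G z s)"
      unfolding lborel_prod by (rule schwartz_family_integrable[OF schwartz_family_atoms[OF G c int]])
    have "(LBINT z. cross_transform \<gamma> \<phi> z * tf_atom G z s) =
        (LBINT x. LBINT \<xi>. cross_transform \<gamma> \<phi> (x, \<xi>) * tf_atom G (x, \<xi>) s)"
      unfolding lborel_pair.integral_fst'[OF I] lborel_prod ..
    also have "\<dots> = (LBINT x. G (s - x) * (LBINT \<xi>. echar (- \<xi> * s) * cross_transform \<gamma> \<phi> (x, \<xi>)))"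
      by (simp add: tf_atom_def mult_ac flip: integral_mult_right_zero)
    also have "\<dots> = (LBINT x. \<gamma> (s - x) * G (s - x) * \<phi> s)"
      unfolding cross_transform_inversion[OF S] by (simp add: mult_ac)
    also have "\<dots> = (LBINT x. \<gamma> (s - x) * G (s - x)) * \<phi> s"
      by simp
    also have "(LBINT x. \<gamma> (s - x) * G (s - x)) = (LBINT t. \<gamma> t * G t)"
      using lborel_integral_real_affine[of "-1" "\<lambda>t. \<gamma> t * G t" s] by simp
    finally show ?thesis .
  qed
  then have "f (\<lambda>s. LBINT z. cross_transform \<gamma> \<phi> z * tf_atom G z s) = (LBINT t. \<gamma> t * G t) * f \<phi>"
    by (simp add: tempered_scale[OF f S(2)])
  then show ?thesis
    using tempered_integral_atoms(2)[OF G f c int] by simp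
qed

section \<open>Distributions with integrable transform are functions\<close>

text \<open>The pairing is the squared L2 norm. If it vanished, the set where G is nonzero would be
  an open null set and hence empty.\<close>

lemma schwartz_self_pairing_nonzero:
  assumes G: "G \<in> schwartz" and "G \<noteq> 0"
  shows "(LBINT t. cnj (G t) * G t) \<noteq> 0"
proof
  assume "(LBINT t. cnj (G t) * G t) = 0"
  moreover have eq: "(\<lambda>t. cnj (G t) * G t) = (\<lambda>t. of_real ((norm (G t))\<^sup>2))"
    by (auto simp: complex_norm_square mult.commute simp flip: of_real_power)
  ultimately have "complex_of_real (LBINT t. (norm (G t))\<^sup>2) = 0"
    unfolding integral_complex_of_real[symmetric] by (simp only:)
  then have "(LBINT t. (norm (G t))\<^sup>2) = 0" by (simp only: of_real_eq_0_iff)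
  moreover have "integrable lborel (\<lambda>t. (norm (G t))\<^sup>2)"
    using schwartz_integrable[OF schwartz_mult[OF schwartz_cnj[OF G] G]]
    unfolding eq by (simp only: complex_of_real_integrable_eq)
  ultimately have "AE t in lborel. (norm (G t))\<^sup>2 = 0"
    by (subst (asm) integral_nonneg_eq_0_iff_AE) auto
  then have ae: "AE t in lborel. G t = 0" by simp
  have "open {t. G t \<noteq> 0}"
    using schwartz_continuous[OF G, of UNIV] by (intro open_Collect_neq) auto
  moreover have "{t. G t \<noteq> 0} \<in> null_sets lborel"
    using ae \<open>open _\<close> by (subst (asm) AE_iff_null) auto
  then have "negligible {t. G t \<noteq> 0}"
    by (simp add: negligible_iff_null_sets null_sets_completionI)
  ultimately have "{t. G t \<noteq> 0} = {}"
    using open_not_negligible by blast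
  with \<open>G \<noteq> 0\<close> show False by (auto simp: fun_eq_iff)
qed

text \<open>F is the inversion integral of the transform with dual window the conjugate of G. The L1
  norm of the transform bounds F, dominated convergence gives continuity, and Fubini turns the
  reproducing formula into the integral representation.\<close>

lemma tempered_is_function:
  assumes G: "G \<in> schwartz" and "G \<noteq> 0" and f: "f \<in> tempered"
    and V: "integrable lborel (stft G f)"
  obtains F B where "continuous_on UNIV F" "\<And>t. norm (F t) \<le> B"
    "\<And>\<phi>. \<phi> \<in> schwartz \<Longrightarrow> f \<phi> = (LBINT t. F t * \<phi> t)"
proof -
  define \<gamma> where "\<gamma> = (\<lambda>t. cnj (G t))"
  have \<gamma>: "\<gamma> \<in> schwartz" unfolding \<gamma>_def by (rule schwartz_cnj[OF G])
  define \<kappa> where "\<kappa> = (LBINT t. \<gamma> t * G t)"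
  have \<kappa>: "\<kappa> \<noteq> 0" unfolding \<kappa>_def \<gamma>_def by (rule schwartz_self_pairing_nonzero) fact+
  obtain b where b: "b \<ge> 0" "\<And>t. \<bar>t\<bar> ^ 0 * norm (\<gamma> t) \<le> b"
    using schwartz_bounded[OF \<gamma>] by blast
  let ?V = "stft G f"
  define h where "h = (\<lambda>z t. ?V z * (echar (snd z * t) * \<gamma> (t - fst z)))"
  define F where "F t = inverse \<kappa> * (LBINT z. h z t)" for t
  note [measurable] = schwartz_measurable[OF \<gamma>]
  have Vm: "?V \<in> borel_measurable (borel \<Otimes>\<^sub>M borel)"
    unfolding borel_prod by (rule borel_measurable_continuous_onI[OF continuous_on_tempered_atom[OF G f]])
  have hm: "case_prod h \<in> borel_measurable ((borel \<Otimes>\<^sub>M borel) \<Otimes>\<^sub>M borel)"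
    unfolding h_def using Vm by measurable
  have hmt: "(\<lambda>z. h z t) \<in> borel_measurable (borel \<Otimes>\<^sub>M borel)" for t
    unfolding h_def using Vm by measurable
  have hb: "norm (h z t) \<le> norm (?V z) * b" for z t
    using b(2)[of "t - fst z"] by (simp add: h_def norm_mult mult_left_mono)
  have Vb: "integrable lborel (\<lambda>z. norm (?V z) * b)"
    using V by (intro integrable_mult_left integrable_norm)
  have hint: "integrable lborel (\<lambda>z. h z t)" for t
    by (rule Bochner_Integration.integrable_bound[OF Vb])
      (use hmt[of t] hb in \<open>auto simp: borel_prod intro!: AE_I2 order_trans[OF hb abs_ge_self]\<close>)
  show ?thesis
  proof (rule that)
    show "norm (F t) \<le> norm (inverse \<kappa>) * (LBINT z. norm (?V z) * b)" for t
      unfolding F_def norm_mult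
      by (intro mult_left_mono Bochner_Integration.integral_norm_bound_integral hint Vb hb) auto
    show "continuous_on UNIV F"
    proof (intro continuous_at_imp_continuous_on ballI continuous_at_sequentiallyI)
      fix t u assume u: "u \<longlonglongrightarrow> (t::real)"
      have "(\<lambda>n. LBINT z. h z (u n)) \<longlonglongrightarrow> (LBINT z. h z t)"
      proof (rule integral_dominated_convergence[where w = "\<lambda>z. norm (?V z) * b"])
        show "(\<lambda>z. h z t) \<in> borel_measurable lborel" "(\<lambda>z. h z (u n)) \<in> borel_measurable lborel" for n
          using hint by auto
        have "isCont \<gamma> s" "isCont echar s" for s
          using schwartz_continuous[OF \<gamma>, of UNIV] continuous_on_echar[of UNIV "\<lambda>x. x"]
          by (auto simp: continuous_on_eq_continuous_at)
        then show "AE z in lborel. (\<lambda>n. h z (u n)) \<longlonglongrightarrow> h z t"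
          unfolding h_def
          by (intro AE_I2 tendsto_intros isCont_tendsto_compose[of _ \<gamma>] isCont_tendsto_compose[of _ echar] u)
        show "AE z in lborel. norm (h z (u n)) \<le> norm (?V z) * b" for n
          by (intro AE_I2 hb)
      qed (rule Vb)
      then show "(\<lambda>n. F (u n)) \<longlonglongrightarrow> F t"
        unfolding F_def by (intro tendsto_intros)
    qed
    fix \<phi> assume \<phi>: "\<phi> \<in> schwartz"
    have "\<kappa> * f \<phi> = (LBINT z. cross_transform \<gamma> \<phi> z * ?V z)"
      unfolding \<kappa>_def by (rule tempered_reproducing[OF G \<gamma> \<phi> f, symmetric])
    also have "\<dots> = (LBINT z. LBINT t. h z t * \<phi> t)"
      by (simp add: cross_transform_def h_def mult_ac flip: integral_mult_right_zero)
    also have "\<dots> = (LBINT t. LBINT z. h z t * \<phi> t)"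
    proof (rule Fubini_product_bound)
      have [measurable]: "\<phi> \<in> borel_measurable borel" by (rule schwartz_measurable[OF \<phi>])
      show "(\<lambda>(z, t). h z t * \<phi> t) \<in> borel_measurable (lborel \<Otimes>\<^sub>M lborel)"
      proof -
        have [measurable]: "case_prod h \<in> borel_measurable borel"
          using hm by (simp add: borel_prod)
        have [measurable]: "(\<lambda>p. \<phi> (snd p)) \<in> borel_measurable (borel :: ((real \<times> real) \<times> real) measure)"
          by (intro borel_measurable_continuous_onI continuous_on_compose2[OF schwartz_continuous[OF \<phi>, of UNIV]]
              continuous_intros) auto
        have "(\<lambda>p. case_prod h p * \<phi> (snd p)) \<in> borel_measurable borel"
          by measurable
        then show ?thesis by (simp add: lborel_prod split_beta')
      qed
      show "integrable lborel (\<lambda>t. norm (\<phi> t))" using schwartz_integrable[OF \<phi>] by simp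
      show "norm (h z t * \<phi> t) \<le> norm (?V z) * b * norm (\<phi> t)" for z t
        unfolding norm_mult by (intro mult_right_mono hb) auto
    qed (rule Vb)
    also have "\<dots> = \<kappa> * (LBINT t. F t * \<phi> t)"
      using \<kappa> by (simp add: F_def field_simps flip: integral_mult_right_zero)
    finally show "f \<phi> = (LBINT t. F t * \<phi> t)" using \<kappa> by simp
  qed
qed

section \<open>Time-frequency shifts of distributions\<close>


text \<open>This is the transpose formulation of the shift sending a function H to
  \<open>echar (\<xi> * t) * H (t - x)\<close>, with z = (x, \<xi>).\<close>

definition dist_shift :: "real \<times> real \<Rightarrow> distribution \<Rightarrow> distribution"
  where "dist_shift z h = (\<lambda>\<phi>. h (\<lambda>t. echar (snd z * (t + fst z)) * \<phi> (t + fst z)))"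

lemma schwartz_dist_shift:
  assumes "\<phi> \<in> schwartz"
  shows "(\<lambda>t. echar (snd z * (t + fst z)) * \<phi> (t + fst z)) \<in> schwartz"
  using schwartz_translate[OF schwartz_modulate[OF assms, of "snd z"], of "- fst z"] by simp

text \<open>Covariance: shifting h translates its transform and multiplies it by a phase. The phase
  disappears from norms but has to be tracked wherever two shifts of h are subtracted.\<close>

lemma dist_shift_atom:
  assumes G: "G \<in> schwartz" and h: "h \<in> tempered"
  shows "dist_shift w h (tf_atom G z) =
    echar (- (snd z - snd w) * fst w) * h (tf_atom G (z - w))"
proof -
  have "(\<lambda>t. echar (snd w * (t + fst w)) * tf_atom G z (t + fst w)) =
      (\<lambda>t. echar (- (snd z - snd w) * fst w) * tf_atom G (z - w) t)"
  proof
    fix t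
    have "echar (snd w * (t + fst w)) * echar (- snd z * (t + fst w)) =
        echar (- (snd z - snd w) * fst w) * echar (- snd (z - w) * t)"
      unfolding echar_add[symmetric] by (simp add: algebra_simps)
    then have "(echar (snd w * (t + fst w)) * echar (- snd z * (t + fst w))) * G (t - fst (z - w)) =
        (echar (- (snd z - snd w) * fst w) * echar (- snd (z - w) * t)) * G (t - fst (z - w))"
      by (simp only:)
    moreover have "t + fst w - fst z = t - fst (z - w)" by simp
    ultimately show "echar (snd w * (t + fst w)) * tf_atom G z (t + fst w) =
        echar (- (snd z - snd w) * fst w) * tf_atom G (z - w) t"
      unfolding tf_atom_def by (simp only: mult.assoc)
  qed
  then show ?thesis
    by (simp add: dist_shift_def tempered_scale[OF h schwartz_tf_atom[OF G]])
qed

lemma dist_shift_function: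
  assumes \<phi>: "\<phi> \<in> schwartz"
    and H: "\<And>\<psi>. \<psi> \<in> schwartz \<Longrightarrow> h \<psi> = (LBINT t. H t * \<psi> t)"
  shows "dist_shift z h \<phi> = (LBINT t. H (t - fst z) * (echar (snd z * t) * \<phi> t))"
  unfolding dist_shift_def H[OF schwartz_dist_shift[OF \<phi>]]
  using lborel_integral_real_affine[of 1 "\<lambda>t. H (t - fst z) * (echar (snd z * t) * \<phi> t)" "fst z"]
  by (simp add: algebra_simps)

section \<open>The orthogonality relation with a rough synthesis window\<close>

text \<open>For fixed x the transform of f is the Fourier transform of
  \<open>F t * G (t - x)\<close>. Inverting it in \<xi> leaves the double integral of
  \<open>H (t - x) * G (t - x) * F t * \<phi> t\<close>, and its integral over x is
  \<open>h G\<close> for every t.\<close>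

lemma tempered_orthogonality:
  assumes G: "G \<in> schwartz" and \<phi>: "\<phi> \<in> schwartz" and f: "f \<in> tempered"
    and F: "continuous_on UNIV F" "\<And>t. norm (F t) \<le> B"
      "\<And>\<psi>. \<psi> \<in> schwartz \<Longrightarrow> f \<psi> = (LBINT t. F t * \<psi> t)"
    and H: "continuous_on UNIV H" "\<And>t. norm (H t) \<le> B'"
      "\<And>\<psi>. \<psi> \<in> schwartz \<Longrightarrow> h \<psi> = (LBINT t. H t * \<psi> t)"
    and V: "integrable lborel (stft G f)"
  shows "integrable lborel (\<lambda>z. f (tf_atom G z) * dist_shift z h \<phi>)"
    and "(LBINT z. f (tf_atom G z) * dist_shift z h \<phi>) = h G * f \<phi>"
proof -
  note [measurable] = schwartz_measurable[OF G] schwartz_measurable[OF \<phi>]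
    borel_measurable_continuous_onI[OF F(1)] borel_measurable_continuous_onI[OF H(1)]
  have B: "B \<ge> 0" "B' \<ge> 0"
    using norm_ge_zero[of "F 0"] F(2)[of 0] norm_ge_zero[of "H 0"] H(2)[of 0] by linarith+
  let ?V = "stft G f"
  have S: "dist_shift z h \<phi> = (LBINT t. H (t - fst z) * (echar (snd z * t) * \<phi> t))" for z
    by (rule dist_shift_function[OF \<phi> H(3)])
  have \<phi>int: "integrable lborel (\<lambda>t. norm (\<phi> t))" using schwartz_integrable[OF \<phi>] by simp
  have Hb: "norm (H (t - x) * (echar (\<xi> * t) * \<phi> t)) \<le> B' * norm (\<phi> t)" for t x \<xi>
    by (simp add: norm_mult mult_right_mono H)
  have Hint: "integrable lborel (\<lambda>t. H (t - x) * (echar (\<xi> * t) * \<phi> t))" for x \<xi>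
    by (rule Bochner_Integration.integrable_bound[OF integrable_mult_right[OF \<phi>int, of B']])
      (use Hb B in \<open>auto intro!: AE_I2 order_trans[OF Hb]\<close>)
  have Sm: "(\<lambda>z. dist_shift z h \<phi>) \<in> borel_measurable lborel"
  proof -
    have "(\<lambda>z. LBINT t. H (t - fst z) * (echar (snd z * t) * \<phi> t)) \<in> borel_measurable (borel \<Otimes>\<^sub>M borel)"
      by measurable
    then show ?thesis by (simp add: S borel_prod)
  qed
  have Sb: "norm (dist_shift z h \<phi>) \<le> B' * (LBINT t. norm (\<phi> t))" for z
  proof -
    have "norm (dist_shift z h \<phi>) \<le> (LBINT t. B' * norm (\<phi> t))"
      unfolding S by (intro Bochner_Integration.integral_norm_bound_integral Hint integrable_mult_right \<phi>int Hb)
    then show ?thesis by simp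
  qed
  show I: "integrable lborel (\<lambda>z. ?V z * dist_shift z h \<phi>)"
  proof (rule Bochner_Integration.integrable_bound[OF integrable_mult_left[OF integrable_norm[OF V], of "B' * (LBINT t. norm (\<phi> t))"]])
    show "(\<lambda>z. ?V z * dist_shift z h \<phi>) \<in> borel_measurable lborel"
      using borel_measurable_integrable[OF V] Sm by measurable
    have "norm (?V z * dist_shift z h \<phi>) \<le> norm (?V z) * (B' * (LBINT t. norm (\<phi> t)))" for z
      unfolding norm_mult by (intro mult_left_mono Sb) auto
    then show "AE z in lborel. norm (?V z * dist_shift z h \<phi>) \<le> norm (norm (?V z) * (B' * (LBINT t. norm (\<phi> t))))"
      using order_trans[OF _ abs_ge_self] by (intro AE_I2) auto
  qed
  \<comment> \<open>Integrability of the transform on the plane gives this premise for almost every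
    x only, which is enough under the outer integral.\<close>
  have inner: "(LBINT \<xi>. ?V (x, \<xi>) * dist_shift (x, \<xi>) h \<phi>) = (LBINT t. H (t - x) * (\<phi> t * (F t * G (t - x))))"
    if Vx: "integrable lborel (\<lambda>\<xi>. ?V (x, \<xi>))" for x
  proof -
    let ?a = "\<lambda>t. F t * G (t - x)"
    obtain b where b: "b \<ge> 0" "\<And>t. \<bar>t\<bar> ^ 0 * norm (G t) \<le> b"
      using schwartz_bounded[OF G] by blast
    have Veq: "?V (x, \<xi>) = (LBINT s. echar (- 1 * \<xi> * s) * ?a s)" for \<xi>
      unfolding F(3)[OF schwartz_tf_atom[OF G]] by (simp add: tf_atom_def mult_ac)
    have Vm: "(\<lambda>\<xi>. ?V (x, \<xi>)) \<in> borel_measurable borel"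
      using borel_measurable_integrable[OF Vx] by simp
    have inv: "(LBINT \<xi>. echar (\<xi> * t) * ?V (x, \<xi>)) = ?a t" for t
    proof -
      have "(LBINT \<xi>. echar (- (- 1) * \<xi> * t) * (LBINT s. echar (- 1 * \<xi> * s) * ?a s)) = ?a t"
      proof (rule fourier_inversion)
        show "continuous_on UNIV ?a"
          by (intro continuous_intros F(1) continuous_on_compose2[OF schwartz_continuous[OF G, of UNIV]]) auto
        show "norm (?a t) \<le> B * b" for t
          unfolding norm_mult using F(2)[of t] b(2)[of "t - x"] B by (intro mult_mono) auto
        show "integrable lborel ?a"
        proof (rule Bochner_Integration.integrable_bound)
          show "integrable lborel (\<lambda>t. B * norm (G (t - x)))"
            by (intro integrable_mult_right integrable_norm schwartz_integrable schwartz_translate G)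
          show "AE t in lborel. norm (?a t) \<le> norm (B * norm (G (t - x)))"
            using B by (intro AE_I2) (simp add: norm_mult mult_right_mono F)
        qed measurable
        show "integrable lborel (\<lambda>\<xi>. LBINT s. echar (- 1 * \<xi> * s) * ?a s)"
          using Vx unfolding Veq .
      qed simp
      then show ?thesis unfolding Veq by simp
    qed
    have "(LBINT \<xi>. ?V (x, \<xi>) * dist_shift (x, \<xi>) h \<phi>) =
        (LBINT \<xi>. LBINT t. ?V (x, \<xi>) * (H (t - x) * (echar (\<xi> * t) * \<phi> t)))"
      unfolding S by simp
    also have "\<dots> = (LBINT t. LBINT \<xi>. ?V (x, \<xi>) * (H (t - x) * (echar (\<xi> * t) * \<phi> t)))"
    proof (rule Fubini_product_bound)
      show "(\<lambda>(\<xi>, t). ?V (x, \<xi>) * (H (t - x) * (echar (\<xi> * t) * \<phi> t))) \<in> borel_measurable (lborel \<Otimes>\<^sub>M lborel)"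
        using Vm by measurable
      show "integrable lborel (\<lambda>\<xi>. norm (?V (x, \<xi>)))" using Vx by simp
      show "integrable lborel (\<lambda>t. B' * norm (\<phi> t))" using \<phi>int by simp
      show "norm (?V (x, \<xi>) * (H (t - x) * (echar (\<xi> * t) * \<phi> t))) \<le> norm (?V (x, \<xi>)) * (B' * norm (\<phi> t))" for \<xi> t
        unfolding norm_mult[of "?V (x, \<xi>)"] by (intro mult_left_mono Hb) auto
    qed
    also have "\<dots> = (LBINT t. H (t - x) * \<phi> t * (LBINT \<xi>. echar (\<xi> * t) * ?V (x, \<xi>)))"
      by (simp add: mult_ac flip: integral_mult_right_zero)
    finally show ?thesis unfolding inv by (simp add: mult_ac)
  qed
  have "(LBINT z. ?V z * dist_shift z h \<phi>) = (LBINT x. LBINT \<xi>. ?V (x, \<xi>) * dist_shift (x, \<xi>) h \<phi>)"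
    using I unfolding lborel_prod[symmetric] by (rule lborel_pair.integral_fst'[symmetric])
  also have "\<dots> = (LBINT x. LBINT t. H (t - x) * (\<phi> t * (F t * G (t - x))))"
  proof (rule integral_cong_AE)
    have "AE x in lborel. integrable lborel (\<lambda>\<xi>. ?V (x, \<xi>))"
      using V unfolding lborel_prod[symmetric] by (rule lborel_pair.AE_integrable_fst')
    then show "AE x in lborel. (LBINT \<xi>. ?V (x, \<xi>) * dist_shift (x, \<xi>) h \<phi>) =
        (LBINT t. H (t - x) * (\<phi> t * (F t * G (t - x))))"
      by (rule AE_mp) (simp add: inner)
    show "(\<lambda>x. LBINT \<xi>. ?V (x, \<xi>) * dist_shift (x, \<xi>) h \<phi>) \<in> borel_measurable lborel"
      using lborel_pair.integrable_fst'[of "\<lambda>z. ?V z * dist_shift z h \<phi>"] I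
      unfolding lborel_prod by (auto dest: borel_measurable_integrable)
  qed measurable
  also have "\<dots> = (LBINT t. LBINT x. H (t - x) * (\<phi> t * (F t * G (t - x))))"
  proof -
    \<comment> \<open>F and H are merely bounded, so absolute convergence in both variables comes
      from the joint decay of \<open>G (t - x) * \<phi> t\<close> in x and t.\<close>
    obtain C0 where C0: "C0 \<ge> 0"
      "\<And>x t. wderiv 0 0 (\<lambda>t. G (t - x) * \<phi> t) t * (1 + \<bar>x\<bar>) ^ 2 \<le> C0"
      using translate_product_bound[OF G \<phi>] by blast
    obtain C2 where C2: "C2 \<ge> 0"
      "\<And>x t. wderiv 2 0 (\<lambda>t. G (t - x) * \<phi> t) t * (1 + \<bar>x\<bar>) ^ 2 \<le> C2"
      using translate_product_bound[OF G \<phi>] by blast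
    show ?thesis
    proof (rule Fubini_product_bound)
      show "integrable lborel (\<lambda>x::real. B * B' * (C0 + C2) * (1 / (1 + x\<^sup>2)))" "integrable lborel (\<lambda>t::real. 1 / (1 + t\<^sup>2))"
        by (intro integrable_mult_right integrable_inverse_1_plus_square_lborel)+
      fix x t :: real
      have pos: "1 + x\<^sup>2 > 0" "1 + t\<^sup>2 > 0" by (simp_all add: add_pos_nonneg)
      have "norm (G (t - x) * \<phi> t) * ((1 + x\<^sup>2) * (1 + t\<^sup>2)) \<le> norm (G (t - x) * \<phi> t) * ((1 + \<bar>x\<bar>)\<^sup>2 * (1 + t\<^sup>2))"
        by (intro mult_left_mono mult_right_mono) (auto simp: power2_sum)
      also have "\<dots> \<le> C0 + C2"
        using C0(2)[of t x] C2(2)[of t x] by (simp add: algebra_simps)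
      finally have *: "norm (G (t - x) * \<phi> t) \<le> (C0 + C2) * (1 / (1 + x\<^sup>2)) * (1 / (1 + t\<^sup>2))"
        using pos by (simp add: pos_le_divide_eq mult_ac)
      have "norm (H (t - x) * (\<phi> t * (F t * G (t - x)))) = norm (F t) * norm (H (t - x)) * norm (G (t - x) * \<phi> t)"
        by (simp add: norm_mult mult_ac)
      also have "\<dots> \<le> B * B' * ((C0 + C2) * (1 / (1 + x\<^sup>2)) * (1 / (1 + t\<^sup>2)))"
        using B by (intro mult_mono F H * mult_nonneg_nonneg) auto
      finally show "norm (H (t - x) * (\<phi> t * (F t * G (t - x)))) \<le> B * B' * (C0 + C2) * (1 / (1 + x\<^sup>2)) * (1 / (1 + t\<^sup>2))"
        by (simp add: mult_ac)
    qed measurable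
  qed
  also have "\<dots> = (LBINT t. F t * \<phi> t * (LBINT x. H (t - x) * G (t - x)))"
    by (simp add: mult_ac flip: integral_mult_right_zero)
  also have "\<dots> = (LBINT t. F t * \<phi> t * h G)"
  proof -
    have "(LBINT x. H (t - x) * G (t - x)) = h G" for t
      using lborel_integral_real_affine[of "-1" "\<lambda>t. H t * G t" t] by (simp add: H(3)[OF G])
    then show ?thesis by simp
  qed
  also have "\<dots> = h G * f \<phi>"
    by (simp add: F(3)[OF \<phi>] mult.commute)
  finally show "(LBINT z. ?V z * dist_shift z h \<phi>) = h G * f \<phi>" .
qed

section \<open>Weights and discretization\<close>


lemma measurable_fst_borel [measurable]:
    "fst \<in> borel_measurable (borel :: ('a::second_countable_topology \<times> 'b::second_countable_topology) measure)"
  and measurable_snd_borel [measurable]: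
    "snd \<in> borel_measurable (borel :: ('a \<times> 'b) measure)"
  by (intro borel_measurable_continuous_onI continuous_intros)+

lemma nn_integral_lborel_shift:
  fixes f :: "'a::euclidean_space \<Rightarrow> ennreal"
  assumes [measurable]: "f \<in> borel_measurable borel"
  shows "(\<integral>\<^sup>+z. f (z - w) \<partial>lborel) = (\<integral>\<^sup>+z. f z \<partial>lborel)"
proof -
  have "(\<integral>\<^sup>+z. f z \<partial>lborel) = (\<integral>\<^sup>+z. f z \<partial>distr lborel borel ((+) (- w)))"
    by (simp add: lborel_distr_plus)
  also have "\<dots> = (\<integral>\<^sup>+z. f (z - w) \<partial>lborel)"
    by (subst nn_integral_distr) simp_all
  finally show ?thesis ..
qed

lemma compact_tf_box: "compact (tf_box R)"
proof -
  have "tf_box R = {- R..R} \<times> {- R..R}"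
    by (auto simp: tf_box_def)
  then show ?thesis by (simp add: compact_Times)
qed

text \<open>The boxes exhaust the plane, so the truncated integrands tend to 0 pointwise and f
  itself is the majorant.\<close>

lemma tf_box_tail:
  fixes f :: "real \<times> real \<Rightarrow> ennreal"
  assumes [measurable]: "f \<in> borel_measurable borel" and fin: "(\<integral>\<^sup>+z. f z \<partial>lborel) < \<infinity>" and "e > 0"
  obtains R where "R \<ge> 0" "(\<integral>\<^sup>+z. f z * indicator (- tf_box R) z \<partial>lborel) \<le> ennreal e"
proof -
  have "(\<lambda>n. \<integral>\<^sup>+z. f z * indicator (- tf_box (real n)) z \<partial>lborel) \<longlonglongrightarrow> (\<integral>\<^sup>+(z :: real \<times> real). 0 \<partial>lborel)"
  proof (rule nn_integral_dominated_convergence[where w = f])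
    show "AE z in lborel. (\<lambda>n. f z * indicator (- tf_box (real n)) z) \<longlonglongrightarrow> 0"
    proof (rule AE_I2)
      fix z
      obtain m where m: "\<bar>fst z\<bar> + \<bar>snd z\<bar> \<le> real m" using real_arch_simple by blast
      have "f z * indicator (- tf_box (real n)) z = 0" if "n \<ge> m" for n
      proof -
        have "real m \<le> real n" using that by simp
        then show ?thesis using m by (auto simp: tf_box_def indicator_def)
      qed
      then show "(\<lambda>n. f z * indicator (- tf_box (real n)) z) \<longlonglongrightarrow> 0"
        by (intro tendsto_eventually) (auto simp: eventually_sequentially)
    qed
    show "AE z in lborel. f z * indicator (- tf_box (real n)) z \<le> f z" for n
      by (intro AE_I2) (auto simp: indicator_def)
  qed (use fin in auto)
  then have "\<forall>\<^sub>F n in sequentially. (\<integral>\<^sup>+z. f z * indicator (- tf_box (real n)) z \<partial>lborel) < ennreal e"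
    using \<open>e > 0\<close> by (intro order_tendstoD) auto
  then obtain n where "(\<integral>\<^sup>+z. f z * indicator (- tf_box (real n)) z \<partial>lborel) < ennreal e"
    by (auto simp: eventually_sequentially)
  then show ?thesis using that[of "real n"] by simp
qed

section \<open>Weighted L1 estimates on phase space\<close>

text \<open>The lower bound 1 places weighted L1 inside L1, submultiplicativity makes translations
  bounded, and boundedness on balls makes the weights at nearby points comparable.\<close>

locale tf_weight =
  fixes u :: "real \<times> real \<Rightarrow> real"
  assumes measurable_u [measurable]: "u \<in> borel_measurable borel"
    and u_ge_1: "1 \<le> u z"
    and u_submult: "u (z + z') \<le> u z * u z'"
    and u_bounded: "\<exists>C. \<forall>z. norm z \<le> R \<longrightarrow> u z \<le> C"
begin

lemma u_pos [simp]: "0 < u z" "0 \<le> u z"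
  using u_ge_1[of z] by linarith+

lemma u_bound:
  obtains C where "C > 0" "\<And>z. norm z \<le> R \<Longrightarrow> u z \<le> C"
proof -
  obtain C where C: "\<And>z. norm z \<le> R \<Longrightarrow> u z \<le> C" using u_bounded by blast
  show ?thesis
    by (rule that[of "max C 1"]) (auto intro: order_trans[OF C])
qed

text \<open>The weighted L1 norm takes values in \<open>ennreal\<close>, so that it can be estimated
  before integrability is known.\<close>

definition mass :: "(real \<times> real \<Rightarrow> complex) \<Rightarrow> ennreal"
  where "mass V = (\<integral>\<^sup>+z. ennreal (norm (V z) * u z) \<partial>lborel)"

lemma nn_integral_shift_u:
  assumes [measurable]: "g \<in> borel_measurable borel" and g: "\<And>z. 0 \<le> g z"
  shows "(\<integral>\<^sup>+z. ennreal (g (z - w) * u z) \<partial>lborel) \<le> ennreal (u w) * (\<integral>\<^sup>+z. ennreal (g z * u z) \<partial>lborel)"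
proof -
  have "(\<integral>\<^sup>+z. ennreal (g (z - w) * u z) \<partial>lborel) \<le> (\<integral>\<^sup>+z. ennreal (u w * (g (z - w) * u (z - w))) \<partial>lborel)"
  proof (rule nn_integral_mono)
    fix z
    have "g (z - w) * u z \<le> g (z - w) * (u (z - w) * u w)"
      using u_submult[of "z - w" w] by (intro mult_left_mono g) simp
    then show "ennreal (g (z - w) * u z) \<le> ennreal (u w * (g (z - w) * u (z - w)))"
      by (intro ennreal_leI) (simp add: mult_ac)
  qed
  also have "\<dots> = (\<integral>\<^sup>+z. ennreal (u w * (g z * u z)) \<partial>lborel)"
    by (rule nn_integral_lborel_shift[of "\<lambda>z. ennreal (u w * (g z * u z))"]) measurable
  also have "\<dots> = ennreal (u w) * (\<integral>\<^sup>+z. ennreal (g z * u z) \<partial>lborel)"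
    by (simp add: ennreal_mult g nn_integral_cmult)
  finally show ?thesis .
qed

lemma mass_integrable:
  assumes [measurable]: "V \<in> borel_measurable borel" and "mass V < \<infinity>"
  shows "integrable lborel V" "integrable lborel (\<lambda>z. norm (V z) * u z)"
proof -
  show 1: "integrable lborel (\<lambda>z. norm (V z) * u z)"
    by (rule integrableI_nonneg) (use assms(2) in \<open>auto simp: mass_def\<close>)
  have "norm (V z) \<le> norm (V z) * u z" for z
    using mult_left_mono[OF u_ge_1[of z], of "norm (V z)"] by simp
  then show "integrable lborel V"
    by (intro Bochner_Integration.integrable_bound[OF 1]) (auto intro!: AE_I2)
qed

lemma mass_shift:
  assumes [measurable]: "V \<in> borel_measurable borel"
  shows "mass (\<lambda>z. V (z - w)) \<le> ennreal (u w) * mass V"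
  unfolding mass_def by (rule nn_integral_shift_u) simp_all

text \<open>If V is the transform of a tempered distribution h, then by covariance this is the
  transform of h minus its shift by w.\<close>

definition shift_defect :: "(real \<times> real \<Rightarrow> complex) \<Rightarrow> real \<times> real \<Rightarrow> real \<times> real \<Rightarrow> complex"
  where "shift_defect V w y = V y - echar (- (snd y - snd w) * fst w) * V (y - w)"

text \<open>This is the continuity of translation in weighted L1, in a form twisted by the phase:
  uniform continuity controls a large compact box, and the tails of V and of its translate control
  the complement.\<close>

lemma shift_defect_small:
  assumes cont: "continuous_on UNIV V" and fin: "mass V < \<infinity>" and e: "e > 0"
  obtains \<delta> where "\<delta> > 0" "\<And>w. norm w \<le> \<delta> \<Longrightarrow> mass (shift_defect V w) \<le> ennreal e"
proof -
  have [measurable]: "V \<in> borel_measurable borel" by (rule borel_measurable_continuous_onI[OF cont])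
  obtain C1 where C1: "C1 > 0" "\<And>z. norm z \<le> 1 \<Longrightarrow> u z \<le> C1" using u_bound by blast
  \<comment> \<open>Translation by a vector of norm at most 1 multiplies a weighted tail by at most
    \<open>C1\<close>. The tails of V and of its translate thus take up e / 2 together.\<close>
  define \<eta> where "\<eta> = (e / 2) / (1 + C1)"
  have "1 + C1 \<noteq> 0" using C1(1) by simp
  from iffD1[OF nonzero_eq_divide_eq[OF this] \<eta>_def] have "\<eta> * (1 + C1) = e / 2" .
  then have \<eta>: "\<eta> > 0" "\<eta> + C1 * \<eta> = e / 2"
    using e C1(1) by (simp add: \<eta>_def, simp add: algebra_simps)
  obtain R where R: "R \<ge> 0"
    "(\<integral>\<^sup>+z. ennreal (norm (V z) * u z) * indicator (- tf_box R) z \<partial>lborel) \<le> ennreal \<eta>"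
    using tf_box_tail[of "\<lambda>z. ennreal (norm (V z) * u z)", OF _ _ \<eta>(1)] fin by (auto simp: mass_def)
  \<comment> \<open>The margin 1 ensures that for y outside K and w of norm at most 1 both y and y -
    w lie outside the box of size R.\<close>
  define K where "K = tf_box (R + 1)"
  have Kc: "compact K" unfolding K_def by (rule compact_tf_box)
  have [measurable]: "K \<in> sets borel" unfolding K_def by simp
  obtain M where M: "M > 0" "\<And>z. z \<in> K \<Longrightarrow> u z \<le> M"
  proof -
    obtain r where "\<And>z. z \<in> K \<Longrightarrow> norm z \<le> r" using compact_imp_bounded[OF Kc] by (auto simp: bounded_iff)
    then show ?thesis using u_bound[of r] that by metis
  qed
  define mK where "mK = measure lborel K"
  have mK: "emeasure lborel K = ennreal mK" "mK \<ge> 0"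
    using emeasure_compact_finite[OF Kc] by (auto simp: mK_def emeasure_eq_ennreal_measure)
  \<comment> \<open>The part over K costs at most \<open>\<epsilon> * M * mK\<close>, which must not
    exceed e / 2. The summand 1 keeps the denominator positive when K has measure 0.\<close>
  define \<epsilon> where "\<epsilon> = (e / 2) / (M * (mK + 1))"
  have pos: "M * (mK + 1) > 0" using M(1) mK(2) by simp
  then have "M * (mK + 1) \<noteq> 0" by (metis less_irrefl)
  from iffD1[OF nonzero_eq_divide_eq[OF this] \<epsilon>_def] have eps: "\<epsilon> * (M * (mK + 1)) = e / 2" .
  have \<epsilon>: "\<epsilon> > 0" "\<epsilon> * M * mK \<le> e / 2"
  proof -
    show "\<epsilon> > 0" unfolding \<epsilon>_def using e pos by (intro divide_pos_pos) auto
    then have "\<epsilon> * M * mK \<le> \<epsilon> * (M * (mK + 1))"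
      using M(1) by (simp add: algebra_simps)
    then show "\<epsilon> * M * mK \<le> e / 2" using eps by linarith
  qed
  define \<Phi> where "\<Phi> = (\<lambda>p :: (real \<times> real) \<times> (real \<times> real). shift_defect V (fst p) (snd p))"
  have "continuous_on (cball 0 1 \<times> K) \<Phi>"
    unfolding \<Phi>_def shift_defect_def
    by (intro continuous_intros continuous_on_compose2[OF cont]) auto
  then have "uniformly_continuous_on (cball 0 1 \<times> K) \<Phi>"
    by (rule compact_uniformly_continuous) (simp add: compact_Times Kc)
  then obtain d where d: "d > 0" "\<And>p q. p \<in> cball 0 1 \<times> K \<Longrightarrow> q \<in> cball 0 1 \<times> K \<Longrightarrow> dist p q < d \<Longrightarrow> dist (\<Phi> p) (\<Phi> q) < \<epsilon>"
    unfolding uniformly_continuous_on_def using \<epsilon>(1) by metis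
  show ?thesis
  proof (rule that[of "min 1 (d / 2)"])
    show "0 < min 1 (d / 2)" using d(1) by simp
    fix w :: "real \<times> real" assume w: "norm w \<le> min 1 (d / 2)"
    have small: "norm (shift_defect V w y) \<le> \<epsilon>" if "y \<in> K" for y
    proof -
      \<comment> \<open>\<open>\<Phi> (0, y)\<close> is 0, so this distance is the modulus of the
        defect itself.\<close>
      have "dist (\<Phi> (w, y)) (\<Phi> (0, y)) < \<epsilon>"
        using w that d(1) by (intro d(2)) (auto simp: dist_Pair_Pair)
      then show ?thesis by (simp add: \<Phi>_def shift_defect_def dist_norm)
    qed
    have out: "y - w \<notin> tf_box R" if "y \<notin> K" for y
    proof
      assume "y - w \<in> tf_box R"
      moreover have "\<bar>fst w\<bar> \<le> 1" "\<bar>snd w\<bar> \<le> 1"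
        using norm_fst_le[of "fst w" "snd w"] norm_snd_le[of "snd w" "fst w"] w by auto
      ultimately have "y \<in> K" by (auto simp: K_def tf_box_def)
      then show False using that by simp
    qed
    let ?A = "\<lambda>z. norm (V z) * indicator (- tf_box R) z"
    have "mass (shift_defect V w) \<le> (\<integral>\<^sup>+y. ennreal (\<epsilon> * M) * indicator K y +
        (ennreal (?A y * u y) + ennreal (?A (y - w) * u y)) \<partial>lborel)"
      unfolding mass_def
    proof (rule nn_integral_mono)
      fix y
      show "ennreal (norm (shift_defect V w y) * u y) \<le> ennreal (\<epsilon> * M) * indicator K y +
          (ennreal (?A y * u y) + ennreal (?A (y - w) * u y))"
      proof (cases "y \<in> K")
        case True
        have "norm (shift_defect V w y) * u y \<le> \<epsilon> * M"
          using small[OF True] M(2)[OF True] \<epsilon>(1) by (intro mult_mono) auto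
        then have "ennreal (norm (shift_defect V w y) * u y) \<le> ennreal (\<epsilon> * M)"
          by (rule ennreal_leI)
        then show ?thesis using True by (simp add: add_increasing2)
      next
        case False
        have "y \<notin> tf_box R" using False R(1) by (auto simp: K_def tf_box_def)
        moreover have "norm (shift_defect V w y) * u y \<le> norm (V y) * u y + norm (V (y - w)) * u y"
          using norm_triangle_ineq4[of "V y" "echar (- (snd y - snd w) * fst w) * V (y - w)"]
          by (simp add: shift_defect_def norm_mult flip: distrib_right)
        ultimately show ?thesis
          using False out[OF False] by (simp add: ennreal_leI flip: ennreal_plus)
      qed
    qed
    also have "\<dots> = ennreal (\<epsilon> * M) * emeasure lborel K +
        ((\<integral>\<^sup>+y. ennreal (?A y * u y) \<partial>lborel) + (\<integral>\<^sup>+y. ennreal (?A (y - w) * u y) \<partial>lborel))"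
      by (simp add: nn_integral_add nn_integral_cmult_indicator)
    also have "\<dots> \<le> ennreal (e / 2) + (ennreal \<eta> + ennreal (C1 * \<eta>))"
    proof (intro add_mono)
      show "ennreal (\<epsilon> * M) * emeasure lborel K \<le> ennreal (e / 2)"
        unfolding mK(1) using \<epsilon> M(1) mK(2) by (simp add: ennreal_leI flip: ennreal_mult)
      have eq: "(\<integral>\<^sup>+y. ennreal (?A y * u y) \<partial>lborel) = (\<integral>\<^sup>+z. ennreal (norm (V z) * u z) * indicator (- tf_box R) z \<partial>lborel)"
        by (intro nn_integral_cong) (auto simp: indicator_def)
      then show le: "(\<integral>\<^sup>+y. ennreal (?A y * u y) \<partial>lborel) \<le> ennreal \<eta>" using R(2) by simp
      have "(\<integral>\<^sup>+y. ennreal (?A (y - w) * u y) \<partial>lborel) \<le> ennreal (u w) * (\<integral>\<^sup>+y. ennreal (?A y * u y) \<partial>lborel)"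
        by (rule nn_integral_shift_u) auto
      also have "\<dots> \<le> ennreal C1 * ennreal \<eta>"
        using w by (intro mult_mono le ennreal_leI C1(2)) auto
      finally show "(\<integral>\<^sup>+y. ennreal (?A (y - w) * u y) \<partial>lborel) \<le> ennreal (C1 * \<eta>)"
        using C1(1) \<eta>(1) by (simp add: ennreal_mult)
    qed
    also have "\<dots> = ennreal e"
      using e \<eta> C1(1) by (simp flip: ennreal_plus)
    finally show "mass (shift_defect V w) \<le> ennreal e" .
  qed
qed

text \<open>The inversion formula \<open>h G * f = \<integral> V z * dist_shift z h dz\<close> is discretized by replacing
  \<open>dist_shift z h\<close> with a unimodular multiple of \<open>dist_shift (r z) h\<close>, where \<open>r z\<close> is the grid point of
  \<open>z\<close>. A sum is used because \<open>z \<mapsto> dist_shift z h\<close> need not be strongly measurable in a general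
  invariant Banach space.\<close>

lemma discretize:
  assumes G: "G \<in> schwartz" and h: "h \<in> tempered" and \<kappa>0: "h G \<noteq> 0"
    and hfin: "mass (stft G h) < \<infinity>"
  shows "\<exists>C\<ge>0. \<forall>f\<in>tempered. \<forall>\<tau>>0. mass (stft G f) \<le> ennreal \<tau> \<longrightarrow>
    (\<exists>I a. finite I \<and> (\<Sum>k\<in>I. norm (a k) * u k) \<le> C * \<tau> \<and>
      mass (\<lambda>z. f (tf_atom G z) - (\<Sum>k\<in>I. a k * dist_shift k h (tf_atom G z))) \<le> ennreal (\<tau> / 2))"
proof -
  define \<kappa> where "\<kappa> = norm (h G)"
  have \<kappa>: "\<kappa> > 0" using \<kappa>0 by (simp add: \<kappa>_def)
  have G0: "G \<noteq> 0"
  proof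
    assume "G = 0"
    then have "G = (\<lambda>t. 0)" by (simp add: fun_eq_iff)
    then show False using \<kappa>0 tempered_zero[OF h] by simp
  qed
  let ?h = "stft G h"
  have hcont: "continuous_on UNIV ?h" by (rule continuous_on_tempered_atom[OF G h])
  have hm[measurable]: "?h \<in> borel_measurable borel" by (rule borel_measurable_continuous_onI[OF hcont])
  obtain H B' where H: "continuous_on UNIV H" "\<And>t. norm (H t) \<le> B'"
      "\<And>\<psi>. \<psi> \<in> schwartz \<Longrightarrow> h \<psi> = (LBINT t. H t * \<psi> t)"
    using tempered_is_function[OF G G0 h mass_integrable(1)[OF hm hfin]] by metis
  obtain mh where mh: "mh \<ge> 0" "mass ?h = ennreal mh"
    using hfin by (cases "mass ?h") auto
  \<comment> \<open>The total error allowed is \<open>\<kappa> * \<tau> / 2\<close>: one half goes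
    to the grid, whence \<kappa> / 4, and the other half to the part of the transform of f outside
    the box.\<close>
  obtain \<delta> where \<delta>: "\<delta> > 0" "\<And>w. norm w \<le> \<delta> \<Longrightarrow> mass (shift_defect ?h w) \<le> ennreal (\<kappa> / 4)"
    using shift_defect_small[OF hcont hfin, of "\<kappa> / 4"] \<kappa> by auto
  obtain C1 where C1: "C1 > 0" "\<And>z. norm z \<le> 1 \<Longrightarrow> u z \<le> C1" using u_bound by blast
  \<comment> \<open>A grid of width d moves points by at most 2 d, hence the division by 2.\<close>
  define d where "d = min \<delta> 1 / 2"
  define r where "r = tf_grid d"
  have d: "d > 0" using \<delta>(1) by (simp add: d_def)
  have r: "norm (r z - z) \<le> \<delta>" "norm (r z - z) \<le> 1" for z
    using dist_tf_grid[OF d, of z] by (auto simp: r_def d_def dist_norm)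
  have [measurable]: "r \<in> borel \<rightarrow>\<^sub>M borel" unfolding r_def by measurable
  \<comment> \<open>Shifts compose only up to a phase:
    \<open>dist_shift z (dist_shift (r z - z) h)\<close> is \<open>\<theta> z\<close> times
    \<open>dist_shift (r z) h\<close>. With this correction the grid error is a shifted copy of
    \<open>shift_defect\<close>.\<close>
  define \<theta> where "\<theta> z = echar (- (snd (r z) - snd z) * fst z)" for z
  have [measurable]: "\<theta> \<in> borel_measurable borel" unfolding \<theta>_def[abs_def] by measurable
  have \<theta>1: "norm (\<theta> z) = 1" for z by (simp add: \<theta>_def)
  have main: "\<exists>I a. finite I \<and> (\<Sum>k\<in>I. norm (a k) * u k) \<le> C1 / \<kappa> * \<tau> \<and>
      mass (\<lambda>z. f (tf_atom G z) - (\<Sum>k\<in>I. a k * dist_shift k h (tf_atom G z))) \<le> ennreal (\<tau> / 2)"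
    if f: "f \<in> tempered" and \<tau>: "\<tau> > 0" and mf: "mass (stft G f) \<le> ennreal \<tau>" for f \<tau>
  proof -
    let ?f = "stft G f"
    have fm[measurable]: "?f \<in> borel_measurable borel"
      by (rule borel_measurable_continuous_onI[OF continuous_on_tempered_atom[OF G f]])
    have ffin: "mass ?f < \<infinity>" using mf by (simp add: order_le_less_trans)
    note fint = mass_integrable[OF fm ffin]
    obtain F B where F: "continuous_on UNIV F" "\<And>t. norm (F t) \<le> B"
      "\<And>\<psi>. \<psi> \<in> schwartz \<Longrightarrow> f \<psi> = (LBINT t. F t * \<psi> t)"
      using tempered_is_function[OF G G0 f fint(1)] by metis
    \<comment> \<open>Discarded points cost up to the whole mass \<open>mh\<close> of h each, so the
      tail of the transform of f must have mass at most \<kappa> \<tau> / 4 divided by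
      \<open>mh\<close>; the summand 1 covers \<open>mh = 0\<close>.\<close>
    define \<eta> where "\<eta> = \<kappa> * \<tau> / (4 * (mh + 1))"
    have \<eta>: "\<eta> > 0" "mh * \<eta> \<le> \<kappa> * \<tau> / 4"
      using \<kappa> \<tau> mh(1) by (auto simp: \<eta>_def field_simps)
    obtain R where R: "(\<integral>\<^sup>+z. ennreal (norm (?f z) * u z) * indicator (- tf_box R) z \<partial>lborel) \<le> ennreal \<eta>"
      using tf_box_tail[of "\<lambda>z. ennreal (norm (?f z) * u z)", OF _ _ \<eta>(1)] ffin by (auto simp: mass_def)
    define Q where "Q = tf_box R"
    have Qm[measurable]: "Q \<in> sets borel" unfolding Q_def by simp
    define P where "P k = Q \<inter> {z \<in> space lborel. r z = k}" for k
    have fin: "finite (r ` Q)" unfolding r_def Q_def by (rule finite_tf_grid_box[OF d])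
    have sets: "Q \<in> sets lborel" "\<And>k. {z \<in> space lborel. r z = k} \<in> sets lborel" by measurable
    have Pm[measurable]: "P k \<in> sets borel" for k unfolding P_def using sets by auto
    \<comment> \<open>The phase is kept inside the cell integral because it varies with z, while the
      shift by k does not. The inverse of \<open>h G\<close> removes the factor produced by the
      orthogonality relation.\<close>
    define a where "a k = inverse (h G) * (LBINT z. indicator (P k) z * (?f z * \<theta> z))" for k
    have fs: "integrable lborel (\<lambda>z. ?f z * \<theta> z)"
      by (rule Bochner_Integration.integrable_bound[OF fint(1)]) (auto simp: norm_mult \<theta>1)
    note riemann = finite_range_integral[OF fin sets fs, folded P_def]
    have cost: "(\<Sum>k\<in>r ` Q. norm (a k) * u k) \<le> C1 / \<kappa> * \<tau>"
    proof -
      have "norm (a k) * u k \<le> C1 / \<kappa> * (LBINT z. indicator (P k) z * (norm (?f z) * u z))" for k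
      proof -
        have "norm (a k) * u k = inverse \<kappa> * (norm (LBINT z. indicator (P k) z * (?f z * \<theta> z)) * u k)"
          by (simp add: a_def norm_mult norm_inverse \<kappa>_def)
        also have "norm (LBINT z. indicator (P k) z * (?f z * \<theta> z)) * u k
            = norm (LBINT z. of_real (u k) * (indicator (P k) z * (?f z * \<theta> z)))"
          by (subst integral_mult_right_zero) (simp add: norm_mult)
        also have "\<dots> \<le> (LBINT z. C1 * (indicator (P k) z * (norm (?f z) * u z)))"
        proof (rule Bochner_Integration.integral_norm_bound_integral)
          have ip: "integrable lborel (\<lambda>z. indicator (P k) z *\<^sub>R (?f z * \<theta> z))"
            by (intro integrable_mult_indicator fs) simp
          have eq: "indicator (P k) z *\<^sub>R (?f z * \<theta> z) = indicator (P k) z * (?f z * \<theta> z)" for z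
            by (simp add: indicator_def)
          show "integrable lborel (\<lambda>z. of_real (u k) * (indicator (P k) z * (?f z * \<theta> z)))"
            using ip unfolding eq by (rule integrable_mult_right)
          show "integrable lborel (\<lambda>z. C1 * (indicator (P k) z * (norm (?f z) * u z)))"
            using integrable_mult_indicator[of "P k" lborel "\<lambda>z. norm (?f z) * u z"] fint(2) by simp
          fix z
          show "norm (of_real (u k) * (indicator (P k) z * (?f z * \<theta> z))) \<le> C1 * (indicator (P k) z * (norm (?f z) * u z))"
          proof (cases "z \<in> P k")
            case True
            then have k: "k = r z" by (simp add: P_def)
            \<comment> \<open>The grid point of z is within distance 1, so its weight exceeds that
              of z by at most \<open>C1\<close>. Hence the cost constant
              \<open>C1 / \<kappa>\<close> depends neither on f nor on the box.\<close>
            have "u k \<le> u (r z - z) * u z" using u_submult[of "r z - z" z] k by simp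
            also have "\<dots> \<le> C1 * u z" using C1(2)[OF r(2)] by (intro mult_right_mono) auto
            finally have "u k * norm (?f z) \<le> C1 * u z * norm (?f z)" by (rule mult_right_mono) simp
            then show ?thesis using True by (simp add: norm_mult \<theta>1 mult_ac)
          qed simp
        qed
        finally show ?thesis using \<kappa> by (simp add: divide_inverse mult_ac)
      qed
      then have "(\<Sum>k\<in>r ` Q. norm (a k) * u k) \<le> (\<Sum>k\<in>r ` Q. C1 / \<kappa> * (LBINT z. indicator (P k) z * (norm (?f z) * u z)))"
        by (rule sum_mono)
      also have "\<dots> = C1 / \<kappa> * (LBINT z. indicator Q z * (norm (?f z) * u z))"
        using finite_range_integral[OF fin sets fint(2), folded P_def, of "\<lambda>_. 1"]
        by (simp add: has_bochner_integral_integral_eq sum_distrib_left)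
      also have "\<dots> \<le> C1 / \<kappa> * (LBINT z. norm (?f z) * u z)"
        using C1(1) \<kappa> integrable_mult_indicator[of Q lborel "\<lambda>z. norm (?f z) * u z"] fint(2)
        by (intro mult_left_mono integral_mono) (auto simp: indicator_def)
      also have "\<dots> \<le> C1 / \<kappa> * \<tau>"
      proof -
        have "ennreal (LBINT z. norm (?f z) * u z) = mass ?f"
          unfolding mass_def using fint(2) by (intro nn_integral_eq_integral[symmetric]) auto
        then have "ennreal (LBINT z. norm (?f z) * u z) \<le> ennreal \<tau>" using mf by simp
        then show ?thesis using \<tau> C1(1) \<kappa> by (intro mult_left_mono) (auto simp: ennreal_le_iff)
      qed
      finally show ?thesis .
    qed
    define res where "res z' = ?f z' - (\<Sum>k\<in>r ` Q. a k * dist_shift k h (tf_atom G z'))" for z'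
    \<comment> \<open>With y = z' - z this is the modulus, per unit of the transform of f at z, of
      the error caused at z': a shift defect if z is sampled, the full shifted transform of h if z
      is discarded.\<close>
    define E where "E z y = (if z \<in> Q then norm (shift_defect ?h (r z - z) y) else norm (?h y))" for z y
    have E0: "E z y \<ge> 0" for z y by (simp add: E_def)
    have Em: "(\<lambda>p. E (fst p) (snd p - fst p)) \<in> borel_measurable (borel \<Otimes>\<^sub>M borel)"
      unfolding E_def shift_defect_def by measurable
    \<comment> \<open>Subtracting the Riemann sum from the orthogonality relation tested on the atom
      at z' bounds the remainder by a convolution-type integral. Only after this are the weight and
      the z'-integral applied.\<close>
    have resb: "ennreal (\<kappa> * norm (res z')) \<le> (\<integral>\<^sup>+z. ennreal (norm (?f z) * E z (z' - z)) \<partial>lborel)" for z'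
    proof -
      let ?\<phi> = "tf_atom G z'"
      note S = schwartz_tf_atom[OF G, of z']
      have orth: "integrable lborel (\<lambda>z. ?f z * dist_shift z h ?\<phi>)"
          "(LBINT z. ?f z * dist_shift z h ?\<phi>) = h G * f ?\<phi>"
        by (rule tempered_orthogonality[OF G S f F H fint(1)]; assumption)+
      note rie = riemann[of "\<lambda>k. dist_shift k h ?\<phi>"]
      have "h G * res z' = (LBINT z. ?f z * dist_shift z h ?\<phi>) - (LBINT z. indicator Q z * (?f z * \<theta> z) * dist_shift (r z) h ?\<phi>)"
      proof -
        have "h G * (\<Sum>k\<in>r ` Q. a k * dist_shift k h ?\<phi>) = (\<Sum>k\<in>r ` Q. (LBINT z. indicator (P k) z * (?f z * \<theta> z)) * dist_shift k h ?\<phi>)"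
          unfolding sum_distrib_left a_def using \<kappa>0 by (intro sum.cong) (auto simp: field_simps)
        also have "\<dots> = (LBINT z. indicator Q z * (?f z * \<theta> z) * dist_shift (r z) h ?\<phi>)"
          using rie by (simp add: has_bochner_integral_integral_eq)
        finally show ?thesis
          unfolding res_def orth(2) by (simp add: right_diff_distrib)
      qed
      also have "\<dots> = (LBINT z. ?f z * dist_shift z h ?\<phi> - indicator Q z * (?f z * \<theta> z) * dist_shift (r z) h ?\<phi>)"
        using orth(1) rie by (intro Bochner_Integration.integral_diff[symmetric]) (auto intro: integrable.intros)
      finally have eq: "h G * res z' = \<dots>" .
      have "ennreal (\<kappa> * norm (res z')) = ennreal (norm (h G * res z'))"
        by (simp add: \<kappa>_def norm_mult)
      also have "\<dots> \<le> (\<integral>\<^sup>+z. norm (?f z * dist_shift z h ?\<phi> - indicator Q z * (?f z * \<theta> z) * dist_shift (r z) h ?\<phi>) \<partial>lborel)"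
        unfolding eq using orth(1) rie
        by (intro integral_norm_bound_ennreal Bochner_Integration.integrable_diff) (auto intro: integrable.intros)
      also have "\<dots> = (\<integral>\<^sup>+z. ennreal (norm (?f z) * E z (z' - z)) \<partial>lborel)"
      proof (intro nn_integral_cong arg_cong[where f = ennreal])
        fix z
        have 1: "dist_shift z h ?\<phi> = echar (- (snd z' - snd z) * fst z) * ?h (z' - z)"
          by (rule dist_shift_atom[OF G h])
        have "\<theta> z * echar (- (snd z' - snd (r z)) * fst (r z)) =
            echar (- (snd z' - snd z) * fst z) * echar (- (snd (z' - z) - snd (r z - z)) * fst (r z - z))"
          unfolding \<theta>_def echar_add[symmetric] by (simp add: algebra_simps)
        then have 2: "\<theta> z * dist_shift (r z) h ?\<phi> = echar (- (snd z' - snd z) * fst z) *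
            (echar (- (snd (z' - z) - snd (r z - z)) * fst (r z - z)) * ?h (z' - z - (r z - z)))"
          unfolding dist_shift_atom[OF G h] by (simp add: mult.assoc[symmetric])
        have "?f z * dist_shift z h ?\<phi> - indicator Q z * (?f z * \<theta> z) * dist_shift (r z) h ?\<phi>
          = ?f z * (dist_shift z h ?\<phi> - indicator Q z * (\<theta> z * dist_shift (r z) h ?\<phi>))"
          by (simp add: algebra_simps)
        also have "norm \<dots> = norm (?f z) * E z (z' - z)"
        proof (cases "z \<in> Q")
          case True
          then have "dist_shift z h ?\<phi> - indicator Q z * (\<theta> z * dist_shift (r z) h ?\<phi>) =
            echar (- (snd z' - snd z) * fst z) * shift_defect ?h (r z - z) (z' - z)"
            unfolding 1 2 shift_defect_def by (simp add: right_diff_distrib)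
          then show ?thesis using True by (simp add: norm_mult E_def)
        next
          case False
          then show ?thesis unfolding 1 by (simp add: norm_mult E_def)
        qed
        finally show "norm (?f z * dist_shift z h ?\<phi> - indicator Q z * (?f z * \<theta> z) * dist_shift (r z) h ?\<phi>) = norm (?f z) * E z (z' - z)" .
      qed
      finally show ?thesis .
    qed
    have "ennreal \<kappa> * mass res = (\<integral>\<^sup>+z'. ennreal (\<kappa> * norm (res z')) * ennreal (u z') \<partial>lborel)"
    proof -
      have "res \<in> borel_measurable borel"
        unfolding res_def[abs_def] dist_shift_atom[OF G h] by measurable
      then show ?thesis
        unfolding mass_def using \<kappa>
        by (subst nn_integral_cmult[symmetric]) (auto simp: ennreal_mult mult.assoc)
    qed
    also have "\<dots> \<le> (\<integral>\<^sup>+z'. (\<integral>\<^sup>+z. ennreal (norm (?f z) * E z (z' - z)) \<partial>lborel) * ennreal (u z') \<partial>lborel)"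
      by (intro nn_integral_mono mult_right_mono resb) auto
    also have "\<dots> = (\<integral>\<^sup>+z'. (\<integral>\<^sup>+z. ennreal (norm (?f z)) * ennreal (E z (z' - z) * u z') \<partial>lborel) \<partial>lborel)"
    proof (intro nn_integral_cong)
      fix z'
      have "(\<lambda>z. E z (z' - z)) \<in> borel_measurable borel"
        using measurable_compose[OF _ Em, of "\<lambda>z. (z, z')" borel] by simp
      then show "(\<integral>\<^sup>+z. ennreal (norm (?f z) * E z (z' - z)) \<partial>lborel) * ennreal (u z') =
          (\<integral>\<^sup>+z. ennreal (norm (?f z)) * ennreal (E z (z' - z) * u z') \<partial>lborel)"
        by (subst nn_integral_multc[symmetric]) (auto simp: ennreal_mult E0 mult.assoc)
    qed
    also have "\<dots> = (\<integral>\<^sup>+z. (\<integral>\<^sup>+z'. ennreal (norm (?f z)) * ennreal (E z (z' - z) * u z') \<partial>lborel) \<partial>lborel)"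
      using Em by (intro lborel_pair.Fubini'[where f = "\<lambda>z z'. ennreal (norm (?f z)) * ennreal (E z (z' - z) * u z')"])
        (simp add: split_beta', measurable)
    also have "\<dots> = (\<integral>\<^sup>+z. ennreal (norm (?f z)) * (\<integral>\<^sup>+z'. ennreal (E z (z' - z) * u z') \<partial>lborel) \<partial>lborel)"
    proof (intro nn_integral_cong nn_integral_cmult)
      fix z
      have "(\<lambda>z'. E z (z' - z)) \<in> borel_measurable borel"
        using measurable_compose[OF _ Em, of "\<lambda>z'. (z, z')" borel] by simp
      then show "(\<lambda>z'. ennreal (E z (z' - z) * u z')) \<in> borel_measurable lborel" by simp
    qed
    \<comment> \<open>For fixed z the inner integral is at most \<open>u z\<close> times the mass of
      \<open>E z\<close>. That mass is at most \<kappa> / 4 in the box and equals \<open>mh\<close>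
      outside it.\<close>
    also have "\<dots> \<le> (\<integral>\<^sup>+z. ennreal (\<kappa> / 4) * ennreal (norm (?f z) * u z) +
        ennreal mh * (ennreal (norm (?f z) * u z) * indicator (- tf_box R) z) \<partial>lborel)"
    proof (rule nn_integral_mono)
      fix z
      have "E z \<in> borel_measurable borel"
        unfolding E_def[abs_def] shift_defect_def by measurable
      then have shift: "(\<integral>\<^sup>+z'. ennreal (E z (z' - z) * u z') \<partial>lborel) \<le> ennreal (u z) * (\<integral>\<^sup>+y. ennreal (E z y * u y) \<partial>lborel)"
        by (rule nn_integral_shift_u) (rule E0)
      have "(\<integral>\<^sup>+y. ennreal (E z y * u y) \<partial>lborel) \<le> ennreal (\<kappa> / 4) + ennreal mh * indicator (- tf_box R) z"
      proof (cases "z \<in> Q")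
        case True
        then show ?thesis using \<delta>(2)[OF r(1)[of z]] by (simp add: E_def mass_def Q_def)
      next
        case False
        then show ?thesis using mh(2) by (simp add: E_def mass_def Q_def)
      qed
      note order_trans[OF shift mult_left_mono[OF this]]
      then have "ennreal (norm (?f z)) * (\<integral>\<^sup>+z'. ennreal (E z (z' - z) * u z') \<partial>lborel) \<le>
          ennreal (norm (?f z)) * (ennreal (u z) * (ennreal (\<kappa> / 4) + ennreal mh * indicator (- tf_box R) z))"
        by (intro mult_left_mono) auto
      also have "\<dots> = ennreal (\<kappa> / 4) * ennreal (norm (?f z) * u z) +
        ennreal mh * (ennreal (norm (?f z) * u z) * indicator (- tf_box R) z)"
        by (simp add: ennreal_mult distrib_left mult_ac)
      finally show "ennreal (norm (?f z)) * (\<integral>\<^sup>+z'. ennreal (E z (z' - z) * u z') \<partial>lborel) \<le> \<dots>" .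
    qed
    also have "\<dots> = ennreal (\<kappa> / 4) * mass ?f +
        ennreal mh * (\<integral>\<^sup>+z. ennreal (norm (?f z) * u z) * indicator (- tf_box R) z \<partial>lborel)"
      unfolding mass_def by (simp add: nn_integral_add nn_integral_cmult)
    also have "\<dots> \<le> ennreal (\<kappa> / 4) * ennreal \<tau> + ennreal mh * ennreal \<eta>"
      by (intro add_mono mult_left_mono mf R) auto
    also have "\<dots> = ennreal (\<kappa> / 4 * \<tau> + mh * \<eta>)"
      using \<kappa> \<tau> mh(1) \<eta>(1) by (simp flip: ennreal_mult ennreal_plus)
    also have "\<dots> \<le> ennreal (\<kappa> * (\<tau> / 2))"
      using \<eta>(2) by (intro ennreal_leI) simp
    also have "\<dots> = ennreal \<kappa> * ennreal (\<tau> / 2)"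
      using \<kappa> \<tau> by (intro ennreal_mult) auto
    finally have "mass res \<le> ennreal (\<tau> / 2)"
      using \<kappa> by (subst (asm) ennreal_mult_le_mult_iff) auto
    then show ?thesis
      using fin cost unfolding res_def[abs_def] by blast
  qed
  show ?thesis
    using main C1(1) \<kappa> by (intro exI[of _ "C1 / \<kappa>"]) auto
qed

end

section \<open>Invariant Banach spaces\<close>


lemma tempered_diff_closed:
  assumes "f \<in> tempered" "h \<in> tempered"
  shows "(\<lambda>\<phi>. f \<phi> - h \<phi>) \<in> tempered"
  using assms unfolding tempered_def
  by (auto intro: continuous_map_diff simp: algebra_simps)

text \<open>The continuous embedding is recorded as one bound per test function, since the seminorms
  of the weak-* topology are exactly the evaluations.\<close>

locale banach_distributions =
  fixes B :: "distribution set" and N :: "distribution \<Rightarrow> real"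
  assumes banach: "complex_banach_space B N"
    and B_tempered: "B \<subseteq> tempered"
    and evaluation_bound: "\<phi> \<in> schwartz \<Longrightarrow> \<exists>C. \<forall>\<Lambda>\<in>B. norm (\<Lambda> \<phi>) \<le> C * N \<Lambda>"
begin

lemma B_zero: "(\<lambda>\<phi>. 0) \<in> B"
  and B_add: "f \<in> B \<Longrightarrow> h \<in> B \<Longrightarrow> (\<lambda>\<phi>. f \<phi> + h \<phi>) \<in> B"
  and B_scale: "f \<in> B \<Longrightarrow> (\<lambda>\<phi>. c * f \<phi>) \<in> B"
proof -
  have sub: "cfun.subspace B" using banach by (simp add: complex_banach_space_def)
  show "(\<lambda>\<phi>. 0) \<in> B" using cfun.subspace_0[OF sub] by (simp add: zero_fun_def)
  show "f \<in> B \<Longrightarrow> h \<in> B \<Longrightarrow> (\<lambda>\<phi>. f \<phi> + h \<phi>) \<in> B"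
    using cfun.subspace_add[OF sub] by (simp add: plus_fun_def)
  show "f \<in> B \<Longrightarrow> (\<lambda>\<phi>. c * f \<phi>) \<in> B"
    using cfun.subspace_scale[OF sub] by (simp add: fscale_def)
qed

lemma N_nonneg: "f \<in> B \<Longrightarrow> 0 \<le> N f"
  and N_add: "f \<in> B \<Longrightarrow> h \<in> B \<Longrightarrow> N (\<lambda>\<phi>. f \<phi> + h \<phi>) \<le> N f + N h"
  and N_scale: "f \<in> B \<Longrightarrow> N (\<lambda>\<phi>. c * f \<phi>) = cmod c * N f"
  using banach by (simp_all add: complex_banach_space_def plus_fun_def fscale_def)

lemma N_zero: "N (\<lambda>\<phi>. 0) = 0"
  using N_scale[OF B_zero, of 0] by simp

lemma B_diff: "f \<in> B \<Longrightarrow> h \<in> B \<Longrightarrow> (\<lambda>\<phi>. f \<phi> - h \<phi>) \<in> B"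
  using B_add[of f "\<lambda>\<phi>. -1 * h \<phi>"] B_scale[of h "-1"] by simp

lemma N_minus_commute: "f \<in> B \<Longrightarrow> h \<in> B \<Longrightarrow> N (\<lambda>\<phi>. f \<phi> - h \<phi>) = N (\<lambda>\<phi>. h \<phi> - f \<phi>)"
  using N_scale[OF B_diff, of h f "-1"] by simp

lemma B_complete:
  assumes "\<And>n. \<sigma> n \<in> B"
    and "\<And>e. e > 0 \<Longrightarrow> \<exists>K. \<forall>m\<ge>K. \<forall>n\<ge>K. N (\<lambda>\<phi>. \<sigma> m \<phi> - \<sigma> n \<phi>) < e"
  obtains f where "f \<in> B" "(\<lambda>n. N (\<lambda>\<phi>. \<sigma> n \<phi> - f \<phi>)) \<longlonglongrightarrow> 0"
proof -
  have eq: "f - h = (\<lambda>\<phi>. f \<phi> - h \<phi>)" for f h :: distribution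
    by (simp add: fun_eq_iff)
  have prem: "range \<sigma> \<subseteq> B \<and> (\<forall>e>0. \<exists>K. \<forall>m\<ge>K. \<forall>n\<ge>K. N (\<sigma> m - \<sigma> n) < e)"
    unfolding eq using assms by auto
  have "\<forall>\<sigma>. range \<sigma> \<subseteq> B \<and> (\<forall>e>0. \<exists>K. \<forall>m\<ge>K. \<forall>n\<ge>K. N (\<sigma> m - \<sigma> n) < e) \<longrightarrow>
      (\<exists>f\<in>B. (\<lambda>n. N (\<sigma> n - f)) \<longlonglongrightarrow> 0)"
    using banach unfolding complex_banach_space_def by (elim conjE)
  from mp[OF spec[OF this, of \<sigma>] prem] have "\<exists>f\<in>B. (\<lambda>n. N (\<sigma> n - f)) \<longlonglongrightarrow> 0" .
  then show ?thesis unfolding eq using that by (elim bexE)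
qed

lemma B_sum:
  assumes "\<And>k. k \<in> I \<Longrightarrow> h k \<in> B"
  shows "(\<lambda>\<phi>. \<Sum>k\<in>I. a k * h k \<phi>) \<in> B \<and> N (\<lambda>\<phi>. \<Sum>k\<in>I. a k * h k \<phi>) \<le> (\<Sum>k\<in>I. cmod (a k) * N (h k))"
  using assms
proof (induction I rule: infinite_finite_induct)
  case (insert k I)
  then have IH: "(\<lambda>\<phi>. \<Sum>k\<in>I. a k * h k \<phi>) \<in> B" "N (\<lambda>\<phi>. \<Sum>k\<in>I. a k * h k \<phi>) \<le> (\<Sum>k\<in>I. cmod (a k) * N (h k))"
    by auto
  have k: "(\<lambda>\<phi>. a k * h k \<phi>) \<in> B" "N (\<lambda>\<phi>. a k * h k \<phi>) = cmod (a k) * N (h k)"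
    using insert.prems by (auto intro: B_scale N_scale)
  have "N (\<lambda>\<phi>. a k * h k \<phi> + (\<Sum>k\<in>I. a k * h k \<phi>)) \<le> cmod (a k) * N (h k) + (\<Sum>k\<in>I. cmod (a k) * N (h k))"
    using N_add[OF k(1) IH(1)] IH(2) k(2) by simp
  then show ?case
    using insert.hyps B_add[OF k(1) IH(1)] by simp
qed (simp_all add: B_zero N_zero)

end

locale invariant_banach = banach_distributions B N + tf_weight u
  for B N u +
  assumes shift_in_B: "h \<in> B \<Longrightarrow> dist_shift z h \<in> B"
    and N_shift: "h \<in> B \<Longrightarrow> N (dist_shift z h) \<le> u z * N h"
begin

text \<open>The orthogonality relation expresses \<open>h G * f \<phi>\<close> through shifts of h,
  which lie in B and obey the evaluation bound. Thus f is controlled on \<phi> by its mass before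
  its membership in B is known, and remainders of vanishing mass vanish on test functions.\<close>

lemma pairing_bound:
  assumes G: "G \<in> schwartz" and G0: "G \<noteq> 0" and \<phi>: "\<phi> \<in> schwartz"
    and h: "h \<in> B" and hfin: "mass (stft G h) < \<infinity>"
  shows "\<exists>D. \<forall>f\<in>tempered. \<forall>\<tau>\<ge>0. mass (stft G f) \<le> ennreal \<tau> \<longrightarrow> norm (h G) * norm (f \<phi>) \<le> D * \<tau>"
proof -
  have ht: "h \<in> tempered" using h B_tempered by blast
  obtain C0 where C0: "\<And>\<Lambda>. \<Lambda> \<in> B \<Longrightarrow> norm (\<Lambda> \<phi>) \<le> C0 * N \<Lambda>" using evaluation_bound[OF \<phi>] by blast
  define C where "C = max C0 0"
  have C: "C \<ge> 0" "\<And>\<Lambda>. \<Lambda> \<in> B \<Longrightarrow> norm (\<Lambda> \<phi>) \<le> C * N \<Lambda>"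
  proof -
    fix \<Lambda> assume "\<Lambda> \<in> B"
    then have "C0 * N \<Lambda> \<le> C * N \<Lambda>" unfolding C_def by (intro mult_right_mono N_nonneg) auto
    then show "norm (\<Lambda> \<phi>) \<le> C * N \<Lambda>" using C0[OF \<open>\<Lambda> \<in> B\<close>] by linarith
  qed (simp add: C_def)
  have Vm: "(stft G f) \<in> borel_measurable borel" if "f \<in> tempered" for f
    by (rule borel_measurable_continuous_onI[OF continuous_on_tempered_atom[OF G that]])
  obtain H B' where H: "continuous_on UNIV H" "\<And>t. norm (H t) \<le> B'"
      "\<And>\<psi>. \<psi> \<in> schwartz \<Longrightarrow> h \<psi> = (LBINT t. H t * \<psi> t)"
    using tempered_is_function[OF G G0 ht mass_integrable(1)[OF Vm[OF ht] hfin]] by metis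
  have "norm (h G) * norm (f \<phi>) \<le> (C * N h) * \<tau>"
    if f: "f \<in> tempered" and \<tau>: "\<tau> \<ge> 0" and mf: "mass (stft G f) \<le> ennreal \<tau>" for f \<tau>
  proof -
    have ffin: "mass (stft G f) < \<infinity>" using mf by (simp add: order_le_less_trans)
    note fint = mass_integrable[OF Vm[OF f] ffin]
    obtain F B where F: "continuous_on UNIV F" "\<And>t. norm (F t) \<le> B"
      "\<And>\<psi>. \<psi> \<in> schwartz \<Longrightarrow> f \<psi> = (LBINT t. F t * \<psi> t)"
      using tempered_is_function[OF G G0 f fint(1)] by metis
    have orth: "integrable lborel (\<lambda>z. f (tf_atom G z) * dist_shift z h \<phi>)"
          "(LBINT z. f (tf_atom G z) * dist_shift z h \<phi>) = h G * f \<phi>"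
        by (rule tempered_orthogonality[OF G \<phi> f F H fint(1)]; assumption)+
    have "norm (h G) * norm (f \<phi>) = norm (LBINT z. f (tf_atom G z) * dist_shift z h \<phi>)"
      by (simp add: orth(2) norm_mult)
    also have "\<dots> \<le> (LBINT z. (C * N h) * (norm (f (tf_atom G z)) * u z))"
    proof (rule Bochner_Integration.integral_norm_bound_integral)
      show "integrable lborel (\<lambda>z. f (tf_atom G z) * dist_shift z h \<phi>)" by (rule orth)
      show "integrable lborel (\<lambda>z. (C * N h) * (norm (f (tf_atom G z)) * u z))"
        by (intro integrable_mult_right fint)
      fix z
      have "norm (dist_shift z h \<phi>) \<le> C * (u z * N h)"
        using C(2)[OF shift_in_B[OF h]] mult_left_mono[OF N_shift[OF h] C(1)] by (meson order_trans)
      then have "norm (f (tf_atom G z)) * norm (dist_shift z h \<phi>) \<le> norm (f (tf_atom G z)) * (C * (u z * N h))"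
        by (rule mult_left_mono) simp
      then show "norm (f (tf_atom G z) * dist_shift z h \<phi>) \<le> (C * N h) * (norm (f (tf_atom G z)) * u z)"
        by (simp add: norm_mult mult_ac)
    qed
    also have "\<dots> = (C * N h) * (LBINT z. norm (f (tf_atom G z)) * u z)" by simp
    also have "\<dots> \<le> (C * N h) * \<tau>"
    proof (rule mult_left_mono)
      have "ennreal (LBINT z. norm (f (tf_atom G z)) * u z) = mass (stft G f)"
        unfolding mass_def using fint(2) by (intro nn_integral_eq_integral[symmetric]) auto
      then have "ennreal (LBINT z. norm (f (tf_atom G z)) * u z) \<le> ennreal \<tau>" using mf by simp
      then show "(LBINT z. norm (f (tf_atom G z)) * u z) \<le> \<tau>"
        using \<tau> by (simp add: ennreal_le_iff)
      show "0 \<le> C * N h" using C(1) N_nonneg[OF h] by simp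
    qed
    finally show ?thesis .
  qed
  then show ?thesis by blast
qed

text \<open>The mass enters through an arbitrary positive upper bound \<tau>, so that halving works
  in the same way when the mass is 0. The geometric series of the corrections contributes the factor
  2 in the final constant.\<close>

lemma minimality_aux:
  assumes G: "G \<in> schwartz" and h: "h \<in> B" and \<kappa>: "h G \<noteq> 0"
    and hfin: "mass (stft G h) < \<infinity>"
  shows "\<exists>K\<ge>0. \<forall>f\<in>tempered. \<forall>\<tau>>0. mass (stft G f) \<le> ennreal \<tau> \<longrightarrow> f \<in> B \<and> N f \<le> K * \<tau>"
proof -
  have ht: "h \<in> tempered" using h B_tempered by blast
  have G0: "G \<noteq> 0"
  proof
    assume "G = 0"
    then have "G = (\<lambda>t. 0)" by (simp add: fun_eq_iff)
    then show False using \<kappa> tempered_zero[OF ht] by simp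
  qed
  obtain C where C: "C \<ge> 0" "\<And>f \<tau>. f \<in> tempered \<Longrightarrow> \<tau> > 0 \<Longrightarrow> mass (stft G f) \<le> ennreal \<tau> \<Longrightarrow>
      \<exists>I a. finite I \<and> (\<Sum>k\<in>I. norm (a k) * u k) \<le> C * \<tau> \<and>
        mass (\<lambda>z. f (tf_atom G z) - (\<Sum>k\<in>I. a k * dist_shift k h (tf_atom G z))) \<le> ennreal (\<tau> / 2)"
    using discretize[OF G ht \<kappa> hfin] by blast
  define C' where "C' = C * N h"
  have C': "C' \<ge> 0" using C(1) N_nonneg[OF h] by (simp add: C'_def)
  have step: "\<exists>f'. f' \<in> tempered \<and> mass (stft G f') \<le> ennreal (\<tau> / 2) \<and>
      (\<lambda>\<phi>. f \<phi> - f' \<phi>) \<in> B \<and> N (\<lambda>\<phi>. f \<phi> - f' \<phi>) \<le> C' * \<tau>"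
    if f: "f \<in> tempered" and \<tau>: "\<tau> > 0" and m: "mass (stft G f) \<le> ennreal \<tau>" for f \<tau>
  proof -
    obtain I a where I: "finite I" "(\<Sum>k\<in>I. norm (a k) * u k) \<le> C * \<tau>"
        "mass (\<lambda>z. f (tf_atom G z) - (\<Sum>k\<in>I. a k * dist_shift k h (tf_atom G z))) \<le> ennreal (\<tau> / 2)"
      using C(2)[OF f \<tau> m] by blast
    define s where "s = (\<lambda>\<phi>. \<Sum>k\<in>I. a k * dist_shift k h \<phi>)"
    have s: "s \<in> B" "N s \<le> (\<Sum>k\<in>I. cmod (a k) * N (dist_shift k h))"
      using B_sum[of I "\<lambda>k. dist_shift k h" a] shift_in_B[OF h] by (auto simp: s_def)
    have "N s \<le> (\<Sum>k\<in>I. cmod (a k) * (u k * N h))"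
      by (rule order_trans[OF s(2)]) (intro sum_mono mult_left_mono N_shift h, simp)
    also have "\<dots> = (\<Sum>k\<in>I. cmod (a k) * u k) * N h"
      by (simp add: sum_distrib_right mult.assoc)
    also have "\<dots> \<le> (C * \<tau>) * N h"
      by (intro mult_right_mono I N_nonneg h)
    finally have Ns: "N s \<le> C' * \<tau>" by (simp add: C'_def mult_ac)
    show ?thesis
    proof (intro exI[of _ "\<lambda>\<phi>. f \<phi> - s \<phi>"] conjI)
      show "(\<lambda>\<phi>. f \<phi> - s \<phi>) \<in> tempered"
        using s(1) B_tempered by (intro tempered_diff_closed f) auto
    qed (use s(1) Ns I(3) in \<open>simp_all add: s_def\<close>)
  qed
  have main: "f \<in> B \<and> N f \<le> 2 * C' * \<tau>"
    if f: "f \<in> tempered" and \<tau>: "\<tau> > 0" and m: "mass (stft G f) \<le> ennreal \<tau>" for f \<tau>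
  proof -
    \<comment> \<open>The choice principle yields some sequence of remainders; the clause for n = 0
      forces it to start at f.\<close>
    have "\<exists>F. \<forall>n. (F n \<in> tempered \<and> mass (\<lambda>z. F n (tf_atom G z)) \<le> ennreal (\<tau> / 2 ^ n) \<and> (n = 0 \<longrightarrow> F n = f)) \<and>
        ((\<lambda>\<phi>. F n \<phi> - F (Suc n) \<phi>) \<in> B \<and> N (\<lambda>\<phi>. F n \<phi> - F (Suc n) \<phi>) \<le> C' * (\<tau> / 2 ^ n))"
    proof (rule dependent_nat_choice)
      show "\<exists>g. g \<in> tempered \<and> mass (stft G g) \<le> ennreal (\<tau> / 2 ^ 0) \<and> (0 = (0::nat) \<longrightarrow> g = f)"
        using f m by auto
      fix g n assume g: "g \<in> tempered \<and> mass (stft G g) \<le> ennreal (\<tau> / 2 ^ n) \<and> (n = 0 \<longrightarrow> g = f)"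
      have half: "\<tau> / 2 ^ n / 2 = \<tau> / 2 ^ Suc n" by simp
      show "\<exists>g'. (g' \<in> tempered \<and> mass (stft G g') \<le> ennreal (\<tau> / 2 ^ Suc n) \<and> (Suc n = 0 \<longrightarrow> g' = f)) \<and>
        (\<lambda>\<phi>. g \<phi> - g' \<phi>) \<in> B \<and> N (\<lambda>\<phi>. g \<phi> - g' \<phi>) \<le> C' * (\<tau> / 2 ^ n)"
        using step[of g "\<tau> / 2 ^ n", unfolded half] g \<tau> by auto
    qed
    then obtain F where F: "\<And>n. F n \<in> tempered" "\<And>n. mass (\<lambda>z. F n (tf_atom G z)) \<le> ennreal (\<tau> / 2 ^ n)" "F 0 = f"
      "\<And>n. (\<lambda>\<phi>. F n \<phi> - F (Suc n) \<phi>) \<in> B" "\<And>n. N (\<lambda>\<phi>. F n \<phi> - F (Suc n) \<phi>) \<le> C' * (\<tau> / 2 ^ n)"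
      by blast
    \<comment> \<open>The bound is the exact partial sum of the geometric series; a bound by its
      full sum would not pass through the induction.\<close>
    have tail: "(\<lambda>\<phi>. F m \<phi> - F n \<phi>) \<in> B \<and> N (\<lambda>\<phi>. F m \<phi> - F n \<phi>) \<le> C' * (2 * \<tau> / 2 ^ m - 2 * \<tau> / 2 ^ n)" if "m \<le> n" for m n
      using that
    proof (induction n rule: dec_induct)
      case base
      then show ?case by (simp add: B_zero N_zero)
    next
      case (step n)
      have "N (\<lambda>\<phi>. (F m \<phi> - F n \<phi>) + (F n \<phi> - F (Suc n) \<phi>)) \<le> C' * (2 * \<tau> / 2 ^ m - 2 * \<tau> / 2 ^ n) + C' * (\<tau> / 2 ^ n)"
        using N_add[OF conjunct1[OF step.IH] F(4)[of n]] step.IH F(5)[of n] by simp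
      also have "\<dots> = C' * (2 * \<tau> / 2 ^ m - 2 * \<tau> / 2 ^ Suc n)"
        by (simp add: field_simps)
      finally show ?case
        using B_add[OF conjunct1[OF step.IH] F(4)[of n]] by simp
    qed
    have tail': "N (\<lambda>\<phi>. F m \<phi> - F n \<phi>) \<le> C' * (2 * \<tau> / 2 ^ m)" if "m \<le> n" for m n
    proof -
      have "C' * (2 * \<tau> / 2 ^ m - 2 * \<tau> / 2 ^ n) \<le> C' * (2 * \<tau> / 2 ^ m)"
        using C' \<tau> by (intro mult_left_mono) auto
      then show ?thesis using tail[OF that] by linarith
    qed
    define S where "S n = (\<lambda>\<phi>. f \<phi> - F n \<phi>)" for n
    have SB: "S n \<in> B" for n using tail[of 0 n] by (simp add: S_def F(3))
    obtain L where L: "L \<in> B" "(\<lambda>n. N (\<lambda>\<phi>. S n \<phi> - L \<phi>)) \<longlonglongrightarrow> 0"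
    proof (rule B_complete[of S])
      show "S n \<in> B" for n by (rule SB)
      fix e :: real assume "e > 0"
      have "(\<lambda>n. C' * (2 * \<tau>) * (1 / 2) ^ n) \<longlonglongrightarrow> C' * (2 * \<tau>) * 0"
        by (intro tendsto_intros LIMSEQ_realpow_zero) auto
      then have "\<forall>\<^sub>F n in sequentially. C' * (2 * \<tau>) * (1 / 2) ^ n < e"
        using \<open>e > 0\<close> by (intro order_tendstoD) auto
      then obtain K where K: "\<And>n. n \<ge> K \<Longrightarrow> C' * (2 * \<tau> / 2 ^ n) < e"
        by (auto simp: eventually_sequentially power_one_over)
      have le: "N (\<lambda>\<phi>. S m \<phi> - S n \<phi>) < e" if "K \<le> m" "m \<le> n" for m n
      proof -
        have "N (\<lambda>\<phi>. S m \<phi> - S n \<phi>) = N (\<lambda>\<phi>. S n \<phi> - S m \<phi>)"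
          by (rule N_minus_commute[OF SB SB])
        also have "\<dots> = N (\<lambda>\<phi>. F m \<phi> - F n \<phi>)" by (simp add: S_def)
        also have "\<dots> < e" using tail'[OF that(2)] K[OF that(1)] by linarith
        finally show ?thesis .
      qed
      have "N (\<lambda>\<phi>. S m \<phi> - S n \<phi>) < e" if "K \<le> m" "K \<le> n" for m n
        using le[of m n] le[of n m] that N_minus_commute[OF SB SB, of m n] by (cases "m \<le> n") auto
      then show "\<exists>K. \<forall>m\<ge>K. \<forall>n\<ge>K. N (\<lambda>\<phi>. S m \<phi> - S n \<phi>) < e" by blast
    qed (rule that)
    have NL: "N L \<le> 2 * C' * \<tau>"
    proof (rule tendsto_lowerbound)
      have "(\<lambda>n. N (\<lambda>\<phi>. S n \<phi> - L \<phi>) + 2 * C' * \<tau>) \<longlonglongrightarrow> 0 + 2 * C' * \<tau>"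
        by (intro tendsto_intros L)
      then show "(\<lambda>n. N (\<lambda>\<phi>. S n \<phi> - L \<phi>) + 2 * C' * \<tau>) \<longlonglongrightarrow> 2 * C' * \<tau>" by simp
      have "N L \<le> N (\<lambda>\<phi>. S n \<phi> - L \<phi>) + 2 * C' * \<tau>" for n
      proof -
        have "N (\<lambda>\<phi>. (L \<phi> - S n \<phi>) + S n \<phi>) \<le> N (\<lambda>\<phi>. L \<phi> - S n \<phi>) + N (S n)"
          by (intro N_add B_diff SB L)
        moreover have "N (S n) \<le> 2 * C' * \<tau>"
          using tail'[of 0 n] by (simp add: S_def F(3) mult_ac)
        ultimately show ?thesis
          using N_minus_commute[OF L(1) SB, of n] by simp
      qed
      then show "\<forall>\<^sub>F n in sequentially. N L \<le> N (\<lambda>\<phi>. S n \<phi> - L \<phi>) + 2 * C' * \<tau>" by simp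
    qed simp
    \<comment> \<open>On a Schwartz function, the partial sums tend to L by the evaluation bound and
      to f because the remainders vanish there by \<open>pairing_bound\<close>. Off the Schwartz
      space both sides are 0 by the encoding of distributions.\<close>
    have "f = L"
    proof
      fix \<phi>
      show "f \<phi> = L \<phi>"
      proof (cases "\<phi> \<in> schwartz")
        case False
        then show ?thesis using tempered_outside f L(1) B_tempered by (metis subsetD)
      next
        case \<phi>: True
        obtain D where D: "\<And>g t. g \<in> tempered \<Longrightarrow> t \<ge> 0 \<Longrightarrow> mass (stft G g) \<le> ennreal t \<Longrightarrow>
            norm (h G) * norm (g \<phi>) \<le> D * t"
          using pairing_bound[OF G G0 \<phi> h hfin] by blast
        obtain C0 where C0: "\<And>\<Lambda>. \<Lambda> \<in> B \<Longrightarrow> norm (\<Lambda> \<phi>) \<le> C0 * N \<Lambda>"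
          using evaluation_bound[OF \<phi>] by blast
        have "(\<lambda>n. F n \<phi>) \<longlonglongrightarrow> 0"
        proof (rule Lim_null_comparison)
          have "norm (F n \<phi>) \<le> D * \<tau> / norm (h G) * (1 / 2) ^ n" for n
            using D[OF F(1) _ F(2), of n] \<tau> \<kappa> by (simp add: field_simps power_one_over)
          then show "\<forall>\<^sub>F n in sequentially. norm (F n \<phi>) \<le> D * \<tau> / norm (h G) * (1 / 2) ^ n" by simp
          show "(\<lambda>n. D * \<tau> / norm (h G) * (1 / 2) ^ n) \<longlonglongrightarrow> 0"
            by (rule tendsto_mult_right_zero) (rule LIMSEQ_realpow_zero; simp)
        qed
        from tendsto_diff[OF tendsto_const[of "f \<phi>"] this]
        have 1: "(\<lambda>n. S n \<phi>) \<longlonglongrightarrow> f \<phi>" by (simp add: S_def)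
        have "(\<lambda>n. S n \<phi> - L \<phi>) \<longlonglongrightarrow> 0"
        proof (rule Lim_null_comparison)
          show "\<forall>\<^sub>F n in sequentially. norm (S n \<phi> - L \<phi>) \<le> C0 * N (\<lambda>\<phi>. S n \<phi> - L \<phi>)"
            using C0[OF B_diff[OF SB L(1)]] by simp
          show "(\<lambda>n. C0 * N (\<lambda>\<phi>. S n \<phi> - L \<phi>)) \<longlonglongrightarrow> 0"
            by (rule tendsto_mult_right_zero[OF L(2)])
        qed
        then have "(\<lambda>n. S n \<phi>) \<longlonglongrightarrow> L \<phi>" by (simp add: LIM_zero_iff)
        with 1 show ?thesis by (rule LIMSEQ_unique)
      qed
    qed
    then show ?thesis using L(1) NL by simp
  qed
  show ?thesis
    using main C' by (intro exI[of _ "2 * C'"]) auto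
qed

text \<open>A distribution whose transform vanishes everywhere is 0 by the reproducing formula with
  the conjugate window. So the transform of h is nonzero at some z, and the shift by -z moves this
  value to the origin, where the atom is G; mass stays finite by submultiplicativity.\<close>

lemma minimality:
  assumes G: "G \<in> schwartz" and G0: "G \<noteq> 0" and h: "h \<in> B" and "h \<noteq> 0"
    and hfin: "mass (stft G h) < \<infinity>"
  shows "\<exists>K\<ge>0. \<forall>f\<in>tempered. \<forall>\<tau>>0. mass (stft G f) \<le> ennreal \<tau> \<longrightarrow> f \<in> B \<and> N f \<le> K * \<tau>"
proof -
  have ht: "h \<in> tempered" using h B_tempered by blast
  obtain z where z: "h (tf_atom G z) \<noteq> 0"
  proof (rule ccontr)
    assume "\<not> thesis"
    then have 0: "h (tf_atom G z) = 0" for z using that by blast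
    have "h \<phi> = 0" for \<phi>
    proof (cases "\<phi> \<in> schwartz")
      case True
      then show ?thesis
        using tempered_reproducing[OF G schwartz_cnj[OF G] True ht] schwartz_self_pairing_nonzero[OF G G0]
        by (simp add: 0)
    qed (simp add: tempered_outside[OF ht])
    then show False using \<open>h \<noteq> 0\<close> by (simp add: fun_eq_iff)
  qed
  define h1 where "h1 = dist_shift (- z) h"
  have atom: "norm (h1 (tf_atom G y)) = norm (h (tf_atom G (y - - z)))" for y
    by (simp add: h1_def dist_shift_atom[OF G ht] norm_mult)
  show ?thesis
  proof (rule minimality_aux[OF G])
    show "h1 \<in> B" unfolding h1_def by (rule shift_in_B[OF h])
    have "tf_atom G 0 = G" by (simp add: tf_atom_def)
    then show "h1 G \<noteq> 0" using atom[of 0] z by auto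
    have "mass (\<lambda>y. h1 (tf_atom G y)) = mass (\<lambda>y. h (tf_atom G (y - - z)))"
      unfolding mass_def by (simp only: atom)
    also have "\<dots> \<le> ennreal (u (- z)) * mass (\<lambda>y. h (tf_atom G y))"
      by (rule mass_shift[OF borel_measurable_continuous_onI[OF continuous_on_tempered_atom[OF G ht]]])
    also have "\<dots> < \<infinity>" using hfin by (simp add: ennreal_mult_less_top)
    finally show "mass (\<lambda>y. h1 (tf_atom G y)) < \<infinity>" .
  qed
qed

end

section \<open>The A-time-frequency shifts\<close>


text \<open>If \<open>v z < 1\<close>, then \<open>v (n z) \<le> v z ^ n\<close> decays exponentially, and so
  \<open>v (- n z) \<ge> 1 / v (n z)\<close> grows exponentially.\<close>

lemma weight_ge_1:
  assumes pos: "\<And>z. 0 < v z" and sub: "submultiplicative v" and pol: "polynomial_growth v"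
  shows "1 \<le> v z"
proof (rule ccontr)
  assume "\<not> 1 \<le> v z"
  then have r: "0 < v z" "v z < 1" using pos by auto
  have sub': "v (z + z') \<le> v z * v z'" for z z'
    using sub unfolding submultiplicative_def by (cases z; cases z') auto
  have "v 0 \<le> v 0 * v 0" using sub'[of 0 0] by simp
  then have v0: "1 \<le> v 0" using pos[of 0] by simp
  obtain C k where C: "C > 0" "k \<ge> 0" "\<And>x \<omega>. v (x, \<omega>) \<le> C * (1 + \<bar>x\<bar> + \<bar>\<omega>\<bar>) powr k"
    using pol unfolding polynomial_growth_def by auto
  \<comment> \<open>The estimate 1 + n (\<bar>x\<bar> + \<bar>\<omega>\<bar>) \<le> (1 + n)
    \<open>tf_size z\<close> separates n from z, so D collects all that is independent of n.\<close>
  define D where "D = C * (tf_size z) powr k"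
  have pw: "v (real n *\<^sub>R z) \<le> v 0 * v z ^ n" for n
  proof (induction n)
    case (Suc n)
    have "v (real (Suc n) *\<^sub>R z) \<le> v (real n *\<^sub>R z) * v z"
      using sub'[of "real n *\<^sub>R z" z] by (simp add: scaleR_add_left add.commute)
    also have "\<dots> \<le> v 0 * v z ^ n * v z"
      using Suc r by (intro mult_right_mono) auto
    finally show ?case by (simp add: mult_ac)
  qed simp
  have gr: "v (- (real n *\<^sub>R z)) \<le> D * (1 + real n) powr k" for n
  proof -
    have "v (- (real n *\<^sub>R z)) \<le> C * (1 + \<bar>real n * fst z\<bar> + \<bar>real n * snd z\<bar>) powr k"
      using C(3)[of "- (real n * fst z)" "- (real n * snd z)"] by (cases z) simp
    also have "\<dots> \<le> C * ((1 + real n) * tf_size z) powr k"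
      using C(1,2) by (intro mult_left_mono powr_mono2) (auto simp: tf_size_def algebra_simps abs_mult)
    also have "\<dots> = D * (1 + real n) powr k"
      by (simp add: D_def powr_mult mult_ac)
    finally show ?thesis .
  qed
  have "1 \<le> v 0 * D * (v z ^ n * (1 + real n) powr k)" for n
  proof -
    have "1 \<le> v (real n *\<^sub>R z) * v (- (real n *\<^sub>R z))"
      using sub'[of "real n *\<^sub>R z" "- (real n *\<^sub>R z)"] v0 by simp
    also have "\<dots> \<le> (v 0 * v z ^ n) * (D * (1 + real n) powr k)"
      using pos[of 0] r pos[THEN less_imp_le] by (intro mult_mono pw gr mult_nonneg_nonneg) auto
    finally show ?thesis by (simp add: mult_ac)
  qed
  moreover have "(\<lambda>n. v 0 * D * (v z ^ n * (1 + real n) powr k)) \<longlonglongrightarrow> v 0 * D * 0"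
  proof (intro tendsto_intros)
    show "(\<lambda>n. v z ^ n * (1 + real n) powr k) \<longlonglongrightarrow> 0"
      using r C(2) by real_asymp
  qed
  ultimately have "1 \<le> v 0 * D * 0"
    by (intro tendsto_lowerbound) auto
  then show False by simp
qed

text \<open>A supremum over open unit balls is lower semicontinuous, so no measurability of \<open>v\<close> is needed.\<close>

lemma tf_weight_regularization:
  fixes v :: "real \<times> real \<Rightarrow> real"
  assumes ge: "\<And>z. 1 \<le> v z" and sub: "\<And>z z'. v (z + z') \<le> v z * v z'"
    and bdd: "\<And>R. \<exists>C. \<forall>z. norm z \<le> R \<longrightarrow> v z \<le> C"
  obtains u C where "tf_weight u" "C > 0" "\<And>z. v z \<le> u z" "\<And>z. u z \<le> C * v z"
proof -
  define u where "u z = (SUP h\<in>ball 0 1. v (z + h))" for z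
  obtain C0 where C0: "\<And>z. norm z \<le> 1 \<Longrightarrow> v z \<le> C0" using bdd by blast
  have C1: "C0 \<ge> 1" using C0[of 0] ge[of 0] by simp
  have v0: "0 \<le> v z" for z using ge[of z] by linarith
  have le: "v (z + h) \<le> C0 * v z" if "h \<in> ball 0 1" for z h
  proof -
    have "v (z + h) \<le> v z * v h" by (rule sub)
    also have "\<dots> \<le> v z * C0" using that v0 by (intro mult_left_mono C0) auto
    finally show ?thesis by (simp add: mult.commute)
  qed
  have bd: "bdd_above ((\<lambda>h. v (z + h)) ` ball 0 1)" for z
    by (rule bdd_aboveI2) (rule le)
  have up: "v (z + h) \<le> u z" if "h \<in> ball 0 1" for z h
    unfolding u_def by (rule cSUP_upper[OF that bd])
  have vu: "v z \<le> u z" for z using up[of 0 z] by simp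
  have uv: "u z \<le> C0 * v z" for z
    unfolding u_def by (rule cSUP_least) (auto intro: le)
  have "tf_weight u"
  proof
    have "open {z. c < u z}" for c
    proof -
      have "{z. c < u z} = (\<Union>y\<in>{y. c < v y}. ball y 1)"
      proof -
        have "c < u z \<longleftrightarrow> (\<exists>y. c < v y \<and> dist y z < 1)" for z
        proof -
          have "c < u z \<longleftrightarrow> (\<exists>h\<in>ball 0 1. c < v (z + h))"
            unfolding u_def by (rule less_cSUP_iff[OF _ bd]) simp
          also have "\<dots> \<longleftrightarrow> (\<exists>y. c < v y \<and> dist y z < 1)"
          proof
            assume "\<exists>h\<in>ball 0 1. c < v (z + h)"
            then obtain h where "h \<in> ball 0 1" "c < v (z + h)" by blast
            then show "\<exists>y. c < v y \<and> dist y z < 1"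
              by (intro exI[of _ "z + h"]) (simp add: dist_norm)
          next
            assume "\<exists>y. c < v y \<and> dist y z < 1"
            then obtain y where "c < v y" "dist y z < 1" by blast
            then show "\<exists>h\<in>ball 0 1. c < v (z + h)"
              by (intro bexI[of _ "y - z"]) (auto simp: dist_norm norm_minus_commute)
          qed
          finally show ?thesis .
        qed
        then show ?thesis by (simp add: set_eq_iff del: split_paired_All split_paired_Ex)
      qed
      then show ?thesis by auto
    qed
    then show "u \<in> borel_measurable borel"
      by (intro borel_measurableI_greater) auto
    show "1 \<le> u z" for z using ge[of z] vu[of z] by linarith
    \<comment> \<open>The perturbation h is assigned entirely to the second argument, so that the
      unperturbed v z can be bounded by u z.\<close>
    show "u (z + z') \<le> u z * u z'" for z z'
      unfolding u_def[of "z + z'"]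
    proof (rule cSUP_least)
      fix h :: "real \<times> real" assume "h \<in> ball 0 1"
      have "v (z + z' + h) \<le> v z * v (z' + h)" using sub[of z "z' + h"] by (simp add: add.assoc)
      also have "\<dots> \<le> u z * u z'"
        using vu[of z] up[OF \<open>h \<in> ball 0 1\<close>, of z'] v0 order_trans[OF v0 vu]
        by (intro mult_mono) blast+
      finally show "v (z + z' + h) \<le> u z * u z'" .
    qed simp
    show "\<exists>C. \<forall>z. norm z \<le> R \<longrightarrow> u z \<le> C" for R
    proof -
      obtain C where "\<And>z. norm z \<le> R \<Longrightarrow> v z \<le> C" using bdd by blast
      then have "C0 * v z \<le> C0 * C" if "norm z \<le> R" for z
        using C1 that by (intro mult_left_mono) auto
      with uv have "u z \<le> C0 * C" if "norm z \<le> R" for z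
        using that order_trans by blast
      then show ?thesis by blast
    qed
  qed
  then show ?thesis using that[of u C0] C1 vu uv by simp
qed

text \<open>The window \<open>G\<close> absorbs the chirp \<open>C\<^bsub>2a/b\<^esub>\<close>, and \<open>\<xi> = (\<omega> - a x) / b\<close> is the frequency at which
  the A-time-frequency shift by \<open>(x, \<omega>)\<close> acts.\<close>

definition A_window :: "real \<Rightarrow> real \<Rightarrow> (real \<Rightarrow> complex) \<Rightarrow> real \<Rightarrow> complex"
  where "A_window a b g = (\<lambda>t. echar (a / b * t\<^sup>2) * g (- t))"

lemma schwartz_A_window: "g \<in> schwartz \<Longrightarrow> A_window a b g \<in> schwartz"
  using schwartz_chirp_affine[of g "-1" "a / b" 0 0] by (simp add: A_window_def)

lemma A_window_nonzero:
  assumes "g \<noteq> 0"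
  shows "A_window a b g \<noteq> 0"
proof -
  obtain t where "g t \<noteq> 0" using assms by (auto simp: fun_eq_iff)
  then have "A_window a b g (- t) \<noteq> 0"
    using norm_echar[of "a / b * t\<^sup>2"] by (auto simp: A_window_def simp del: norm_echar)
  then show ?thesis by auto
qed

lemma cis_echar: "cis (2 * pi * x) = echar x"
  by (simp add: echar_def)

lemma echar_mult3_cong:
  "x + (y + z) = x' + (y' + z') \<Longrightarrow>
    echar x * (echar y * (echar z * w)) = echar x' * (echar y' * (echar z' * w))"
  by (simp only: mult.assoc[symmetric] echar_add[symmetric] add.assoc)

lemma norm_A_convolution:
  assumes b: "b \<noteq> 0" and g: "g \<in> schwartz" and f: "f \<in> tempered"
  shows "cmod (A_convolution a b f (A_modulation a b p \<omega> g) x) =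
    1 / sqrt \<bar>b\<bar> * cmod (f (tf_atom (A_window a b g) (x, (\<omega> - a * x) / b)))"
proof -
  define c where "c = (a * \<omega>\<^sup>2 - 2 * p * \<omega>) / (2 * b) + \<omega> * x / b"
  have "chirp (2 * a / b) (A_translation a b x (reflection (A_modulation a b p \<omega> g))) =
      (\<lambda>t. echar c * tf_atom (A_window a b g) (x, (\<omega> - a * x) / b) t)"
  proof
    fix t
    have e1: "pi * (2 * a / b) * t\<^sup>2 = 2 * pi * (a / b * t\<^sup>2)"
      by simp
    have e2: "- (2 * pi * a / b) * x * (t - x) = 2 * pi * (- (a / b) * x * (t - x))"
      by simp
    have e3: "pi / b * (a * \<omega>\<^sup>2 - 2 * p * \<omega> + 2 * \<omega> * - (t - x)) =
        2 * pi * ((a * \<omega>\<^sup>2 - 2 * p * \<omega>) / (2 * b) + \<omega> * (x - t) / b)"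
      using b by (simp add: field_simps)
    \<comment> \<open>Collecting the exponents by their dependence on t: the chirp of the window,
      recentred at x, takes the quadratic part, the linear rest has slope -(\<omega> - a x) / b, and
      what remains is the constant c.\<close>
    have e4: "a / b * t\<^sup>2 + (- (a / b) * x * (t - x) + ((a * \<omega>\<^sup>2 - 2 * p * \<omega>) / (2 * b) + \<omega> * (x - t) / b))
      = c + (- ((\<omega> - a * x) / b) * t + a / b * (t - x)\<^sup>2)"
      unfolding c_def using b by (simp add: field_simps power2_eq_square)
    show "chirp (2 * a / b) (A_translation a b x (reflection (A_modulation a b p \<omega> g))) t =
        echar c * tf_atom (A_window a b g) (x, (\<omega> - a * x) / b) t"
      unfolding chirp_def A_translation_def reflection_def A_modulation_def tf_atom_def A_window_def
        fst_conv snd_conv e1 e2 e3 cis_echar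
      by (rule echar_mult3_cong[OF e4])
  qed
  then have "f (chirp (2 * a / b) (A_translation a b x (reflection (A_modulation a b p \<omega> g)))) =
      echar c * f (tf_atom (A_window a b g) (x, (\<omega> - a * x) / b))"
    by (simp add: tempered_scale[OF f schwartz_tf_atom[OF schwartz_A_window[OF g]]])
  then show ?thesis
    by (simp add: A_convolution_def norm_mult norm_divide)
qed

text \<open>The modulations by - a x / b and \<omega> / b act on the test function one after the
  other and merge into a single frequency; the remaining scalars are unimodular.\<close>

lemma A_shift_dist:
  assumes b: "b \<noteq> 0"
  obtains c where "cmod c = 1"
    "A_modulation_dist a b p \<omega> (A_translation_dist a b x f) = (\<lambda>\<phi>. c * dist_shift (x, (\<omega> - a * x) / b) f \<phi>)"
proof -
  define c where "c = cis (pi / b * (a * \<omega>\<^sup>2 - 2 * p * \<omega>)) * cis (2 * pi * a * x\<^sup>2 / b)"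
  have "translation (- x) (modulation (- (a * x / b)) (modulation (\<omega> / b) \<phi>)) =
      (\<lambda>t. echar ((\<omega> - a * x) / b * (t + x)) * \<phi> (t + x))" for \<phi>
  proof
    fix t
    have "- (a * x / b) * (t + x) + \<omega> / b * (t + x) = (\<omega> - a * x) / b * (t + x)"
      using b by (simp add: field_simps)
    then have "echar (- (a * x / b) * (t + x)) * echar (\<omega> / b * (t + x)) = echar ((\<omega> - a * x) / b * (t + x))"
      by (simp only: echar_add[symmetric])
    then show "translation (- x) (modulation (- (a * x / b)) (modulation (\<omega> / b) \<phi>)) t =
      echar ((\<omega> - a * x) / b * (t + x)) * \<phi> (t + x)"
      unfolding translation_def modulation_def echar_def
      by (simp only: diff_minus_eq_add mult.assoc[symmetric])
  qed
  then have "A_modulation_dist a b p \<omega> (A_translation_dist a b x f) = (\<lambda>\<phi>. c * dist_shift (x, (\<omega> - a * x) / b) f \<phi>)"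
    unfolding A_modulation_dist_def A_translation_dist_def fscale_def modulation_dist_def
        translation_dist_def dist_shift_def c_def fst_conv snd_conv
    by (simp only: mult.assoc)
  moreover have "cmod c = 1" by (simp add: c_def norm_mult)
  ultimately show ?thesis using that by blast
qed

text \<open>For fixed x the substitution \<omega> = a x + b \<xi> has Jacobian \<bar>b\<bar>, which
  combines with the factor 1 / sqrt \<bar>b\<bar> of the A-convolution to sqrt
  \<bar>b\<bar>.\<close>

lemma (in tf_weight) M1_ennnorm_equivalent:
  assumes b: "b \<noteq> 0" and g: "g \<in> schwartz" and f: "f \<in> tempered"
    and vu: "\<And>x \<xi>. v (x, b * \<xi> + a * x) \<le> u (x, \<xi>)" "\<And>x \<xi>. u (x, \<xi>) \<le> C * v (x, b * \<xi> + a * x)" and C: "C > 0"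
  shows "M1_ennnorm a b p v g f \<le> ennreal (sqrt \<bar>b\<bar>) * mass (stft (A_window a b g) f)"
    and "ennreal (1 / C) * (ennreal (sqrt \<bar>b\<bar>) * mass (stft (A_window a b g) f)) \<le> M1_ennnorm a b p v g f"
proof -
  let ?V = "stft (A_window a b g) f"
  have [measurable]: "?V \<in> borel_measurable borel"
    by (rule borel_measurable_continuous_onI[OF continuous_on_tempered_atom[OF schwartz_A_window[OF g] f]])
  define s where "s = 1 / sqrt \<bar>b\<bar>"
  have s: "s > 0" "s * \<bar>b\<bar> = sqrt \<bar>b\<bar>"
    using b by (simp_all add: s_def real_div_sqrt)
  \<comment> \<open>Fubini is applied to this integrand, which carries the Borel weight u. The
    integral with v is compared with it pointwise and never rearranged.\<close>
  define J where "J = (\<lambda>x \<omega>. ennreal (s * (cmod (?V (x, (\<omega> - a * x) / b)) * u (x, (\<omega> - a * x) / b))))"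
  have Vm: "(\<lambda>p. ?V (fst p, (snd p - a * fst p) / b)) \<in> borel_measurable borel"
    and um: "(\<lambda>p. u (fst p, (snd p - a * fst p) / b)) \<in> borel_measurable borel"
  proof -
    have "(\<lambda>p. (fst p, (snd p - a * fst p) / b)) \<in> borel \<rightarrow>\<^sub>M (borel :: (real \<times> real) measure)"
      using b by (intro borel_measurable_continuous_onI continuous_intros) auto
    from measurable_compose[OF this] show "(\<lambda>p. ?V (fst p, (snd p - a * fst p) / b)) \<in> borel_measurable borel"
      "(\<lambda>p. u (fst p, (snd p - a * fst p) / b)) \<in> borel_measurable borel"
      by measurable
  qed
  have Jm: "(\<lambda>p. J (fst p) (snd p)) \<in> borel_measurable borel"
    unfolding J_def using Vm um by measurable
  have J: "(\<integral>\<^sup>+\<omega>. \<integral>\<^sup>+x. J x \<omega> \<partial>lborel \<partial>lborel) = ennreal (sqrt \<bar>b\<bar>) * mass ?V"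
  proof -
    have "(\<integral>\<^sup>+\<omega>. \<integral>\<^sup>+x. J x \<omega> \<partial>lborel \<partial>lborel) = (\<integral>\<^sup>+x. \<integral>\<^sup>+\<omega>. J x \<omega> \<partial>lborel \<partial>lborel)"
      using Jm by (intro lborel_pair.Fubini') (simp add: lborel_prod split_beta')
    also have "\<dots> = (\<integral>\<^sup>+x. \<integral>\<^sup>+\<xi>. ennreal (sqrt \<bar>b\<bar>) * ennreal (cmod (?V (x, \<xi>)) * u (x, \<xi>)) \<partial>lborel \<partial>lborel)"
    proof (rule nn_integral_cong)
      fix x
      have Jx: "J x \<in> borel_measurable borel"
      proof -
        have "(\<lambda>\<omega>::real. (x, \<omega>)) \<in> borel \<rightarrow>\<^sub>M borel"
          by (intro borel_measurable_continuous_onI continuous_intros)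
        from measurable_compose[OF this Jm] show ?thesis by simp
      qed
      have pt: "ennreal \<bar>b\<bar> * J x (a * x + b * \<xi>) = ennreal (sqrt \<bar>b\<bar>) * ennreal (cmod (?V (x, \<xi>)) * u (x, \<xi>))" for \<xi>
      proof -
        have "J x (a * x + b * \<xi>) = ennreal (s * (cmod (?V (x, \<xi>)) * u (x, \<xi>)))"
          using b by (simp add: J_def)
        then have "ennreal \<bar>b\<bar> * J x (a * x + b * \<xi>) = ennreal (\<bar>b\<bar> * (s * (cmod (?V (x, \<xi>)) * u (x, \<xi>))))"
          using s(1) by (subst ennreal_mult) (auto intro!: mult_nonneg_nonneg)
        also have "\<bar>b\<bar> * (s * (cmod (?V (x, \<xi>)) * u (x, \<xi>))) = sqrt \<bar>b\<bar> * (cmod (?V (x, \<xi>)) * u (x, \<xi>))"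
          unfolding s(2)[symmetric] by simp
        finally show ?thesis by (simp add: ennreal_mult mult_nonneg_nonneg)
      qed
      have "(\<integral>\<^sup>+\<omega>. J x \<omega> \<partial>lborel) = ennreal \<bar>b\<bar> * (\<integral>\<^sup>+\<xi>. J x (a * x + b * \<xi>) \<partial>lborel)"
        by (rule nn_integral_real_affine[OF Jx b])
      also have "\<dots> = (\<integral>\<^sup>+\<xi>. ennreal \<bar>b\<bar> * J x (a * x + b * \<xi>) \<partial>lborel)"
        using measurable_compose[OF _ Jx, of "\<lambda>\<xi>. a * x + b * \<xi>" borel]
        by (intro nn_integral_cmult[symmetric]) simp
      finally show "(\<integral>\<^sup>+\<omega>. J x \<omega> \<partial>lborel) = (\<integral>\<^sup>+\<xi>. ennreal (sqrt \<bar>b\<bar>) * ennreal (cmod (?V (x, \<xi>)) * u (x, \<xi>)) \<partial>lborel)"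
        by (simp only: pt)
    qed
    also have "\<dots> = (\<integral>\<^sup>+z. ennreal (sqrt \<bar>b\<bar>) * ennreal (cmod (?V z) * u z) \<partial>(lborel \<Otimes>\<^sub>M lborel))"
      by (rule lborel.nn_integral_fst) (simp add: lborel_prod)
    also have "\<dots> = ennreal (sqrt \<bar>b\<bar>) * mass ?V"
      unfolding lborel_prod mass_def by (rule nn_integral_cmult) measurable
    finally show ?thesis .
  qed
  \<comment> \<open>\<open>nn_integral\<close> takes the same value over a measure and over its
    completion, so the integrals pass from \<open>lebesgue\<close> to \<open>lborel\<close>.\<close>
  have norm_eq: "M1_ennnorm a b p v g f =
      (\<integral>\<^sup>+\<omega>. \<integral>\<^sup>+x. ennreal (s * cmod (?V (x, (\<omega> - a * x) / b)) * v (x, \<omega>)) \<partial>lborel \<partial>lborel)"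
    unfolding M1_ennnorm_def nn_integral_completion norm_A_convolution[OF b g f] s_def ..
  have v1: "v (x, \<omega>) \<le> u (x, (\<omega> - a * x) / b)" "u (x, (\<omega> - a * x) / b) \<le> C * v (x, \<omega>)" for x \<omega>
    using vu[of x "(\<omega> - a * x) / b"] b by simp_all
  show "M1_ennnorm a b p v g f \<le> ennreal (sqrt \<bar>b\<bar>) * mass ?V"
    unfolding norm_eq J[symmetric] J_def
    using s(1) v1(1) by (intro nn_integral_mono ennreal_leI) (simp add: mult.assoc mult_left_mono)
  have "ennreal (1 / C) * (ennreal (sqrt \<bar>b\<bar>) * mass ?V) =
      (\<integral>\<^sup>+\<omega>. \<integral>\<^sup>+x. ennreal (1 / C) * J x \<omega> \<partial>lborel \<partial>lborel)"
  proof -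
    have 1: "(\<lambda>\<omega>. \<integral>\<^sup>+x. J x \<omega> \<partial>lborel) \<in> borel_measurable lborel"
      using measurable_compose[OF measurable_pair_swap' Jm[folded borel_prod]]
      by (intro lborel.borel_measurable_nn_integral) (simp add: split_beta' lborel_prod borel_prod)
    have 2: "(\<lambda>x. J x \<omega>) \<in> borel_measurable lborel" for \<omega>
    proof -
      have "(\<lambda>x::real. (x, \<omega>)) \<in> borel \<rightarrow>\<^sub>M borel"
        by (intro borel_measurable_continuous_onI continuous_intros)
      from measurable_compose[OF this Jm] show ?thesis by simp
    qed
    show ?thesis
      unfolding J[symmetric] using 1 2 by (simp add: nn_integral_cmult)
  qed
  also have "\<dots> \<le> M1_ennnorm a b p v g f"
    unfolding norm_eq
  proof (intro nn_integral_mono)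
    fix \<omega> x
    let ?c = "cmod (?V (x, (\<omega> - a * x) / b))"
    have "1 / C * u (x, (\<omega> - a * x) / b) \<le> v (x, \<omega>)"
      using v1(2)[of x \<omega>] C by (simp add: field_simps)
    then have "s * ?c * (1 / C * u (x, (\<omega> - a * x) / b)) \<le> s * ?c * v (x, \<omega>)"
      using s(1) by (intro mult_left_mono) auto
    then have "ennreal (1 / C * (s * (?c * u (x, (\<omega> - a * x) / b)))) \<le> ennreal (s * ?c * v (x, \<omega>))"
      by (intro ennreal_leI) (simp add: mult_ac)
    also have "ennreal (1 / C * (s * (?c * u (x, (\<omega> - a * x) / b)))) = ennreal (1 / C) * J x \<omega>"
      unfolding J_def using C s(1) by (intro ennreal_mult) (auto intro!: mult_nonneg_nonneg)
    finally show "ennreal (1 / C) * J x \<omega> \<le> ennreal (s * ?c * v (x, \<omega>))" .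
  qed
  finally show "ennreal (1 / C) * (ennreal (sqrt \<bar>b\<bar>) * mass ?V) \<le> M1_ennnorm a b p v g f" .
qed


section \<open>Topological embeddings as norm estimates\<close>

text \<open>The distributions with \<bar>\<Lambda> \<phi>\<bar> < 1 form a weak-* open set, whose
  trace on B contains a ball of N around 0. Homogeneity of N turns the ball into a bound.\<close>

lemma evaluation_bound_of_embedding:
  assumes banach: "complex_banach_space B N"
    and emb: "continuously_embedded (norm_topology B N) tempered_topology" and \<phi>: "\<phi> \<in> schwartz"
  shows "\<exists>C. \<forall>\<Lambda>\<in>B. norm (\<Lambda> \<phi>) \<le> C * N \<Lambda>"
proof -
  have sub: "cfun.subspace B" and Npos: "\<And>f. f \<in> B \<Longrightarrow> 0 \<le> N f"
    and Nsc: "\<And>c f. f \<in> B \<Longrightarrow> N (fscale c f) = cmod c * N f"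
    using banach by (simp_all add: complex_banach_space_def)
  have BT: "B \<subseteq> tempered"
    using emb by (simp add: continuously_embedded_def tempered_topology_def topspace_seminorm_topology)
  let ?U = "{\<Lambda> \<in> tempered. cmod (\<Lambda> \<phi>) < 1}"
  have "openin tempered_topology ?U"
    unfolding tempered_topology_def openin_seminorm_topology
  proof (intro conjI ballI)
    fix f assume f: "f \<in> ?U"
    show "\<exists>F e. finite F \<and> F \<subseteq> (\<lambda>\<phi> \<Lambda>. cmod (\<Lambda> \<phi>)) ` schwartz \<and> 0 < e \<and>
        {h \<in> tempered. \<forall>r\<in>F. r (h - f) < e} \<subseteq> ?U"
    proof (intro exI[of _ "{\<lambda>\<Lambda>. cmod (\<Lambda> \<phi>)}"] exI[of _ "1 - cmod (f \<phi>)"] conjI subsetI)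
      fix h assume "h \<in> {h \<in> tempered. \<forall>r\<in>{\<lambda>\<Lambda>. cmod (\<Lambda> \<phi>)}. r (h - f) < 1 - cmod (f \<phi>)}"
      then show "h \<in> ?U" using norm_triangle_sub[of "h \<phi>" "f \<phi>"] by auto
    qed (use f \<phi> in auto)
  qed auto
  moreover have "continuous_map (norm_topology B N) tempered_topology (\<lambda>x. x)"
    using emb by (simp add: continuously_embedded_def)
  ultimately have "openin (norm_topology B N) {\<Lambda> \<in> topspace (norm_topology B N). \<Lambda> \<in> ?U}"
    using openin_continuous_map_preimage by blast
  then have op: "openin (norm_topology B N) {\<Lambda> \<in> B. \<Lambda> \<in> ?U}"
    by (simp only: topspace_seminorm_topology)
  have 0: "0 \<in> B" by (rule cfun.subspace_0[OF sub])
  then have "0 \<in> {\<Lambda> \<in> B. \<Lambda> \<in> ?U}" using BT by auto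
  then obtain F e where F: "finite F" "F \<subseteq> {N}" "0 < e" "{h \<in> B. \<forall>r\<in>F. r (h - 0) < e} \<subseteq> {\<Lambda> \<in> B. \<Lambda> \<in> ?U}"
    using op unfolding openin_seminorm_topology by meson
  have small: "cmod (\<Lambda> \<phi>) < 1" if "\<Lambda> \<in> B" "N \<Lambda> < e" for \<Lambda>
  proof -
    \<comment> \<open>F is either empty or the set containing N alone; in both cases an N-norm below
      e suffices.\<close>
    have "\<Lambda> \<in> {h \<in> B. \<forall>r\<in>F. r (h - 0) < e}" using F(2) that by auto
    then show ?thesis using F(4) by auto
  qed
  have "norm (\<Lambda> \<phi>) \<le> 1 / e * N \<Lambda>" if \<Lambda>: "\<Lambda> \<in> B" for \<Lambda>
  proof -
    have "norm (\<Lambda> \<phi>) * e \<le> \<tau>" if \<tau>: "N \<Lambda> < \<tau>" for \<tau>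
    proof -
      have \<tau>0: "\<tau> > 0" using Npos[OF \<Lambda>] \<tau> by linarith
      define c where "c = complex_of_real (e / \<tau>)"
      have c: "cmod c = e / \<tau>" unfolding c_def norm_of_real using F(3) \<tau>0 by simp
      have "N (fscale c \<Lambda>) < e"
        unfolding Nsc[OF \<Lambda>] c using F(3) \<tau>0 \<tau> by (simp add: field_simps)
      then have "cmod (fscale c \<Lambda> \<phi>) < 1"
        by (intro small cfun.subspace_scale[OF sub \<Lambda>])
      then have "e / \<tau> * norm (\<Lambda> \<phi>) < 1" by (simp add: fscale_def norm_mult c)
      then show ?thesis using \<tau>0 by (simp add: field_simps)
    qed
    then have "norm (\<Lambda> \<phi>) * e \<le> N \<Lambda>" by (rule dense_ge)
    then show ?thesis using F(3) by (simp add: field_simps)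
  qed
  then show ?thesis by blast
qed

text \<open>Continuity at f is the estimate applied to h - f, which is why V has to be closed under
  differences.\<close>

lemma norm_topology_embedding:
  assumes "V \<subseteq> B" and diff: "\<And>f h. f \<in> V \<Longrightarrow> h \<in> V \<Longrightarrow> h - f \<in> V"
    and K: "K \<ge> 0" "\<And>f \<tau>. f \<in> V \<Longrightarrow> 0 < \<tau> \<Longrightarrow> M f \<le> \<tau> \<Longrightarrow> N f \<le> K * \<tau>"
  shows "continuously_embedded (norm_topology V M) (norm_topology B N)"
  unfolding continuously_embedded_def continuous_map_def topspace_seminorm_topology
proof (intro conjI allI impI)
  show "V \<subseteq> B" "(\<lambda>x. x) \<in> V \<rightarrow> B" using assms(1) by auto
  fix U assume U: "openin (norm_topology B N) U"
  show "openin (norm_topology V M) {x \<in> V. x \<in> U}"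
    unfolding openin_seminorm_topology
  proof (intro conjI ballI)
    fix f assume "f \<in> {x \<in> V. x \<in> U}"
    then have f: "f \<in> V" "f \<in> U" by auto
    then obtain F e where F: "F \<subseteq> {N}" "0 < e" "{h \<in> B. \<forall>r\<in>F. r (h - f) < e} \<subseteq> U"
      using U unfolding openin_seminorm_topology by meson
    \<comment> \<open>K may be 0, so the radius is divided by K + 1, which also makes
      \<open>K * d\<close> strictly smaller than e.\<close>
    define d where "d = e / (K + 1)"
    have d: "d > 0" "K * d < e"
      using K(1) F(2) by (simp_all add: d_def field_simps)
    have "{h \<in> V. \<forall>r\<in>{M}. r (h - f) < d} \<subseteq> {x \<in> V. x \<in> U}"
    proof
      fix h assume "h \<in> {h \<in> V. \<forall>r\<in>{M}. r (h - f) < d}"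
      then have h: "h \<in> V" "M (h - f) \<le> d" by auto
      have "N (h - f) < e"
        using K(2)[OF diff[OF f(1) h(1)] d(1) h(2)] d(2) by linarith
      then have "h \<in> {h \<in> B. \<forall>r\<in>F. r (h - f) < e}" using F(1) h(1) assms(1) by auto
      then show "h \<in> {x \<in> V. x \<in> U}" using F(3) h(1) by auto
    qed
    then show "\<exists>F e. finite F \<and> F \<subseteq> {M} \<and> 0 < e \<and> {h \<in> V. \<forall>r\<in>F. r (h - f) < e} \<subseteq> {x \<in> V. x \<in> U}"
      using d(1) by (intro exI[of _ "{M}"] exI[of _ d]) auto
  qed auto
qed

theorem theorem5p12:
  fixes a b c d p q :: real
    and v :: "real \<times> real \<Rightarrow> real"
    and g :: "real \<Rightarrow> complex"
    and B :: "distribution set"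
    and N :: "distribution \<Rightarrow> real"
  assumes "a * d - b * c = 1" and "b \<noteq> 0"
    and "g \<in> schwartz" and "g \<noteq> 0"
    and "weight v" and "submultiplicative v" and "polynomial_growth v"
    and "complex_banach_space B N"
    and "continuously_embedded (norm_topology B N) tempered_topology"
    and "\<And>f x \<omega>. f \<in> B \<Longrightarrow>
      A_modulation_dist a b p \<omega> (A_translation_dist a b x f) \<in> B \<and>
      N (A_modulation_dist a b p \<omega> (A_translation_dist a b x f)) \<le> v (x, \<omega>) * N f"
    and "M1 a b p v g \<inter> B \<noteq> {0}"
  shows "continuously_embedded (norm_topology (M1 a b p v g) (M1_norm a b p v g)) (norm_topology B N)"
proof -
  note b = \<open>b \<noteq> 0\<close> and g = \<open>g \<in> schwartz\<close> and banach = \<open>complex_banach_space B N\<close>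
  have vpos: "0 < v z" for z using \<open>weight v\<close> unfolding weight_def by blast
  note v1 = weight_ge_1[OF vpos \<open>submultiplicative v\<close> \<open>polynomial_growth v\<close>]
  \<comment> \<open>This is v in the coordinates (x, \<xi>) of the ordinary shifts. The change
    \<omega> = b \<xi> + a x is linear, so submultiplicativity carries over.\<close>
  define v' where "v' = (\<lambda>z. v (fst z, b * snd z + a * fst z))"
  obtain u C where u: "tf_weight u" "C > 0" "\<And>z. v' z \<le> u z" "\<And>z. u z \<le> C * v' z"
  proof (rule tf_weight_regularization[of v'])
    show "1 \<le> v' z" for z by (simp add: v'_def v1)
    show "v' (z + z') \<le> v' z * v' z'" for z z'
    proof -
      have "b * snd (z + z') + a * fst (z + z') = (b * snd z + a * fst z) + (b * snd z' + a * fst z')"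
        by (simp add: algebra_simps)
      then show ?thesis
        using \<open>submultiplicative v\<close> unfolding submultiplicative_def v'_def fst_add by metis
    qed
    show "\<exists>C. \<forall>z. norm z \<le> R \<longrightarrow> v' z \<le> C" for R
    proof -
      obtain C k where C: "C > 0" "k \<ge> 0" "\<And>x \<omega>. v (x, \<omega>) \<le> C * (1 + \<bar>x\<bar> + \<bar>\<omega>\<bar>) powr k"
        using \<open>polynomial_growth v\<close> unfolding polynomial_growth_def by auto
      have "v' z \<le> C * (1 + R + (\<bar>b\<bar> * R + \<bar>a\<bar> * R)) powr k" if z: "norm z \<le> R" for z
      proof -
        have fs: "\<bar>fst z\<bar> \<le> R" "\<bar>snd z\<bar> \<le> R"
          using norm_fst_le[of "fst z" "snd z"] norm_snd_le[of "snd z" "fst z"] z by auto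
        have "\<bar>b * snd z + a * fst z\<bar> \<le> \<bar>b\<bar> * \<bar>snd z\<bar> + \<bar>a\<bar> * \<bar>fst z\<bar>"
          by (rule order_trans[OF abs_triangle_ineq]) (simp add: abs_mult)
        also have "\<dots> \<le> \<bar>b\<bar> * R + \<bar>a\<bar> * R"
          using fs by (intro add_mono mult_left_mono) auto
        finally have "1 + \<bar>fst z\<bar> + \<bar>b * snd z + a * fst z\<bar> \<le> 1 + R + (\<bar>b\<bar> * R + \<bar>a\<bar> * R)"
          using fs by linarith
        then have "C * (1 + \<bar>fst z\<bar> + \<bar>b * snd z + a * fst z\<bar>) powr k \<le> C * (1 + R + (\<bar>b\<bar> * R + \<bar>a\<bar> * R)) powr k"
          using C(1,2) by (intro mult_left_mono powr_mono2) auto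
        then show ?thesis
          using C(3)[of "fst z" "b * snd z + a * fst z"] unfolding v'_def by linarith
      qed
      then show ?thesis by blast
    qed
  qed (rule that)
  interpret banach_distributions B N
  proof
    show "complex_banach_space B N" by fact
    show "B \<subseteq> tempered"
      using assms(9) by (simp add: continuously_embedded_def tempered_topology_def topspace_seminorm_topology)
    show "\<exists>C. \<forall>\<Lambda>\<in>B. norm (\<Lambda> \<phi>) \<le> C * N \<Lambda>" if "\<phi> \<in> schwartz" for \<phi>
      using banach assms(9) that by (rule evaluation_bound_of_embedding)
  qed
  interpret tf_weight u by (rule u(1))
  have shift: "dist_shift z h \<in> B \<and> N (dist_shift z h) \<le> u z * N h" if h: "h \<in> B" for z h
  proof -
    \<comment> \<open>With this frequency the A-shift is the ordinary shift by z up to a unimodular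
      factor c, which is removed by homogeneity of N.\<close>
    define \<omega> where "\<omega> = b * snd z + a * fst z"
    have z: "(fst z, (\<omega> - a * fst z) / b) = z" using b by (simp add: \<omega>_def)
    obtain c where c: "cmod c = 1"
      "A_modulation_dist a b p \<omega> (A_translation_dist a b (fst z) h) = (\<lambda>\<phi>. c * dist_shift z h \<phi>)"
      using that by (rule A_shift_dist[OF b, where p = p and \<omega> = \<omega> and a = a and x = "fst z" and f = h, unfolded z])
    have A: "(\<lambda>\<phi>. c * dist_shift z h \<phi>) \<in> B" "N (\<lambda>\<phi>. c * dist_shift z h \<phi>) \<le> v (fst z, \<omega>) * N h"
      using assms(10)[OF h, of \<omega> "fst z"] unfolding c(2) by auto
    have "c \<noteq> 0" using c(1) by auto
    then have eq: "(\<lambda>\<phi>. inverse c * (c * dist_shift z h \<phi>)) = dist_shift z h"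
      by (simp add: mult.assoc[symmetric])
    have "N (dist_shift z h) = N (\<lambda>\<phi>. c * dist_shift z h \<phi>)"
      using N_scale[OF A(1), of "inverse c"] unfolding eq by (simp add: norm_inverse c(1))
    also have "\<dots> \<le> v' z * N h" using A(2) by (simp add: v'_def \<omega>_def)
    also have "\<dots> \<le> u z * N h" by (intro mult_right_mono u N_nonneg h)
    finally show ?thesis using B_scale[OF A(1), of "inverse c"] unfolding eq by simp
  qed
  interpret invariant_banach B N u
    by unfold_locales (use shift in auto)
  let ?G = "A_window a b g"
  have G: "?G \<in> schwartz" by (rule schwartz_A_window[OF g])
  let ?m = "\<lambda>f. mass (stft ?G f)"
  have vu: "v (x, b * \<xi> + a * x) \<le> u (x, \<xi>)" "u (x, \<xi>) \<le> C * v (x, b * \<xi> + a * x)" for x \<xi>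
    using u(3)[of "(x, \<xi>)"] u(4)[of "(x, \<xi>)"] by (simp_all add: v'_def)
  note eqv = M1_ennnorm_equivalent[OF b g _ vu u(2), of _ p]
  have fin: "M1_ennnorm a b p v g f < \<infinity> \<longleftrightarrow> ?m f < \<infinity>" if f: "f \<in> tempered" for f
  proof
    assume "M1_ennnorm a b p v g f < \<infinity>"
    then have "ennreal (1 / C) * (ennreal (sqrt \<bar>b\<bar>) * ?m f) < \<infinity>"
      using eqv(2)[OF f] by (rule order_le_less_trans[rotated])
    then show "?m f < \<infinity>"
      using b u(2) by (auto simp: ennreal_mult_less_top ennreal_eq_0_iff)
  next
    assume "?m f < \<infinity>"
    then have "ennreal (sqrt \<bar>b\<bar>) * ?m f < \<infinity>" by (simp add: ennreal_mult_less_top)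
    then show "M1_ennnorm a b p v g f < \<infinity>"
      by (rule order_le_less_trans[OF eqv(1)[OF f]])
  qed
  \<comment> \<open>An intersection different from {0} could be empty as a set. Since 0 belongs to
    it, some nonzero element does too.\<close>
  have "\<exists>h. h \<in> M1 a b p v g \<inter> B \<and> h \<noteq> 0"
  proof (rule ccontr)
    assume "\<not> ?thesis"
    moreover have "0 \<in> M1 a b p v g \<inter> B"
    proof -
      have 0: "0 \<in> B" using B_zero by (simp add: zero_fun_def)
      moreover have "?m 0 = 0" by (simp add: mass_def)
      ultimately show ?thesis using fin[of 0] B_tempered by (auto simp: M1_def)
    qed
    ultimately show False using assms(11) by blast
  qed
  then obtain h where h: "h \<in> B" "h \<noteq> 0" "?m h < \<infinity>"
    using fin B_tempered by (auto simp: M1_def)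
  obtain K where K: "K \<ge> 0" "\<And>f \<tau>. f \<in> tempered \<Longrightarrow> \<tau> > 0 \<Longrightarrow> ?m f \<le> ennreal \<tau> \<Longrightarrow> f \<in> B \<and> N f \<le> K * \<tau>"
    using minimality[OF G A_window_nonzero[OF assms(4)] h] by blast
  \<comment> \<open>The factor undoes sqrt \<bar>b\<bar> / C, the lower constant in the comparison
    of the M1 norm with the mass.\<close>
  define K' where "K' = K * (C / sqrt \<bar>b\<bar>)"
  have main: "f \<in> B \<and> N f \<le> K' * \<tau>"
    if f: "f \<in> tempered" and \<tau>: "\<tau> > 0" and m: "M1_ennnorm a b p v g f \<le> ennreal \<tau>" for f \<tau>
  proof -
    have le: "ennreal (1 / C) * (ennreal (sqrt \<bar>b\<bar>) * ?m f) \<le> ennreal \<tau>"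
      using eqv(2)[OF f] m by (rule order_trans)
    have "ennreal (C / sqrt \<bar>b\<bar>) * (ennreal (1 / C) * (ennreal (sqrt \<bar>b\<bar>) * ?m f)) \<le> ennreal (C / sqrt \<bar>b\<bar>) * ennreal \<tau>"
      by (rule mult_left_mono[OF le]) simp
    moreover have "ennreal (C / sqrt \<bar>b\<bar>) * (ennreal (1 / C) * (ennreal (sqrt \<bar>b\<bar>) * ?m f)) = ?m f"
      using b u(2) by (simp add: mult.assoc[symmetric] flip: ennreal_mult)
    moreover have "ennreal (C / sqrt \<bar>b\<bar>) * ennreal \<tau> = ennreal (C / sqrt \<bar>b\<bar> * \<tau>)"
      using u(2) \<tau> by (intro ennreal_mult[symmetric]) auto
    ultimately have "?m f \<le> ennreal (C / sqrt \<bar>b\<bar> * \<tau>)" by simp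
    moreover have "C / sqrt \<bar>b\<bar> * \<tau> > 0" using u(2) \<tau> b by simp
    ultimately show ?thesis using K(2)[OF f] by (fastforce simp: K'_def mult.assoc)
  qed
  show ?thesis
  proof (rule norm_topology_embedding)
    show "0 \<le> K'" using K(1) u(2) by (simp add: K'_def)
    show "M1 a b p v g \<subseteq> B"
    proof
      fix f assume "f \<in> M1 a b p v g"
      then have f: "f \<in> tempered" "M1_ennnorm a b p v g f < \<infinity>" by (auto simp: M1_def)
      then obtain r where "r \<ge> 0" "M1_ennnorm a b p v g f = ennreal r"
        by (cases "M1_ennnorm a b p v g f") auto
      \<comment> \<open>The norm r may be 0 while the estimate asks for a positive bound, hence r +
        1.\<close>
      then have "M1_ennnorm a b p v g f \<le> ennreal (r + 1)" by (simp add: ennreal_leI)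
      then show "f \<in> B" using main[OF f(1), of "r + 1"] \<open>r \<ge> 0\<close> by auto
    qed
    show "N f \<le> K' * \<tau>" if "f \<in> M1 a b p v g" "0 < \<tau>" "M1_norm a b p v g f \<le> \<tau>" for f \<tau>
    proof -
      have f: "f \<in> tempered" "M1_ennnorm a b p v g f < \<infinity>" using that(1) by (auto simp: M1_def)
      have "M1_ennnorm a b p v g f = ennreal (M1_norm a b p v g f)"
        using f(2) by (simp add: M1_norm_def)
      then have "M1_ennnorm a b p v g f \<le> ennreal \<tau>" using that(3) by (simp add: ennreal_leI)
      then show ?thesis using main[OF f(1) that(2)] by blast
    qed
    \<comment> \<open>Differences are estimated through the mass, whose integrands are Borel
      measurable, so that its integral is additive; \<open>fin\<close> translates the result
      back.\<close>
    show "h - f \<in> M1 a b p v g" if "f \<in> M1 a b p v g" "h \<in> M1 a b p v g" for f h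
    proof -
      have t: "f \<in> tempered" "h \<in> tempered" and m: "?m f < \<infinity>" "?m h < \<infinity>"
        using that fin by (auto simp: M1_def)
      have eq: "h - f = (\<lambda>\<phi>. h \<phi> - f \<phi>)" by (simp add: fun_eq_iff)
      have td: "h - f \<in> tempered" unfolding eq by (rule tempered_diff_closed[OF t(2,1)])
      have Vm: "(stft ?G f) \<in> borel_measurable borel" if "f \<in> tempered" for f
        by (rule borel_measurable_continuous_onI[OF continuous_on_tempered_atom[OF G that]])
      have "?m (h - f) \<le> (\<integral>\<^sup>+z. ennreal (norm (h (tf_atom ?G z)) * u z) + ennreal (norm (f (tf_atom ?G z)) * u z) \<partial>lborel)"
        unfolding mass_def
      proof (rule nn_integral_mono)
        fix z
        have "norm (h (tf_atom ?G z) - f (tf_atom ?G z)) * u z \<le> (norm (h (tf_atom ?G z)) + norm (f (tf_atom ?G z))) * u z"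
          by (intro mult_right_mono norm_triangle_ineq4) auto
        then show "ennreal (norm ((h - f) (tf_atom ?G z)) * u z) \<le>
            ennreal (norm (h (tf_atom ?G z)) * u z) + ennreal (norm (f (tf_atom ?G z)) * u z)"
          by (simp add: distrib_right ennreal_leI flip: ennreal_plus)
      qed
      also have "\<dots> = ?m h + ?m f"
      proof -
        note [measurable] = Vm[OF t(1)] Vm[OF t(2)]
        show ?thesis unfolding mass_def by (rule nn_integral_add; measurable)
      qed
      also have "\<dots> < \<infinity>" using m by simp
      finally show ?thesis using fin[OF td] td by (simp add: M1_def)
    qed
  qed
qed

end
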